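(* Let $(N,\hat\omega)$ be an almost symplectic submanifold of an almost Fedosov manifold $(M,\omega,\nabla^\omega)$. Then the induced connection $\tilde\nabla_XY:=(\nabla^\omega_XY)^\top$, $X,Y\in\Gamma(TN)$, is an almost symplectic connection on $(N,\hat\omega)$, i.e. $\tilde\nabla\hat\omega=0$. When $\nabla^\omega$ is torsion-free, $\tilde\nabla$ is a symplectic connection (torsion-free and preserving $\hat\omega$) on the symplectic submanifold $(N,\hat\omega)$.
   Context: An almost symplectic manifold $(M,\omega)$ is a manifold with a non-degenerate 2-form $\omega$. An almost symplectic connection is an affine connection $\nabla$ with $\nabla\omega=0$; it is called symplectic if it is also torsion-free. An almost Fedosov manifold $(M,\omega,\nabla^\omega)$ is an almost symplectic manifold with an almost symplectic connection (standing assumption: $\dim M>4$). A submanifold $\iota:N\to M$ (immersion) is almost symplectic if $\hat\omega:=\iota^*\omega$ is non-degenerate on $N$, and symplectic if moreover $d\hat\omega=0$. Then $TM|_N=TN\oplus\nu(N)$, where $\nu_x(N)=(T_xN)^{\perp_\omega}=\{u\in T_xM:\omega(u,v)=0\ \forall v\in T_xN\}$; $\top$ and $\perp$ denote the projections onto $TN$ and $\nu(N)$. *)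

theory Defs
  imports "HOL-Analysis.Analysis"
begin

section \<open>Smooth manifolds\<close>

primrec C_k_on :: "nat \<Rightarrow> 'a::real_normed_vector set \<Rightarrow> ('a \<Rightarrow> 'b::real_normed_vector) \<Rightarrow> bool"
  where
    "C_k_on 0 S g \<longleftrightarrow> continuous_on S g"
  | "C_k_on (Suc k) S g \<longleftrightarrow>
      (\<forall>x\<in>S. g differentiable (at x)) \<and> (\<forall>v. C_k_on k S (\<lambda>x. frechet_derivative g (at x) v))"

text \<open>Only used for open \<open>S\<close>.\<close>

definition smooth_on :: "'a::real_normed_vector set \<Rightarrow> ('a \<Rightarrow> 'b::real_normed_vector) \<Rightarrow> bool"
  where "smooth_on S g \<longleftrightarrow> (\<forall>k. C_k_on k S g)"

text \<open>A manifold is a whole Hausdorff, second countable type with a (not necessarily maximal)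
  smooth atlas. A chart is a pair \<open>(U, \<phi>)\<close>; the values of \<open>\<phi>\<close> outside \<open>U\<close> are irrelevant.
  The dimension is that of the model space.\<close>

type_synonym ('m, 'e) atlas = "('m set \<times> ('m \<Rightarrow> 'e)) set"

definition smooth_atlas ::
  "('m::{t2_space, second_countable_topology}, 'e::euclidean_space) atlas \<Rightarrow> bool"
  where "smooth_atlas A \<longleftrightarrow>
    (\<Union>(U, \<phi>)\<in>A. U) = UNIV \<and>
    (\<forall>(U, \<phi>)\<in>A. open U \<and> open (\<phi> ` U) \<and> homeomorphism U (\<phi> ` U) \<phi> (inv_into U \<phi>)) \<and>
    (\<forall>(U, \<phi>)\<in>A. \<forall>(V, \<psi>)\<in>A. smooth_on (\<phi> ` (U \<inter> V)) (\<psi> \<circ> inv_into U \<phi>))"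

definition smooth_functions :: "('m, 'e::euclidean_space) atlas \<Rightarrow> ('m \<Rightarrow> real) set"
  where "smooth_functions A = {f. \<forall>(U, \<phi>)\<in>A. smooth_on (\<phi> ` U) (f \<circ> inv_into U \<phi>)}"

definition smooth_map ::
  "('n::topological_space, 'd::euclidean_space) atlas \<Rightarrow>
   ('m::topological_space, 'e::euclidean_space) atlas \<Rightarrow> ('n \<Rightarrow> 'm) \<Rightarrow> bool"
  where "smooth_map B A \<iota> \<longleftrightarrow> continuous_on UNIV \<iota> \<and>
    (\<forall>(U, \<phi>)\<in>B. \<forall>(V, \<psi>)\<in>A. smooth_on (\<phi> ` (U \<inter> \<iota> -` V)) (\<psi> \<circ> \<iota> \<circ> inv_into U \<phi>))"


section \<open>Tangent vectors and vector fields\<close>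

text \<open>Tangent vectors are derivations of the algebra of smooth functions. They are extended
  by \<open>0\<close> to non-smooth functions, so that equal derivations are equal as HOL functions.\<close>

type_synonym 'm tvec = "('m \<Rightarrow> real) \<Rightarrow> real"

definition tangent_space :: "('m, 'e::euclidean_space) atlas \<Rightarrow> 'm \<Rightarrow> 'm tvec set"
  where "tangent_space A p = {v.
    (\<forall>f\<in>smooth_functions A. \<forall>g\<in>smooth_functions A. v (\<lambda>q. f q + g q) = v f + v g) \<and>
    (\<forall>c. \<forall>f\<in>smooth_functions A. v (\<lambda>q. c * f q) = c * v f) \<and>
    (\<forall>f\<in>smooth_functions A. \<forall>g\<in>smooth_functions A.
       v (\<lambda>q. f q * g q) = v f * g p + f p * v g) \<and>
    (\<forall>f. f \<notin> smooth_functions A \<longrightarrow> v f = 0)}"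

definition tangent_map :: "('m, 'e::euclidean_space) atlas \<Rightarrow> ('n \<Rightarrow> 'm) \<Rightarrow> 'n tvec \<Rightarrow> 'm tvec"
  where "tangent_map A \<iota> v = (\<lambda>f. if f \<in> smooth_functions A then v (f \<circ> \<iota>) else 0)"

definition immersion ::
  "('n::topological_space, 'd::euclidean_space) atlas \<Rightarrow>
   ('m::topological_space, 'e::euclidean_space) atlas \<Rightarrow> ('n \<Rightarrow> 'm) \<Rightarrow> bool"
  where "immersion B A \<iota> \<longleftrightarrow>
    smooth_map B A \<iota> \<and> (\<forall>x. inj_on (tangent_map A \<iota>) (tangent_space B x))"

type_synonym 'm vfield = "'m \<Rightarrow> 'm tvec"

definition vector_fields :: "('m, 'e::euclidean_space) atlas \<Rightarrow> 'm vfield set"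
  where "vector_fields A = {X. (\<forall>p. X p \<in> tangent_space A p) \<and>
    (\<forall>f\<in>smooth_functions A. (\<lambda>p. X p f) \<in> smooth_functions A)}"

definition lie_bracket :: "'m vfield \<Rightarrow> 'm vfield \<Rightarrow> 'm vfield"
  where "lie_bracket X Y = (\<lambda>p f. X p (\<lambda>q. Y q f) - Y p (\<lambda>q. X q f))"


section \<open>Two-forms\<close>

type_synonym 'm form2 = "'m \<Rightarrow> 'm tvec \<Rightarrow> 'm tvec \<Rightarrow> real"

definition two_form :: "('m, 'e::euclidean_space) atlas \<Rightarrow> 'm form2 \<Rightarrow> bool"
  where "two_form A \<omega> \<longleftrightarrow>
    (\<forall>p. \<forall>u\<in>tangent_space A p. \<forall>v\<in>tangent_space A p. \<forall>w\<in>tangent_space A p. \<forall>a b.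
       \<omega> p (\<lambda>f. a * u f + b * v f) w = a * \<omega> p u w + b * \<omega> p v w \<and>
       \<omega> p w (\<lambda>f. a * u f + b * v f) = a * \<omega> p w u + b * \<omega> p w v) \<and>
    (\<forall>p. \<forall>v\<in>tangent_space A p. \<omega> p v v = 0) \<and>
    (\<forall>X\<in>vector_fields A. \<forall>Y\<in>vector_fields A. (\<lambda>p. \<omega> p (X p) (Y p)) \<in> smooth_functions A)"

definition nondegenerate :: "('m, 'e::euclidean_space) atlas \<Rightarrow> 'm form2 \<Rightarrow> bool"
  where "nondegenerate A \<omega> \<longleftrightarrow>
    (\<forall>p. \<forall>u\<in>tangent_space A p. (\<forall>v\<in>tangent_space A p. \<omega> p u v = 0) \<longrightarrow> u = (\<lambda>f. 0))"

text \<open>Exterior derivative by the invariant formula, without the factor 1/3 that some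
  conventions put in front.\<close>

definition ext_deriv ::
  "'m form2 \<Rightarrow> 'm vfield \<Rightarrow> 'm vfield \<Rightarrow> 'm vfield \<Rightarrow> 'm \<Rightarrow> real"
  where "ext_deriv \<omega> X Y Z p =
    X p (\<lambda>q. \<omega> q (Y q) (Z q)) - Y p (\<lambda>q. \<omega> q (X q) (Z q)) + Z p (\<lambda>q. \<omega> q (X q) (Y q))
    - \<omega> p (lie_bracket X Y p) (Z p) + \<omega> p (lie_bracket X Z p) (Y p)
    - \<omega> p (lie_bracket Y Z p) (X p)"

definition closed_form :: "('m, 'e::euclidean_space) atlas \<Rightarrow> 'm form2 \<Rightarrow> bool"
  where "closed_form A \<omega> \<longleftrightarrow>
    (\<forall>X\<in>vector_fields A. \<forall>Y\<in>vector_fields A. \<forall>Z\<in>vector_fields A. \<forall>p. ext_deriv \<omega> X Y Z p = 0)"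

definition pullback_form ::
  "('m, 'e::euclidean_space) atlas \<Rightarrow> ('n \<Rightarrow> 'm) \<Rightarrow> 'm form2 \<Rightarrow> 'n form2"
  where "pullback_form A \<iota> \<omega> = (\<lambda>x v w. \<omega> (\<iota> x) (tangent_map A \<iota> v) (tangent_map A \<iota> w))"


section \<open>Connections\<close>

text \<open>A connection is only constrained on smooth vector fields; its other values are junk.\<close>

type_synonym 'm connection = "'m vfield \<Rightarrow> 'm vfield \<Rightarrow> 'm vfield"

definition affine_connection :: "('m, 'e::euclidean_space) atlas \<Rightarrow> 'm connection \<Rightarrow> bool"
  where "affine_connection A D \<longleftrightarrow>
    (\<forall>X\<in>vector_fields A. \<forall>Y\<in>vector_fields A. D X Y \<in> vector_fields A) \<and>
    (\<forall>X\<in>vector_fields A. \<forall>Y\<in>vector_fields A. \<forall>Z\<in>vector_fields A.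
       D (\<lambda>p g. X p g + Y p g) Z = (\<lambda>p g. D X Z p g + D Y Z p g) \<and>
       D Z (\<lambda>p g. X p g + Y p g) = (\<lambda>p g. D Z X p g + D Z Y p g)) \<and>
    (\<forall>X\<in>vector_fields A. \<forall>Y\<in>vector_fields A. \<forall>f\<in>smooth_functions A.
       D (\<lambda>p g. f p * X p g) Y = (\<lambda>p g. f p * D X Y p g) \<and>
       D X (\<lambda>p g. f p * Y p g) = (\<lambda>p g. X p f * Y p g + f p * D X Y p g))"

definition torsion :: "'m connection \<Rightarrow> 'm vfield \<Rightarrow> 'm vfield \<Rightarrow> 'm vfield"
  where "torsion D X Y = (\<lambda>p f. D X Y p f - D Y X p f - lie_bracket X Y p f)"

definition torsion_free :: "('m, 'e::euclidean_space) atlas \<Rightarrow> 'm connection \<Rightarrow> bool"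
  where "torsion_free A D \<longleftrightarrow>
    (\<forall>X\<in>vector_fields A. \<forall>Y\<in>vector_fields A. torsion D X Y = (\<lambda>p f. 0))"

text \<open>\<open>(D\<^sub>X \<omega>)(Y, Z)\<close>\<close>

definition cov_deriv_form ::
  "'m connection \<Rightarrow> 'm form2 \<Rightarrow> 'm vfield \<Rightarrow> 'm vfield \<Rightarrow> 'm vfield \<Rightarrow> 'm \<Rightarrow> real"
  where "cov_deriv_form D \<omega> X Y Z p =
    X p (\<lambda>q. \<omega> q (Y q) (Z q)) - \<omega> p (D X Y p) (Z p) - \<omega> p (Y p) (D X Z p)"

definition parallel_form ::
  "('m, 'e::euclidean_space) atlas \<Rightarrow> 'm connection \<Rightarrow> 'm form2 \<Rightarrow> bool"
  where "parallel_form A D \<omega> \<longleftrightarrow>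
    (\<forall>X\<in>vector_fields A. \<forall>Y\<in>vector_fields A. \<forall>Z\<in>vector_fields A. \<forall>p.
       cov_deriv_form D \<omega> X Y Z p = 0)"


section \<open>Almost symplectic and almost Fedosov manifolds\<close>

definition almost_symplectic_manifold ::
  "('m::{t2_space, second_countable_topology}, 'e::euclidean_space) atlas \<Rightarrow> 'm form2 \<Rightarrow> bool"
  where "almost_symplectic_manifold A \<omega> \<longleftrightarrow>
    smooth_atlas A \<and> two_form A \<omega> \<and> nondegenerate A \<omega>"

definition almost_symplectic_connection ::
  "('m, 'e::euclidean_space) atlas \<Rightarrow> 'm form2 \<Rightarrow> 'm connection \<Rightarrow> bool"
  where "almost_symplectic_connection A \<omega> D \<longleftrightarrow> affine_connection A D \<and> parallel_form A D \<omega>"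

definition symplectic_connection ::
  "('m, 'e::euclidean_space) atlas \<Rightarrow> 'm form2 \<Rightarrow> 'm connection \<Rightarrow> bool"
  where "symplectic_connection A \<omega> D \<longleftrightarrow>
    almost_symplectic_connection A \<omega> D \<and> torsion_free A D"

definition almost_fedosov_manifold ::
  "('m::{t2_space, second_countable_topology}, 'e::euclidean_space) atlas \<Rightarrow>
   'm form2 \<Rightarrow> 'm connection \<Rightarrow> bool"
  where "almost_fedosov_manifold A \<omega> D \<longleftrightarrow>
    almost_symplectic_manifold A \<omega> \<and> almost_symplectic_connection A \<omega> D"


section \<open>Submanifolds and the induced connection\<close>

definition almost_symplectic_submanifold ::
  "('n::{t2_space, second_countable_topology}, 'd::euclidean_space) atlas \<Rightarrow>
   ('m::{t2_space, second_countable_topology}, 'e::euclidean_space) atlas \<Rightarrow>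
   'm form2 \<Rightarrow> ('n \<Rightarrow> 'm) \<Rightarrow> bool"
  where "almost_symplectic_submanifold B A \<omega> \<iota> \<longleftrightarrow>
    smooth_atlas B \<and> immersion B A \<iota> \<and> nondegenerate B (pullback_form A \<iota> \<omega>)"

definition symplectic_submanifold ::
  "('n::{t2_space, second_countable_topology}, 'd::euclidean_space) atlas \<Rightarrow>
   ('m::{t2_space, second_countable_topology}, 'e::euclidean_space) atlas \<Rightarrow>
   'm form2 \<Rightarrow> ('n \<Rightarrow> 'm) \<Rightarrow> bool"
  where "symplectic_submanifold B A \<omega> \<iota> \<longleftrightarrow>
    almost_symplectic_submanifold B A \<omega> \<iota> \<and> closed_form B (pullback_form A \<iota> \<omega>)"

definition normal_space ::
  "('n, 'd::euclidean_space) atlas \<Rightarrow> ('m, 'e::euclidean_space) atlas \<Rightarrow>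
   'm form2 \<Rightarrow> ('n \<Rightarrow> 'm) \<Rightarrow> 'n \<Rightarrow> 'm tvec set"
  where "normal_space B A \<omega> \<iota> x =
    {u \<in> tangent_space A (\<iota> x). \<forall>v\<in>tangent_space B x. \<omega> (\<iota> x) u (tangent_map A \<iota> v) = 0}"

text \<open>The projection of \<open>T\<^bsub>\<iota> x\<^esub> M\<close> onto \<open>T\<^sub>x N\<close> along the normal space, where \<open>T\<^sub>x N\<close> is
  identified with its image under the tangent map.\<close>

definition tangential_part ::
  "('n, 'd::euclidean_space) atlas \<Rightarrow> ('m, 'e::euclidean_space) atlas \<Rightarrow>
   'm form2 \<Rightarrow> ('n \<Rightarrow> 'm) \<Rightarrow> 'n \<Rightarrow> 'm tvec \<Rightarrow> 'n tvec"
  where "tangential_part B A \<omega> \<iota> x u =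
    (THE v. v \<in> tangent_space B x \<and>
       (\<exists>n\<in>normal_space B A \<omega> \<iota> x. u = (\<lambda>f. tangent_map A \<iota> v f + n f)))"

definition extends_near ::
  "('m, 'e::euclidean_space) atlas \<Rightarrow> ('n::topological_space \<Rightarrow> 'm) \<Rightarrow>
   'n \<Rightarrow> 'n vfield \<Rightarrow> 'm vfield \<Rightarrow> bool"
  where "extends_near A \<iota> x X X' \<longleftrightarrow>
    X' \<in> vector_fields A \<and> (\<forall>\<^sub>F y in nhds x. X' (\<iota> y) = tangent_map A \<iota> (X y))"

text \<open>\<open>(D\<^sub>X Y)(x) \<in> T\<^bsub>\<iota> x\<^esub> M\<close> for vector fields \<open>X\<close>, \<open>Y\<close> on the submanifold. As \<open>\<iota>\<close> is only an
  immersion, \<open>X\<close> and \<open>Y\<close> need not extend to the ambient manifold globally, but they do near each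
  point of the submanifold; the value at \<open>x\<close> is independent of the extensions.\<close>

definition deriv_along ::
  "('m, 'e::euclidean_space) atlas \<Rightarrow> ('n::topological_space \<Rightarrow> 'm) \<Rightarrow> 'm connection \<Rightarrow>
   'n vfield \<Rightarrow> 'n vfield \<Rightarrow> 'n \<Rightarrow> 'm tvec"
  where "deriv_along A \<iota> D X Y x =
    (THE u. \<exists>X' Y'. extends_near A \<iota> x X X' \<and> extends_near A \<iota> x Y Y' \<and> u = D X' Y' (\<iota> x))"

definition induced_connection ::
  "('n::topological_space, 'd::euclidean_space) atlas \<Rightarrow> ('m, 'e::euclidean_space) atlas \<Rightarrow>
   'm form2 \<Rightarrow> ('n \<Rightarrow> 'm) \<Rightarrow> 'm connection \<Rightarrow> 'n connection"
  where "induced_connection B A \<omega> \<iota> D =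
    (\<lambda>X Y x. tangential_part B A \<omega> \<iota> x (deriv_along A \<iota> D X Y x))"

end

theory Submission
  imports Defs
begin

text \<open>
  Near a point an immersion has a smooth left inverse, by the inverse function theorem, so functions
  and vector fields on the submanifold extend locally to the ambient manifold. In a coordinate frame
  \<open>(\<nabla>\<^sub>X Y)(p)\<close> is expressed by the value of \<open>X\<close> at \<open>p\<close> and by the derivatives of the components of
  \<open>Y\<close> along \<open>X\<close>; hence its value on the submanifold does not depend on the extensions.
  As the pulled back form is nondegenerate, the tangential part of an ambient vector \<open>u\<close> is the unique
  tangent vector of the submanifold with the same pairings as \<open>u\<close> with all tangent vectors of the
  submanifold. With this characterisation, the Leibniz rule, the parallelism of the form and the
  vanishing of the torsion pass from extensions to the submanifold, and a two-form that is parallel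
  for a torsion-free connection is closed.
\<close>

section \<open>Calculus of smooth maps\<close>

text \<open>The work is done on germs, for three reasons. Tangent vectors are derivations of global
  functions, so restricting to a chart is not free: bump functions give locality, and Hadamard's
  lemma shows that a derivation is a combination of coordinate partial derivatives. An immersion
  need not be injective or have closed image, so fields on the submanifold extend only near a point.
  And \<open>deriv_along\<close> and \<open>tangential_part\<close> are definite descriptions, whose
  existence and uniqueness must be shown at each point before the induced connection can be
  computed.

  The analytic core is that the pointwise inverse of a smooth operator-valued map is smooth. It
  upgrades the local inverse of the inverse function theorem from differentiable to smooth, and it
  makes the inverse Gram matrix of the pulled back form smooth, which gives the smoothness of the
  induced derivative.

  An immersion is defined by injectivity on derivations; this is translated to injectivity of the
  Jacobian in charts before the inverse function theorem applies.\<close>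

lemma C_k_on_cong:
  assumes "open S" and "\<And>x. x \<in> S \<Longrightarrow> f x = g x"
  shows "C_k_on k S f \<longleftrightarrow> C_k_on k S g"
proof -
  have imp: "C_k_on k S f \<Longrightarrow> C_k_on k S g"
    if "\<And>x. x \<in> S \<Longrightarrow> f x = g x" for k and f g :: "'a \<Rightarrow> 'b"
    using that
  proof (induction k arbitrary: f g)
    case 0
    then show ?case using continuous_on_cong[of S S f g] by simp
  next
    case (Suc k)
    have eq: "frechet_derivative f (at x) = frechet_derivative g (at x)" if "x \<in> S" for x
      using Suc.prems that assms(1) frechet_derivative_transform_within_open[of f x S g] by auto
    have "g differentiable (at x)" if "x \<in> S" for x
      using Suc.prems that assms(1) unfolding differentiable_def C_k_on.simps
      by (meson has_derivative_transform_within_open)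
    moreover have "C_k_on k S (\<lambda>x. frechet_derivative g (at x) v)" for v
      by (rule Suc.IH[of "\<lambda>x. frechet_derivative f (at x) v"]) (use Suc.prems(1) eq in auto)
    ultimately show ?case by simp
  qed
  show ?thesis using imp[of f g] imp[of g f] assms(2) by auto
qed

text \<open>Lets the derivative be given by any explicit formula, so that inductions on
  \<open>k\<close> can run on product and chain rule expressions instead of on
  \<open>frechet_derivative\<close>.\<close>

lemma C_k_on_SucI:
  assumes "open S" and "\<And>x. x \<in> S \<Longrightarrow> (g has_derivative g' x) (at x)"
    and "\<And>v. C_k_on k S (\<lambda>x. g' x v)"
  shows "C_k_on (Suc k) S g"
proof -
  have eq: "frechet_derivative g (at x) = g' x" if "x \<in> S" for x
    using assms(2)[OF that] frechet_derivative_at by fastforce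
  have "C_k_on k S (\<lambda>x. frechet_derivative g (at x) v)" for v
    using C_k_on_cong[OF assms(1), of "\<lambda>x. frechet_derivative g (at x) v" "\<lambda>x. g' x v"] eq assms(3)
    by auto
  then show ?thesis using assms(2) by (auto simp: differentiable_def)
qed

lemma C_k_on_SucD:
  assumes "C_k_on (Suc k) S g"
  shows "x \<in> S \<Longrightarrow> (g has_derivative frechet_derivative g (at x)) (at x)"
    and "C_k_on k S (\<lambda>x. frechet_derivative g (at x) v)"
  using assms by (simp_all flip: frechet_derivative_works)

lemma C_k_on_Suc_imp: "C_k_on (Suc k) S g \<Longrightarrow> C_k_on k S g"
proof (induction k arbitrary: g)
  case 0
  then show ?case
    by (simp add: continuous_at_imp_continuous_on differentiable_imp_continuous_within)
next
  case (Suc k)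
  then show ?case by (metis C_k_on.simps(2))
qed

lemma C_k_on_imp_continuous_on: "C_k_on k S g \<Longrightarrow> continuous_on S g"
  by (induction k) (simp, metis C_k_on_Suc_imp)

lemma C_k_on_subset: "C_k_on k S g \<Longrightarrow> T \<subseteq> S \<Longrightarrow> C_k_on k T g"
  by (induction k arbitrary: g) (auto intro: continuous_on_subset)

lemma C_k_on_open_UN:
  assumes "\<And>a. a \<in> S \<Longrightarrow> \<exists>T. open T \<and> a \<in> T \<and> C_k_on k T g"
  shows "C_k_on k S g"
  using assms
proof (induction k arbitrary: g)
  case 0
  have "continuous (at a) g" if "a \<in> S" for a
    using 0[OF that] by (auto simp: continuous_on_eq_continuous_at)
  then show ?case by (simp add: continuous_at_imp_continuous_on)
next
  case (Suc k)
  have "C_k_on k S (\<lambda>x. frechet_derivative g (at x) v)" for v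
    by (rule Suc.IH) (use Suc.prems in fastforce)
  then show ?case using Suc.prems by fastforce
qed

lemma C_k_on_const: "C_k_on k S (\<lambda>x. c)"
  by (induction k arbitrary: c) simp_all

lemma C_k_on_linear:
  assumes "bounded_linear L" and "open S" and "C_k_on k S f"
  shows "C_k_on k S (\<lambda>x. L (f x))"
  using assms(3)
proof (induction k arbitrary: f)
  case 0
  then show ?case using assms(1) by (simp add: bounded_linear.continuous_on)
next
  case (Suc k)
  show ?case
    by (rule C_k_on_SucI[OF assms(2), where g' = "\<lambda>x v. L (frechet_derivative f (at x) v)"])
      (use Suc C_k_on_SucD[OF Suc.prems] bounded_linear.has_derivative[OF assms(1)] in blast)+
qed

lemma C_k_on_add:
  assumes "open S" "C_k_on k S f" "C_k_on k S g"
  shows "C_k_on k S (\<lambda>x. f x + g x)"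
  using assms(2,3)
proof (induction k arbitrary: f g)
  case 0
  then show ?case by (simp add: continuous_on_add)
next
  case (Suc k)
  show ?case
    by (rule C_k_on_SucI[OF assms(1)])
      (use Suc.IH C_k_on_SucD[OF Suc.prems(1)] C_k_on_SucD[OF Suc.prems(2)] has_derivative_add in blast)+
qed

lemma C_k_on_bilinear:
  assumes "bounded_bilinear B" "open S" "C_k_on k S f" "C_k_on k S g"
  shows "C_k_on k S (\<lambda>x. B (f x) (g x))"
  using assms(3,4)
proof (induction k arbitrary: f g)
  case 0
  then show ?case using assms(1) by (simp add: bounded_bilinear.continuous_on)
next
  case (Suc k)
  show ?case
  proof (rule C_k_on_SucI[OF assms(2)])
    fix x assume "x \<in> S"
    then show "((\<lambda>x. B (f x) (g x)) has_derivative
      (\<lambda>v. B (f x) (frechet_derivative g (at x) v) + B (frechet_derivative f (at x) v) (g x))) (at x)"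
      using bounded_bilinear.FDERIV[OF assms(1)] C_k_on_SucD[OF Suc.prems(1)]
        C_k_on_SucD[OF Suc.prems(2)] by blast
  next
    fix v
    show "C_k_on k S (\<lambda>x. B (f x) (frechet_derivative g (at x) v) +
      B (frechet_derivative f (at x) v) (g x))"
      by (intro C_k_on_add assms(2) Suc.IH C_k_on_Suc_imp[OF Suc.prems(1)]
          C_k_on_Suc_imp[OF Suc.prems(2)] C_k_on_SucD(2)[OF Suc.prems(1)] C_k_on_SucD(2)[OF Suc.prems(2)])
  qed
qed

lemma C_k_on_sum:
  assumes "open S" "\<And>i. i \<in> I \<Longrightarrow> C_k_on k S (f i)"
  shows "C_k_on k S (\<lambda>x. \<Sum>i\<in>I. f i x)"
  using assms(2)
proof (induction I rule: infinite_finite_induct)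
  case (insert i I)
  then show ?case using C_k_on_add[OF assms(1), of k "f i" "\<lambda>x. \<Sum>i\<in>I. f i x"] by simp
qed (simp_all add: C_k_on_const)

text \<open>The chain rule applies a varying operator to a varying vector, while
  \<open>C_k_on\<close> controls derivatives only in fixed directions. Expanding the inner
  derivative in the basis of the middle space leaves a sum of products of fixed-direction terms, to
  which the induction hypothesis applies.\<close>

lemma C_k_on_compose:
  fixes f :: "'a::real_normed_vector \<Rightarrow> 'b::euclidean_space"
  assumes "open S" "open T" "C_k_on k S f" "C_k_on k T g" "f ` S \<subseteq> T"
  shows "C_k_on k S (\<lambda>x. g (f x))"
  using assms(3,4)
proof (induction k arbitrary: g)
  case 0
  then show ?case using assms(5) by (auto intro: continuous_on_compose2)
next
  case (Suc k)
  have dg: "(g has_derivative frechet_derivative g (at (f x))) (at (f x))" if "x \<in> S" for x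
    using C_k_on_SucD(1)[OF Suc.prems(2)] assms(5) that by blast
  show ?case
  proof (rule C_k_on_SucI[OF assms(1)])
    fix x assume x: "x \<in> S"
    have deriv: "((\<lambda>x. g (f x)) has_derivative
        (\<lambda>v. frechet_derivative g (at (f x)) (frechet_derivative f (at x) v))) (at x)"
      using diff_chain_at[OF C_k_on_SucD(1)[OF Suc.prems(1) x] dg[OF x]] by (simp add: o_def)
    have rep: "frechet_derivative g (at (f x)) w =
        (\<Sum>b\<in>Basis. (w \<bullet> b) *\<^sub>R frechet_derivative g (at (f x)) b)" for w
      using linear_sum[OF has_derivative_linear[OF dg[OF x]]]
        linear_cmul[OF has_derivative_linear[OF dg[OF x]]] euclidean_representation[of w]
      by (smt (verit, best) sum.cong)
    show "((\<lambda>x. g (f x)) has_derivative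
        (\<lambda>v. \<Sum>b\<in>Basis. (frechet_derivative f (at x) v \<bullet> b) *\<^sub>R frechet_derivative g (at (f x)) b)) (at x)"
      by (rule has_derivative_eq_rhs[OF deriv]) (rule ext, rule rep)
  next
    fix v
    show "C_k_on k S (\<lambda>x. \<Sum>b\<in>Basis.
        (frechet_derivative f (at x) v \<bullet> b) *\<^sub>R frechet_derivative g (at (f x)) b)"
      by (intro C_k_on_sum assms(1) C_k_on_bilinear[OF bounded_bilinear_scaleR]
          C_k_on_linear[OF bounded_linear_inner_left] C_k_on_SucD(2)[OF Suc.prems(1)]
          Suc.IH C_k_on_Suc_imp[OF Suc.prems(1)] C_k_on_SucD(2)[OF Suc.prems(2)])
  qed
qed

lemma C_k_on_inverse:
  fixes f :: "'a::real_normed_vector \<Rightarrow> real"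
  assumes "open S" "C_k_on k S f" "\<And>x. x \<in> S \<Longrightarrow> f x \<noteq> 0"
  shows "C_k_on k S (\<lambda>x. inverse (f x))"
  using assms(2)
proof (induction k)
  case 0
  then show ?case using assms(3) by (simp add: continuous_on_inverse)
next
  case (Suc k)
  note IH = Suc.IH[OF C_k_on_Suc_imp[OF Suc.prems]]
  show ?case
  proof (rule C_k_on_SucI[OF assms(1)])
    fix x assume x: "x \<in> S"
    show "((\<lambda>x. inverse (f x)) has_derivative
      (\<lambda>v. - (inverse (f x) * frechet_derivative f (at x) v * inverse (f x)))) (at x)"
      using Deriv.has_derivative_inverse[OF assms(3)[OF x] C_k_on_SucD(1)[OF Suc.prems x]] by simp
  next
    show "C_k_on k S (\<lambda>x. - (inverse (f x) * frechet_derivative f (at x) v * inverse (f x)))" for v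
      by (intro C_k_on_linear[OF bounded_linear_minus[OF bounded_linear_ident]]
          C_k_on_bilinear[OF bounded_bilinear_mult] IH C_k_on_SucD(2)[OF Suc.prems] assms(1))
  qed
qed

section \<open>Differentiating the inverse of an operator\<close>

text \<open>As \<open>g\<close> vanishes at \<open>x\<close>, mere continuity of \<open>f\<close> suffices. With \<open>R y = R x - R y (A y - A x) R x\<close>
  this differentiates inverse operators.\<close>

lemma has_derivative_bilinear_continuous_vanishing:
  assumes B: "bounded_bilinear B" and f: "continuous (at x) f"
    and g: "(g has_derivative g') (at x)" and g0: "g x = 0"
  shows "((\<lambda>y. B (f y) (g y)) has_derivative (\<lambda>v. B (f x) (g' v))) (at x)"
proof -
  interpret B: bounded_bilinear B by (fact B)
  obtain e where e: "(e \<longlongrightarrow> 0) (at x)"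
    and ge: "\<And>y. y \<noteq> x \<Longrightarrow> g y = g' (y - x) + norm (y - x) *\<^sub>R e y"
  proof
    show "((\<lambda>y. (g y - g x - g' (y - x)) /\<^sub>R norm (y - x)) \<longlongrightarrow> 0) (at x)"
      using g by (simp add: has_derivative_at_within)
    show "y \<noteq> x \<Longrightarrow> g y = g' (y - x) + norm (y - x) *\<^sub>R ((g y - g x - g' (y - x)) /\<^sub>R norm (y - x))" for y
      by (simp add: g0)
  qed
  obtain K where K: "\<And>v. norm (g' v) \<le> norm v * K" "K \<ge> 0"
    using bounded_linear.nonneg_bounded[OF has_derivative_bounded_linear[OF g]] by auto
  have fx: "(f \<longlongrightarrow> f x) (at x)" using f by (simp add: continuous_at)
  \<comment> \<open>The error quotient splits into these two summands: a null factor paired with a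
    bounded one, and a convergent factor paired with the null remainder \<open>e\<close>.\<close>
  have "((\<lambda>y. B (f y - f x) (g' (y - x) /\<^sub>R norm (y - x)) + B (f y) (e y)) \<longlongrightarrow> 0 + B (f x) 0) (at x)"
  proof (intro tendsto_add B.tendsto fx e)
    obtain C where C: "\<And>a b. norm (B a b) \<le> norm a * norm b * C" "C \<ge> 0"
      using B.nonneg_bounded by auto
    have "norm (g' (y - x) /\<^sub>R norm (y - x)) \<le> K" for y
      using K(1)[of "y - x"] K(2) by (cases "y = x") (auto simp: field_simps)
    then have *: "norm (B (f y - f x) (g' (y - x) /\<^sub>R norm (y - x))) \<le> norm (f y - f x) * K * C" for y
      using C by (smt (verit, best) mult_left_mono mult_right_mono norm_ge_zero)
    have "((\<lambda>y. norm (f y - f x) * K * C) \<longlongrightarrow> norm (f x - f x) * K * C) (at x)"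
      by (intro tendsto_intros fx)
    then have "((\<lambda>y. norm (f y - f x) * K * C) \<longlongrightarrow> 0) (at x)" by simp
    then show "((\<lambda>y. B (f y - f x) (g' (y - x) /\<^sub>R norm (y - x))) \<longlongrightarrow> 0) (at x)"
      by (rule Lim_null_comparison[OF always_eventually, rotated]) (use * in blast)
  qed
  then have lim: "((\<lambda>y. B (f y - f x) (g' (y - x) /\<^sub>R norm (y - x)) + B (f y) (e y)) \<longlongrightarrow> 0) (at x)"
    by (simp add: B.zero_right)
  have eq: "B (f y - f x) (g' (y - x) /\<^sub>R norm (y - x)) + B (f y) (e y) =
      (B (f y) (g y) - B (f x) (g x) - B (f x) (g' (y - x))) /\<^sub>R norm (y - x)" if "y \<noteq> x" for y
    unfolding ge[OF that] g0 using that
    by (simp add: B.zero_right B.add_right B.diff_left B.scaleR_right algebra_simps)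
  have "((\<lambda>y. (B (f y) (g y) - B (f x) (g x) - B (f x) (g' (y - x))) /\<^sub>R norm (y - x)) \<longlongrightarrow> 0) (at x)"
    using lim by (rule Lim_transform_eventually) (auto simp: eventually_at_filter eq)
  moreover have "bounded_linear (\<lambda>v. B (f x) (g' v))"
    by (rule bounded_linear_compose[OF B.bounded_linear_right has_derivative_bounded_linear[OF g]])
  ultimately show ?thesis by (simp add: has_derivative_at_within)
qed

text \<open>\<open>R\<close> is only a pointwise inverse with no regularity given, so its continuity
  at \<open>x\<close> has to be won before the rule for a vanishing factor applies. The identity
  \<open>R y = R x - R y (A y - A x) R x\<close> is used three times: to bound \<open>R y\<close>
  near \<open>x\<close>, to make \<open>R y - R x\<close> small, and to differentiate.\<close>

lemma has_derivative_blinfun_inverse: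
  fixes A R :: "'a::real_normed_vector \<Rightarrow> ('d::real_normed_vector \<Rightarrow>\<^sub>L 'd)"
  assumes S: "open S" "x \<in> S"
    and inv: "\<And>y. y \<in> S \<Longrightarrow> R y o\<^sub>L A y = id_blinfun" "\<And>y. y \<in> S \<Longrightarrow> A y o\<^sub>L R y = id_blinfun"
    and A: "(A has_derivative A') (at x)"
  shows "(R has_derivative (\<lambda>v. - (R x o\<^sub>L A' v o\<^sub>L R x))) (at x)"
proof -
  have comp_assoc: "(a o\<^sub>L b) o\<^sub>L c = a o\<^sub>L (b o\<^sub>L c)" for a b c :: "'d \<Rightarrow>\<^sub>L 'd"
    by (rule blinfun_eqI) simp
  have comp_id: "a o\<^sub>L id_blinfun = a" "id_blinfun o\<^sub>L a = a" for a :: "'d \<Rightarrow>\<^sub>L 'd"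
    by (auto intro!: blinfun_eqI)
  interpret C: bounded_bilinear "(o\<^sub>L) :: ('d \<Rightarrow>\<^sub>L 'd) \<Rightarrow> ('d \<Rightarrow>\<^sub>L 'd) \<Rightarrow> ('d \<Rightarrow>\<^sub>L 'd)"
    by (rule bounded_bilinear_blinfun_compose)
  have R: "R y = R x - (R y o\<^sub>L (A y - A x) o\<^sub>L R x)" if "y \<in> S" for y
  proof -
    have "R y o\<^sub>L (A y - A x) o\<^sub>L R x = (R y o\<^sub>L A y o\<^sub>L R x) - (R y o\<^sub>L A x o\<^sub>L R x)"
      by (simp add: C.diff_left C.diff_right)
    also have "\<dots> = R x - R y" using inv(1)[OF that] inv(2)[OF S(2)] by (simp add: comp_assoc comp_id)
    finally show ?thesis by simp
  qed
  have contA: "(A \<longlongrightarrow> A x) (at x)"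
    using has_derivative_continuous[OF A] by (simp add: continuous_at)
  define c where "c = norm (R x)"
  \<comment> \<open>The threshold \<open>1 / 2\<close> allows absorption:
    \<open>norm (R y) \<le> c + norm (R y) / 2\<close> gives the bound \<open>2 * c\<close>.\<close>
  have small: "eventually (\<lambda>y. norm (A y - A x) * c < 1 / 2) (at x)"
  proof -
    have "((\<lambda>y. norm (A y - A x) * c) \<longlongrightarrow> norm (A x - A x) * c) (at x)"
      by (intro tendsto_intros contA)
    then show ?thesis by (intro order_tendstoD(2)[where a = "1/2"]) auto
  qed
  have evS: "eventually (\<lambda>y. y \<in> S) (at x)"
    using S eventually_at_topological by blast
  have diff: "norm (R y - R x) \<le> 2 * c * (norm (A y - A x) * c)"
    if "y \<in> S" "norm (A y - A x) * c < 1 / 2" for y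
  proof -
    have n: "norm (R y o\<^sub>L (A y - A x) o\<^sub>L R x) \<le> norm (R y) * (norm (A y - A x) * c)"
      unfolding c_def
      unfolding comp_assoc
      by (rule order_trans[OF norm_blinfun_compose mult_left_mono[OF norm_blinfun_compose norm_ge_zero]])
    also have "\<dots> \<le> norm (R y) * (1 / 2)"
      using that(2) by (intro mult_left_mono) auto
    finally have "norm (R y) \<le> c + norm (R y) / 2"
      using arg_cong[OF R[OF that(1)], of norm] norm_triangle_ineq4[of "R x" "R y o\<^sub>L (A y - A x) o\<^sub>L R x"]
      unfolding c_def by linarith
    then have "norm (R y) \<le> 2 * c" by simp
    moreover have "norm (R y - R x) \<le> norm (R y) * (norm (A y - A x) * c)"
      using n R[OF that(1)] by (metis add_diff_cancel_left' diff_add_cancel norm_minus_commute)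
    ultimately show ?thesis
      by (smt (verit, best) c_def mult_nonneg_nonneg mult_right_mono norm_ge_zero)
  qed
  have "((\<lambda>y. R y - R x) \<longlongrightarrow> 0) (at x)"
  proof (rule Lim_null_comparison)
    show "eventually (\<lambda>y. norm (R y - R x) \<le> 2 * c * (norm (A y - A x) * c)) (at x)"
      using small evS by eventually_elim (use diff in blast)
    have "((\<lambda>y. 2 * c * (norm (A y - A x) * c)) \<longlongrightarrow> 2 * c * (norm (A x - A x) * c)) (at x)"
      by (intro tendsto_intros contA)
    then show "((\<lambda>y. 2 * c * (norm (A y - A x) * c)) \<longlongrightarrow> 0) (at x)" by simp
  qed
  then have contR: "continuous (at x) R"
    by (simp add: continuous_at LIM_zero_cancel)
  have "((\<lambda>y. R y o\<^sub>L ((A y - A x) o\<^sub>L R x)) has_derivative (\<lambda>v. R x o\<^sub>L (A' v o\<^sub>L R x))) (at x)"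
  proof (rule has_derivative_bilinear_continuous_vanishing[OF bounded_bilinear_blinfun_compose contR])
    have "((\<lambda>y. A y - A x) has_derivative A') (at x)"
      using has_derivative_diff[OF A has_derivative_const] by simp
    then show "((\<lambda>y. (A y - A x) o\<^sub>L R x) has_derivative (\<lambda>v. A' v o\<^sub>L R x)) (at x)"
      by (rule bounded_linear.has_derivative[OF C.bounded_linear_left])
  qed (simp add: C.zero_left)
  from has_derivative_diff[OF has_derivative_const[of "R x"] this]
  have "((\<lambda>y. R x - (R y o\<^sub>L ((A y - A x) o\<^sub>L R x))) has_derivative (\<lambda>v. - (R x o\<^sub>L A' v o\<^sub>L R x))) (at x)"
    by (simp add: comp_assoc)
  then show ?thesis
    by (rule has_derivative_transform_within_open[OF _ S]) (metis R comp_assoc)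
qed

text \<open>Bootstrapping on the derivative \<open>- R (A' v) R\<close>, which is as regular as the
  worse of \<open>R\<close> and \<open>A'\<close>. The index starts at \<open>Suc k\<close> because
  the formula needs \<open>A\<close> differentiable; in the base case the continuity of
  \<open>R\<close> comes from its differentiability.\<close>

lemma C_k_on_blinfun_inverse:
  fixes A R :: "'a::real_normed_vector \<Rightarrow> ('d::real_normed_vector \<Rightarrow>\<^sub>L 'd)"
  assumes "open S" and "C_k_on (Suc k) S A"
    and inv: "\<And>y. y \<in> S \<Longrightarrow> R y o\<^sub>L A y = id_blinfun" "\<And>y. y \<in> S \<Longrightarrow> A y o\<^sub>L R y = id_blinfun"
  shows "C_k_on (Suc k) S R"
  using assms(2)
proof (induction k)
  case 0
  have "(R has_derivative (\<lambda>v. - (R x o\<^sub>L frechet_derivative A (at x) v o\<^sub>L R x))) (at x)"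
    if "x \<in> S" for x
    by (rule has_derivative_blinfun_inverse[OF assms(1) that inv C_k_on_SucD(1)[OF 0 that]])
  note d = this
  have "C_k_on 0 S R"
    using d by (auto intro!: continuous_at_imp_continuous_on has_derivative_continuous)
  then show ?case
    by (intro C_k_on_SucI[OF assms(1) d] C_k_on_SucD(2)[OF 0] assms(1)
        C_k_on_linear[OF bounded_linear_minus[OF bounded_linear_ident]]
        C_k_on_bilinear[OF bounded_bilinear_blinfun_compose])
next
  case (Suc k)
  have d: "(R has_derivative (\<lambda>v. - (R x o\<^sub>L frechet_derivative A (at x) v o\<^sub>L R x))) (at x)"
    if "x \<in> S" for x
    by (rule has_derivative_blinfun_inverse[OF assms(1) that inv C_k_on_SucD(1)[OF Suc.prems that]])
  show ?case
    by (intro C_k_on_SucI[OF assms(1) d] C_k_on_SucD(2)[OF Suc.prems] assms(1)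
        Suc.IH[OF C_k_on_Suc_imp[OF Suc.prems]]
        C_k_on_linear[OF bounded_linear_minus[OF bounded_linear_ident]]
        C_k_on_bilinear[OF bounded_bilinear_blinfun_compose])
qed

section \<open>Smoothness at a point, for working with germs\<close>

definition smooth_at :: "('a::real_normed_vector \<Rightarrow> 'b::real_normed_vector) \<Rightarrow> 'a \<Rightarrow> bool"
  where "smooth_at g a \<longleftrightarrow> (\<exists>S. open S \<and> a \<in> S \<and> smooth_on S g)"

lemma smooth_on_subset: "smooth_on S g \<Longrightarrow> T \<subseteq> S \<Longrightarrow> smooth_on T g"
  unfolding smooth_on_def using C_k_on_subset by blast

lemma smooth_on_cong:
  "open S \<Longrightarrow> (\<And>x. x \<in> S \<Longrightarrow> f x = g x) \<Longrightarrow> smooth_on S f \<longleftrightarrow> smooth_on S g"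
  by (simp add: smooth_on_def C_k_on_cong[of S f g])

lemma smooth_on_iff_smooth_at: "open S \<Longrightarrow> smooth_on S g \<longleftrightarrow> (\<forall>a\<in>S. smooth_at g a)"
proof
  assume "\<forall>a\<in>S. smooth_at g a"
  then show "smooth_on S g"
    unfolding smooth_on_def smooth_at_def by (intro allI C_k_on_open_UN) blast
qed (auto simp: smooth_at_def)

lemma eventually_smooth_at: "smooth_at g a \<Longrightarrow> \<forall>\<^sub>F x in nhds a. smooth_at g x"
  unfolding smooth_at_def eventually_nhds by blast

lemma smooth_at_cong:
  assumes "smooth_at g a" "\<forall>\<^sub>F x in nhds a. f x = g x"
  shows "smooth_at f a"
proof -
  obtain S where S: "open S" "a \<in> S" "smooth_on S g"
    using assms(1) unfolding smooth_at_def by blast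
  obtain T where T: "open T" "a \<in> T" "\<And>x. x \<in> T \<Longrightarrow> f x = g x"
    using assms(2) unfolding eventually_nhds by blast
  have "smooth_on (S \<inter> T) f"
    using smooth_on_cong[of "S \<inter> T" f g] smooth_on_subset[OF S(3)] S(1) T by auto
  then show ?thesis using S T unfolding smooth_at_def by (meson IntI open_Int)
qed

lemma smooth_at_const: "smooth_at (\<lambda>x. c) a"
  unfolding smooth_at_def smooth_on_def using C_k_on_const open_UNIV by blast

lemma smooth_at_ident: "smooth_at (\<lambda>x. x) a"
proof -
  have "C_k_on k UNIV (\<lambda>x::'a. x)" for k
  proof (cases k)
    case (Suc j)
    have "C_k_on (Suc j) UNIV (\<lambda>x::'a. x)"
      by (rule C_k_on_SucI[OF open_UNIV has_derivative_ident C_k_on_const])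
    then show ?thesis by (simp only: Suc)
  qed simp
  then show ?thesis unfolding smooth_at_def smooth_on_def by blast
qed

lemma smooth_at_linear: "bounded_linear L \<Longrightarrow> smooth_at f a \<Longrightarrow> smooth_at (\<lambda>x. L (f x)) a"
  unfolding smooth_at_def smooth_on_def using C_k_on_linear by blast

lemma smooth_at_bilinear:
  assumes "bounded_bilinear B" "smooth_at f a" "smooth_at g a"
  shows "smooth_at (\<lambda>x. B (f x) (g x)) a"
proof -
  obtain S T where "open S" "a \<in> S" "smooth_on S f" "open T" "a \<in> T" "smooth_on T g"
    using assms unfolding smooth_at_def by blast
  then have "open (S \<inter> T) \<and> a \<in> S \<inter> T \<and> smooth_on (S \<inter> T) (\<lambda>x. B (f x) (g x))"
    using C_k_on_bilinear[OF assms(1), of "S \<inter> T" _ f g] smooth_on_subset[of S f "S \<inter> T"]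
      smooth_on_subset[of T g "S \<inter> T"] unfolding smooth_on_def by blast
  then show ?thesis unfolding smooth_at_def by blast
qed

lemma smooth_at_add:
  assumes "smooth_at f a" "smooth_at g a"
  shows "smooth_at (\<lambda>x. f x + g x) a"
proof -
  obtain S T where "open S" "a \<in> S" "smooth_on S f" "open T" "a \<in> T" "smooth_on T g"
    using assms unfolding smooth_at_def by blast
  then have "open (S \<inter> T) \<and> a \<in> S \<inter> T \<and> smooth_on (S \<inter> T) (\<lambda>x. f x + g x)"
    using C_k_on_add[of "S \<inter> T" _ f g] smooth_on_subset[of S f "S \<inter> T"]
      smooth_on_subset[of T g "S \<inter> T"] unfolding smooth_on_def by blast
  then show ?thesis unfolding smooth_at_def by blast
qed

lemma smooth_at_diff: "smooth_at f a \<Longrightarrow> smooth_at g a \<Longrightarrow> smooth_at (\<lambda>x. f x - g x) a"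
  using smooth_at_add[of f a "\<lambda>x. - g x"]
    smooth_at_linear[OF bounded_linear_minus[OF bounded_linear_ident], of g a] by simp

lemma smooth_at_sum:
  assumes "\<And>i. i \<in> I \<Longrightarrow> smooth_at (f i) a"
  shows "smooth_at (\<lambda>x. \<Sum>i\<in>I. f i x) a"
  using assms
proof (induction I rule: infinite_finite_induct)
  case (insert i I)
  then show ?case using smooth_at_add[of "f i" a "\<lambda>x. \<Sum>i\<in>I. f i x"] by simp
qed (simp_all add: smooth_at_const)

lemma smooth_at_compose:
  fixes f :: "'a::real_normed_vector \<Rightarrow> 'b::euclidean_space"
  assumes "smooth_at f a" "smooth_at g (f a)"
  shows "smooth_at (\<lambda>x. g (f x)) a"
proof -
  obtain S T where S: "open S" "a \<in> S" "smooth_on S f" and T: "open T" "f a \<in> T" "smooth_on T g"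
    using assms unfolding smooth_at_def by blast
  have cont: "continuous_on S f" using S(3) C_k_on.simps(1) unfolding smooth_on_def by blast
  define R where "R = S \<inter> f -` T"
  have R: "open R" "a \<in> R" "R \<subseteq> S" "f ` R \<subseteq> T"
    using continuous_open_preimage[OF cont S(1) T(1)] S T unfolding R_def by auto
  have "smooth_on R (\<lambda>x. g (f x))"
    using C_k_on_compose[OF R(1) T(1) _ _ R(4)] C_k_on_subset[OF _ R(3)] S(3) T(3)
    unfolding smooth_on_def by blast
  then show ?thesis using R unfolding smooth_at_def by blast
qed

lemma smooth_at_inverse:
  fixes f :: "'a::real_normed_vector \<Rightarrow> real"
  assumes "smooth_at f a" "f a \<noteq> 0"
  shows "smooth_at (\<lambda>x. inverse (f x)) a"
proof -
  obtain S where S: "open S" "a \<in> S" "smooth_on S f"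
    using assms unfolding smooth_at_def by blast
  have cont: "continuous_on S f" using S(3) C_k_on.simps(1) unfolding smooth_on_def by blast
  define R where "R = S \<inter> f -` (- {0})"
  have R: "open R" "a \<in> R" "R \<subseteq> S" "\<And>x. x \<in> R \<Longrightarrow> f x \<noteq> 0"
    using continuous_open_preimage[OF cont S(1), of "- {0}"] S assms(2) unfolding R_def by auto
  have "smooth_on R (\<lambda>x. inverse (f x))"
    using C_k_on_inverse[OF R(1) _ R(4)] smooth_on_subset[OF S(3) R(3)] unfolding smooth_on_def by simp
  then show ?thesis using R unfolding smooth_at_def by blast
qed

lemma smooth_at_blinfun_inverse:
  fixes A R :: "'a::real_normed_vector \<Rightarrow> ('d::real_normed_vector \<Rightarrow>\<^sub>L 'd)"
  assumes "smooth_at A a"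
    and "\<forall>\<^sub>F y in nhds a. R y o\<^sub>L A y = id_blinfun \<and> A y o\<^sub>L R y = id_blinfun"
  shows "smooth_at R a"
proof -
  obtain S where S: "open S" "a \<in> S" "smooth_on S A"
    using assms(1) unfolding smooth_at_def by blast
  obtain T where T: "open T" "a \<in> T"
    "\<And>y. y \<in> T \<Longrightarrow> R y o\<^sub>L A y = id_blinfun" "\<And>y. y \<in> T \<Longrightarrow> A y o\<^sub>L R y = id_blinfun"
    using assms(2) unfolding eventually_nhds by blast
  have A: "C_k_on k (S \<inter> T) A" for k
    using S(3) C_k_on_subset unfolding smooth_on_def by (metis inf_le1)
  have "C_k_on (Suc k) (S \<inter> T) R" for k
    by (rule C_k_on_blinfun_inverse[OF open_Int[OF S(1) T(1)] A]) (use T in auto)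
  then have "smooth_on (S \<inter> T) R"
    unfolding smooth_on_def using C_k_on_Suc_imp by blast
  then show ?thesis using S T unfolding smooth_at_def by (meson IntI open_Int)
qed

lemma smooth_at_has_derivative:
  "smooth_at f a \<Longrightarrow> (f has_derivative frechet_derivative f (at a)) (at a)"
  unfolding smooth_at_def smooth_on_def using C_k_on_SucD(1) by blast

lemma smooth_at_frechet_derivative:
  "smooth_at f a \<Longrightarrow> smooth_at (\<lambda>x. frechet_derivative f (at x) v) a"
  unfolding smooth_at_def smooth_on_def using C_k_on_SucD(2) by blast

section \<open>Operator-valued derivatives and the smooth local inverse\<close>

lemma linear_eq_sum_Basis:
  fixes f :: "'a::euclidean_space \<Rightarrow> 'b::real_vector"
  assumes "linear f"
  shows "f w = (\<Sum>b\<in>Basis. (w \<bullet> b) *\<^sub>R f b)"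
proof -
  have "f w = f (\<Sum>b\<in>Basis. (w \<bullet> b) *\<^sub>R b)" by (simp only: euclidean_representation)
  also have "\<dots> = (\<Sum>b\<in>Basis. (w \<bullet> b) *\<^sub>R f b)"
    by (simp only: linear_sum[OF assms] linear_cmul[OF assms])
  finally show ?thesis .
qed

lemma Blinfun_eq_sum_Basis:
  fixes f :: "'a::euclidean_space \<Rightarrow> 'b::real_normed_vector"
  assumes "bounded_linear f"
  shows "Blinfun f = (\<Sum>b\<in>Basis. blinfun_scaleR_left (f b) o\<^sub>L blinfun_inner_left b)"
proof (rule blinfun_eqI)
  show "blinfun_apply (Blinfun f) w =
      blinfun_apply (\<Sum>b\<in>Basis. blinfun_scaleR_left (f b) o\<^sub>L blinfun_inner_left b) w" for w
    using linear_eq_sum_Basis[OF bounded_linear.linear[OF assms], of w]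
    by (simp add: bounded_linear_Blinfun_apply[OF assms] blinfun.sum_left)
qed

text \<open>\<open>C_k_on\<close> controls the derivative only direction by direction. On a
  Euclidean domain the operator is a finite sum of rank one operators built from its values on the
  basis, so this control already gives regularity in the operator norm.\<close>

lemma C_k_on_Blinfun_frechet_derivative:
  fixes f :: "'a::euclidean_space \<Rightarrow> 'b::real_normed_vector"
  assumes "open S" "smooth_on S f"
  shows "C_k_on k S (\<lambda>x. Blinfun (frechet_derivative f (at x)))"
proof -
  have f: "C_k_on (Suc k) S f" for k using assms(2) unfolding smooth_on_def by blast
  have eq: "Blinfun (frechet_derivative f (at x)) =
      (\<Sum>b\<in>Basis. blinfun_scaleR_left (frechet_derivative f (at x) b) o\<^sub>L blinfun_inner_left b)"
    if "x \<in> S" for x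
    by (rule Blinfun_eq_sum_Basis[OF has_derivative_bounded_linear[OF C_k_on_SucD(1)[OF f that]]])
  have "C_k_on k S (\<lambda>x. \<Sum>b\<in>Basis. blinfun_scaleR_left (frechet_derivative f (at x) b) o\<^sub>L blinfun_inner_left b)"
    by (intro C_k_on_sum C_k_on_bilinear[OF bounded_bilinear_blinfun_compose] assms(1) C_k_on_const
        C_k_on_linear[OF bounded_linear_blinfun_scaleR_left] C_k_on_SucD(2)[OF f])
  then show ?thesis using C_k_on_cong[OF assms(1) eq] by auto
qed

text \<open>The inverse function theorem yields a local inverse \<open>g\<close> whose derivative at
  \<open>y\<close> is the inverse \<open>R y\<close> of \<open>F' (g y)\<close>. Once
  \<open>g\<close> has at least one continuous derivative, the same regularity passes to
  \<open>F' (g y)\<close>, then to \<open>R\<close>, and so \<open>g\<close> gains one more.\<close>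

lemma smooth_at_local_inverse:
  fixes F :: "'d::euclidean_space \<Rightarrow> 'd"
  assumes "smooth_at F a" "inj (frechet_derivative F (at a))"
  obtains H where "smooth_at H (F a)" "\<forall>\<^sub>F x in nhds a. H (F x) = x"
proof -
  obtain S where S: "open S" "a \<in> S" "smooth_on S F"
    using assms(1) unfolding smooth_at_def by blast
  define F' where "F' x = Blinfun (frechet_derivative F (at x))" for x
  have dF: "(F has_derivative frechet_derivative F (at x)) (at x)" if "x \<in> S" for x
    using S that C_k_on_SucD(1) unfolding smooth_on_def by blast
  then have F'_apply: "blinfun_apply (F' x) = frechet_derivative F (at x)" if "x \<in> S" for x
    using that bounded_linear_Blinfun_apply has_derivative_bounded_linear unfolding F'_def by blast
  have F'C: "C_k_on k S F'" for k
    unfolding F'_def by (rule C_k_on_Blinfun_frechet_derivative[OF S(1,3)])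
  obtain G where G: "linear G" "\<And>x. G (frechet_derivative F (at a) x) = x"
    using linear_injective_isomorphism[OF has_derivative_linear[OF dF[OF S(2)]] assms(2)] by blast
  have inv: "Blinfun G o\<^sub>L F' a = id_blinfun"
    using G F'_apply[OF S(2)]
    by (auto intro!: blinfun_eqI simp: bounded_linear_Blinfun_apply linear_conv_bounded_linear)
  obtain U' V g g' where U': "open U'" "U' \<subseteq> S" "a \<in> U'" and V: "open V" "F a \<in> V"
    and hom: "homeomorphism U' V F g"
    and dg: "\<And>y. y \<in> V \<Longrightarrow> (g has_derivative (g' y)) (at y)"
    and g': "\<And>y. y \<in> V \<Longrightarrow> g' y = Hilbert_Choice.inv (blinfun_apply (F' (g y)))"
    and bij: "\<And>y. y \<in> V \<Longrightarrow> bij (blinfun_apply (F' (g y)))"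
    by (rule inverse_function_theorem[OF S(1), of F F' a "Blinfun G"])
      (use dF F'_apply F'C[of 0] S(2) inv in auto)
  have gV: "g y \<in> S" if "y \<in> V" for y
    using hom that U'(2) unfolding homeomorphism_def by blast
  define R where "R y = Blinfun (g' y)" for y
  have R_apply: "blinfun_apply (R y) = g' y" if "y \<in> V" for y
    using dg[OF that] bounded_linear_Blinfun_apply has_derivative_bounded_linear
    unfolding R_def by blast
  have R_inv: "R y o\<^sub>L F' (g y) = id_blinfun" "F' (g y) o\<^sub>L R y = id_blinfun" if "y \<in> V" for y
    using bij[OF that] g'[OF that] R_apply[OF that]
    by (auto intro!: blinfun_eqI simp: bij_is_inj bij_is_surj surj_f_inv_f)
  have C_comp: "C_k_on k V (\<lambda>y. F' (g y))" if "C_k_on k V g" for k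
    by (rule C_k_on_compose[OF V(1) S(1) that F'C]) (use gV in blast)
  have step: "C_k_on (Suc k) V g" if "C_k_on k V R" for k
  proof (rule C_k_on_SucI[OF V(1) dg])
    have "C_k_on k V (\<lambda>y. blinfun_apply (R y) v)" for v
      by (rule C_k_on_linear[OF blinfun.bounded_linear_left V(1) that])
    then show "C_k_on k V (\<lambda>y. g' y v)" for v
      using C_k_on_cong[OF V(1), of "\<lambda>y. blinfun_apply (R y) v" "\<lambda>y. g' y v"] R_apply by auto
  qed
  have "C_k_on (Suc k) V g" for k
  proof (induction k)
    case 0
    \<comment> \<open>The regularity lemma for inverses would need \<open>g\<close> to be known as
      \<open>C_k_on\<close> of order one, which is the claim here. The derivative formula alone
      gives continuity of \<open>R\<close>, and that starts the bootstrapping.\<close>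
    have "isCont R y" if y: "y \<in> V" for y
    proof -
      have "(F' has_derivative frechet_derivative F' (at (g y))) (at (g y))"
        using C_k_on_SucD(1)[OF F'C gV[OF y]] .
      from has_derivative_blinfun_inverse[OF V(1) y R_inv has_derivative_compose[OF dg[OF y] this]]
      show ?thesis by (rule has_derivative_continuous)
    qed
    then have "C_k_on 0 V R" by (simp add: continuous_at_imp_continuous_on)
    then show ?case by (rule step)
  next
    case (Suc k)
    show ?case by (rule step[OF C_k_on_blinfun_inverse[OF V(1) C_comp[OF Suc] R_inv]])
  qed
  then have "smooth_on V g" unfolding smooth_on_def using C_k_on_Suc_imp by blast
  then have "smooth_at g (F a)" using V unfolding smooth_at_def by blast
  moreover have "\<forall>\<^sub>F x in nhds a. g (F x) = x"
    using U' hom unfolding eventually_nhds homeomorphism_def by blast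
  ultimately show thesis by (rule that)
qed

subsection \<open>Hadamard's lemma\<close>

lemma ray_in_ball:
  fixes a x :: "'a::real_normed_vector"
  assumes "x \<in> ball a r" "t \<in> {0..1}"
  shows "a + t *\<^sub>R (x - a) \<in> ball a r"
proof -
  have "norm (t *\<^sub>R (x - a)) \<le> norm (x - a)"
    using assms(2) by (simp add: mult_left_le_one_le)
  then show ?thesis using assms(1) by (simp add: dist_norm norm_minus_commute)
qed

lemma continuous_on_ray:
  fixes a :: "'a::euclidean_space"
  assumes "continuous_on (ball a r) K"
  shows "continuous_on (ball a r \<times> {0..1::real}) (\<lambda>p. K (a + snd p *\<^sub>R (fst p - a)))"
  by (rule continuous_on_compose2[OF assms]) (auto intro!: continuous_intros ray_in_ball[unfolded mem_ball])

text \<open>The weight \<open>w\<close> is there for the induction: differentiation under the integral produces a factor \<open>t\<close>.\<close>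

lemma C_k_on_ray_integral:
  fixes F :: "'a::euclidean_space \<Rightarrow> real"
  assumes "smooth_on (ball a r) F" "continuous_on {0..1} w"
  shows "C_k_on k (ball a r) (\<lambda>x. integral (cbox 0 1) (\<lambda>t. w t * F (a + t *\<^sub>R (x - a))))"
  using assms
proof (induction k arbitrary: F w)
  case 0
  have cont: "continuous_on (ball a r) F" using 0(1) C_k_on.simps(1) unfolding smooth_on_def by blast
  have w: "continuous_on (ball a r \<times> {0..1}) (\<lambda>p. w (snd p))"
    by (rule continuous_on_compose2[OF 0(2)]) (auto intro!: continuous_intros)
  have "continuous_on (ball a r \<times> cbox 0 1) (\<lambda>(x, t). w t * F (a + t *\<^sub>R (x - a)))"
    using continuous_on_mult[OF w continuous_on_ray[OF cont]] by (simp add: case_prod_beta)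
  then show ?case by (simp only: C_k_on.simps(1) integral_continuous_on_param)
next
  case (Suc k)
  define K where "K x = Blinfun (frechet_derivative F (at x))" for x
  have FC: "C_k_on k (ball a r) F" for k using Suc.prems(1) unfolding smooth_on_def by blast
  have dF: "(F has_derivative frechet_derivative F (at x)) (at x)" if "x \<in> ball a r" for x
    using C_k_on_SucD(1)[OF FC that] .
  have K_apply: "blinfun_apply (K x) = frechet_derivative F (at x)" if "x \<in> ball a r" for x
    using bounded_linear_Blinfun_apply[OF has_derivative_bounded_linear[OF dF[OF that]]]
    unfolding K_def .
  have K_cont: "continuous_on (ball a r) K"
    unfolding K_def
    by (rule C_k_on_imp_continuous_on[OF C_k_on_Blinfun_frechet_derivative[OF open_ball Suc.prems(1)]])
  define fx where "fx x t = (w t * t) *\<^sub>R K (a + t *\<^sub>R (x - a))" for x t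
  have w: "continuous_on (ball a r \<times> {0..1}) (\<lambda>p. w (snd p) * snd p)"
    by (intro continuous_intros continuous_on_compose2[OF Suc.prems(2)]) auto
  have fx_cont: "continuous_on (ball a r \<times> cbox 0 1) (\<lambda>(x, t). fx x t)"
    using continuous_on_scaleR[OF w continuous_on_ray[OF K_cont]]
    unfolding fx_def by (simp add: case_prod_beta)
  have deriv: "((\<lambda>x. integral (cbox 0 1) (\<lambda>t. w t * F (a + t *\<^sub>R (x - a)))) has_derivative
      (\<lambda>v. integral (cbox 0 1) (\<lambda>t. (w t * t) * frechet_derivative F (at (a + t *\<^sub>R (x - a))) v))) (at x)"
    if x: "x \<in> ball a r" for x
  proof -
    have D: "((\<lambda>x. integral (cbox 0 1) (\<lambda>t. w t * F (a + t *\<^sub>R (x - a)))) has_derivative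
      integral (cbox 0 1) (fx x)) (at x within ball a r)"
    proof (rule leibniz_rule[OF _ _ fx_cont x convex_ball])
      fix y t assume y: "y \<in> ball a r" and t: "t \<in> cbox (0::real) 1"
      have r: "a + t *\<^sub>R (y - a) \<in> ball a r" using ray_in_ball[OF y] t by simp
      have "((\<lambda>y. a + t *\<^sub>R (y - a)) has_derivative (\<lambda>v. t *\<^sub>R v)) (at y)"
        by (auto intro!: derivative_eq_intros)
      from has_derivative_mult_right[OF has_derivative_compose[OF this dF[OF r]], of "w t"]
      have "((\<lambda>y. w t * F (a + t *\<^sub>R (y - a))) has_derivative
          (\<lambda>v. w t * frechet_derivative F (at (a + t *\<^sub>R (y - a))) (t *\<^sub>R v))) (at y)" .
      moreover have "w t * frechet_derivative F (at (a + t *\<^sub>R (y - a))) (t *\<^sub>R v) = fx y t v" for v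
        unfolding fx_def using K_apply[OF r] linear_cmul[OF has_derivative_linear[OF dF[OF r]]]
        by (simp add: scaleR_blinfun.rep_eq)
      ultimately show "((\<lambda>y. w t * F (a + t *\<^sub>R (y - a))) has_derivative
          blinfun_apply (fx y t)) (at y within ball a r)"
        by (simp add: has_derivative_at_withinI)
    next
      fix y assume y: "y \<in> ball a r"
      have "continuous_on (cbox 0 1) (\<lambda>t. w t * F (a + t *\<^sub>R (y - a)))"
        by (intro continuous_intros continuous_on_compose2[OF C_k_on_imp_continuous_on[OF FC]])
          (use Suc.prems(2) ray_in_ball[OF y] in auto)
      then show "(\<lambda>t. w t * F (a + t *\<^sub>R (y - a))) integrable_on cbox 0 1"
        by (rule integrable_continuous)
    qed
    \<comment> \<open>Evaluation at \<open>v\<close> brings the operator-valued integral back to the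
      shape of the lemma, with \<open>F\<close> replaced by a directional derivative and the weight
      by \<open>w t * t\<close>, so that the induction hypothesis fits.\<close>
    have E: "blinfun_apply (integral (cbox 0 1) (fx x)) v =
        integral (cbox 0 1) (\<lambda>t. (w t * t) * frechet_derivative F (at (a + t *\<^sub>R (x - a))) v)" for v
    proof -
      have "continuous_on (cbox 0 1) (\<lambda>t. fx x t)"
        using continuous_on_compose2[OF fx_cont continuous_on_Pair[OF continuous_on_const[of _ x] continuous_on_id], of "cbox 0 1"] x
        by (simp add: image_subset_iff)
      then have "blinfun_apply (integral (cbox 0 1) (fx x)) v = integral (cbox 0 1) (\<lambda>t. fx x t v)"
        by (intro blinfun_apply_integral integrable_continuous)
      also have "\<dots> = integral (cbox 0 1) (\<lambda>t. (w t * t) * frechet_derivative F (at (a + t *\<^sub>R (x - a))) v)"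
        unfolding fx_def using K_apply ray_in_ball[OF x]
        by (intro integral_cong) (simp add: scaleR_blinfun.rep_eq)
      finally show ?thesis .
    qed
    show ?thesis
      by (rule has_derivative_eq_rhs[OF D[unfolded at_within_open[OF x open_ball]]]) (rule ext, rule E)
  qed
  show ?case
  proof (rule C_k_on_SucI[OF open_ball deriv])
    fix v
    show "C_k_on k (ball a r)
        (\<lambda>x. integral (cbox 0 1) (\<lambda>t. (w t * t) * frechet_derivative F (at (a + t *\<^sub>R (x - a))) v))"
    proof (rule Suc.IH)
      show "smooth_on (ball a r) (\<lambda>x. frechet_derivative F (at x) v)"
        unfolding smooth_on_def using C_k_on_SucD(2)[OF FC] by blast
      show "continuous_on {0..1} (\<lambda>t. w t * t)"
        by (rule continuous_on_mult[OF Suc.prems(2) continuous_on_id])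
    qed
  qed
qed

text \<open>Integrating the derivative of \<open>F\<close> along the segment from \<open>a\<close>
  to \<open>x\<close> and expanding the direction \<open>x - a\<close> in the basis gives the claim;
  \<open>g b x\<close> is the mean of the partial derivative in direction \<open>b\<close> over that
  segment.\<close>

lemma hadamard:
  fixes F :: "'a::euclidean_space \<Rightarrow> real"
  assumes "smooth_at F a"
  obtains g where "\<And>b. smooth_at (g b) a" "\<And>b. g b a = frechet_derivative F (at a) b"
    "\<forall>\<^sub>F x in nhds a. F x = F a + (\<Sum>b\<in>Basis. ((x - a) \<bullet> b) * g b x)"
proof -
  obtain S where S: "open S" "a \<in> S" "smooth_on S F"
    using assms unfolding smooth_at_def by blast
  obtain r where r: "r > 0" "ball a r \<subseteq> S" using S openE by blast
  have F: "smooth_on (ball a r) F" using smooth_on_subset[OF S(3) r(2)] .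
  \<comment> \<open>The factor \<open>1\<close> is the constant weight, written out to match
    \<open>C_k_on_ray_integral\<close>.\<close>
  define g where "g b x = integral (cbox 0 1) (\<lambda>t. 1 * frechet_derivative F (at (a + t *\<^sub>R (x - a))) b)" for b x
  have FC: "C_k_on k (ball a r) F" for k using F unfolding smooth_on_def by blast
  have dFs: "smooth_on (ball a r) (\<lambda>x. frechet_derivative F (at x) b)" for b
    unfolding smooth_on_def using C_k_on_SucD(2)[OF FC] by blast
  have "smooth_on (ball a r) (g b)" for b
    unfolding smooth_on_def g_def
    by (intro allI C_k_on_ray_integral[OF dFs]) (rule continuous_on_const)
  then have "smooth_at (g b) a" for b using r(1) unfolding smooth_at_def by (metis centre_in_ball open_ball)
  moreover have "g b a = frechet_derivative F (at a) b" for b by (simp add: g_def)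
  moreover have "F x = F a + (\<Sum>b\<in>Basis. ((x - a) \<bullet> b) * g b x)" if x: "x \<in> ball a r" for x
  proof -
    have dF: "(F has_derivative frechet_derivative F (at y)) (at y)" if "y \<in> ball a r" for y
      using C_k_on_SucD(1)[OF FC that] .
    have "((\<lambda>t. F (a + t *\<^sub>R (x - a))) has_vector_derivative
        frechet_derivative F (at (a + t *\<^sub>R (x - a))) (x - a)) (at t within {0..1})"
      if t: "t \<in> {0..1}" for t
    proof -
      have "((\<lambda>t. a + t *\<^sub>R (x - a)) has_derivative (\<lambda>s. s *\<^sub>R (x - a))) (at t within {0..1})"
        by (auto intro!: derivative_eq_intros)
      from has_derivative_compose[OF this dF[OF ray_in_ball[OF x t]]]
      show ?thesis
        using linear_cmul[OF has_derivative_linear[OF dF[OF ray_in_ball[OF x t]]]]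
        unfolding has_vector_derivative_def by simp
    qed
    then have "((\<lambda>t. frechet_derivative F (at (a + t *\<^sub>R (x - a))) (x - a)) has_integral
        F (a + 1 *\<^sub>R (x - a)) - F (a + 0 *\<^sub>R (x - a))) {0..1}"
      by (rule fundamental_theorem_of_calculus[OF zero_le_one])
    then have "F x - F a = integral (cbox 0 1) (\<lambda>t. frechet_derivative F (at (a + t *\<^sub>R (x - a))) (x - a))"
      by (simp add: integral_unique)
    also have "\<dots> = integral (cbox 0 1)
        (\<lambda>t. \<Sum>b\<in>Basis. ((x - a) \<bullet> b) * frechet_derivative F (at (a + t *\<^sub>R (x - a))) b)"
    proof (rule integral_cong)
      fix t :: real assume "t \<in> cbox 0 1"
      then have "a + t *\<^sub>R (x - a) \<in> ball a r" using ray_in_ball[OF x] by simp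
      from linear_eq_sum_Basis[OF has_derivative_linear[OF dF[OF this]], of "x - a"]
      show "frechet_derivative F (at (a + t *\<^sub>R (x - a))) (x - a) =
          (\<Sum>b\<in>Basis. ((x - a) \<bullet> b) * frechet_derivative F (at (a + t *\<^sub>R (x - a))) b)"
        by simp
    qed
    also have "\<dots> = (\<Sum>b\<in>Basis. integral (cbox 0 1)
        (\<lambda>t. ((x - a) \<bullet> b) * frechet_derivative F (at (a + t *\<^sub>R (x - a))) b))"
    proof (rule integral_sum[OF finite_Basis])
      fix b :: 'a assume "b \<in> Basis"
      have "continuous_on (cbox 0 1) (\<lambda>t. ((x - a) \<bullet> b) * frechet_derivative F (at (a + t *\<^sub>R (x - a))) b)"
        by (intro continuous_intros continuous_on_compose2[OF C_k_on_imp_continuous_on[OF C_k_on_SucD(2)[OF FC]]])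
          (use ray_in_ball[OF x] in auto)
      then show "(\<lambda>t. ((x - a) \<bullet> b) * frechet_derivative F (at (a + t *\<^sub>R (x - a))) b) integrable_on cbox 0 1"
        by (rule integrable_continuous)
    qed
    also have "\<dots> = (\<Sum>b\<in>Basis. ((x - a) \<bullet> b) * g b x)" by (simp add: g_def)
    finally show ?thesis by simp
  qed
  then have "\<forall>\<^sub>F x in nhds a. F x = F a + (\<Sum>b\<in>Basis. ((x - a) \<bullet> b) * g b x)"
    unfolding eventually_nhds using r(1) by (metis centre_in_ball open_ball)
  ultimately show thesis by (rule that)
qed

subsection \<open>Bump functions\<close>

text \<open>The denominators \<open>t ^ m\<close> make the span of this family closed under differentiation.\<close>

definition flat_exp :: "nat \<Rightarrow> real \<Rightarrow> real"
  where "flat_exp m t = (if t > 0 then exp (- (1 / t)) / t ^ m else 0)"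

text \<open>With \<open>s = 1 / t\<close> the right-hand limit is that of
  \<open>s ^ m / exp s\<close> at infinity; to the left the function is \<open>0\<close>.\<close>

lemma flat_exp_tendsto_0: "(flat_exp m \<longlongrightarrow> 0) (at 0)"
proof (subst filterlim_at_split, intro conjI)
  have "((\<lambda>t. (inverse t) ^ m / exp (inverse t)) \<longlongrightarrow> (0::real)) (at_right 0)"
    by (rule filterlim_compose[OF tendsto_power_div_exp_0 filterlim_inverse_at_top_right])
  moreover have "\<forall>\<^sub>F t in at_right 0. (inverse t) ^ m / exp (inverse t) = flat_exp m t"
    by (auto simp: eventually_at_filter flat_exp_def exp_minus field_simps)
  ultimately show "(flat_exp m \<longlongrightarrow> 0) (at_right 0)" by (rule Lim_transform_eventually)
  have "\<forall>\<^sub>F t in at_left 0. 0 = flat_exp m t"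
    by (auto simp: eventually_at_filter flat_exp_def)
  then show "(flat_exp m \<longlongrightarrow> 0) (at_left 0)" by (rule Lim_transform_eventually[OF tendsto_const])
qed

lemma flat_exp_has_derivative:
  "(flat_exp m has_derivative (\<lambda>v. v * (flat_exp (m + 2) t - real m * flat_exp (m + 1) t))) (at t)"
proof -
  consider "t > 0" | "t < 0" | "t = 0" by linarith
  then have "(flat_exp m has_field_derivative (flat_exp (m + 2) t - real m * flat_exp (m + 1) t)) (at t)"
  proof cases
    case 1
    have "((\<lambda>t. exp (- (1 / t)) / t ^ m) has_field_derivative
        (exp (- (1 / t)) * (1 / t\<^sup>2) * t ^ m - exp (- (1 / t)) * (real m * t ^ (m - 1))) / (t ^ m * t ^ m)) (at t)"
      using 1 by (auto intro!: derivative_eq_intros simp: power2_eq_square divide_simps)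
    moreover have "(exp (- (1 / t)) * (1 / t\<^sup>2) * t ^ m - exp (- (1 / t)) * (real m * t ^ (m - 1))) / (t ^ m * t ^ m)
        = flat_exp (m + 2) t - real m * flat_exp (m + 1) t"
      using 1 by (cases m) (auto simp: flat_exp_def power2_eq_square field_simps)
    ultimately have "((\<lambda>t. exp (- (1 / t)) / t ^ m) has_field_derivative
        (flat_exp (m + 2) t - real m * flat_exp (m + 1) t)) (at t)" by simp
    then show ?thesis
      by (rule has_field_derivative_transform_within_open[of _ _ _ "{0<..}"])
        (use 1 in \<open>auto simp: flat_exp_def\<close>)
  next
    case 2
    have "((\<lambda>t. 0) has_field_derivative (flat_exp (m + 2) t - real m * flat_exp (m + 1) t)) (at t)"
      using 2 by (simp add: flat_exp_def)
    then show ?thesis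
      by (rule has_field_derivative_transform_within_open[of _ _ _ "{..<0}"])
        (use 2 in \<open>auto simp: flat_exp_def\<close>)
  next
    case 3
    \<comment> \<open>At the origin the difference quotient is the next member of the family, whose
      limit is already known to be \<open>0\<close>.\<close>
    have "\<forall>\<^sub>F h in at 0. flat_exp (m + 1) h = (flat_exp m (0 + h) - flat_exp m 0) / h"
      by (auto simp: eventually_at_filter flat_exp_def field_simps)
    then have "((\<lambda>h. (flat_exp m (0 + h) - flat_exp m 0) / h) \<longlongrightarrow> 0) (at 0)"
      by (rule Lim_transform_eventually[OF flat_exp_tendsto_0])
    then show ?thesis using 3 by (simp add: DERIV_def flat_exp_def)
  qed
  then show ?thesis by (simp add: has_field_derivative_def mult.commute[of _ "flat_exp _ _ - _"])
qed

lemma smooth_on_flat_exp: "smooth_on UNIV (flat_exp m)"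
proof -
  have "C_k_on k UNIV (flat_exp m)" for k
  proof (induction k arbitrary: m)
    case 0
    show ?case
      using has_derivative_continuous[OF flat_exp_has_derivative]
      by (simp add: continuous_at_imp_continuous_on)
  next
    case (Suc k)
    have *: "(\<lambda>t. v * (flat_exp (m + 2) t - real m * flat_exp (m + 1) t)) =
        (\<lambda>t. v * flat_exp (m + 2) t + (- v * real m) * flat_exp (m + 1) t)" for v
      by (auto simp: algebra_simps)
    show ?case
      by (rule C_k_on_SucI[OF open_UNIV flat_exp_has_derivative], unfold *)
        (intro C_k_on_add C_k_on_linear[OF bounded_linear_mult_right] open_UNIV Suc.IH)
  qed
  then show ?thesis unfolding smooth_on_def by blast
qed

text \<open>\<open>u\<close> is positive exactly within distance \<open>2 * r\<close> of
  \<open>a\<close> and \<open>v\<close> exactly beyond distance \<open>r\<close>, so they never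
  vanish together, and \<open>u / (u + v)\<close> is \<open>1\<close> on the inner ball and
  \<open>0\<close> off the outer one. The squared norm \<open>q\<close> is used because the norm is
  not smooth at its centre.\<close>

lemma euclidean_bump:
  fixes a :: "'e::euclidean_space"
  assumes "r > 0"
  obtains \<beta> :: "'e \<Rightarrow> real" where "\<And>x. smooth_at \<beta> x" "\<And>x. x \<in> ball a r \<Longrightarrow> \<beta> x = 1"
    "\<And>x. x \<notin> ball a (2 * r) \<Longrightarrow> \<beta> x = 0"
proof -
  define q where "q x = (x - a) \<bullet> (x - a)" for x
  define u where "u x = flat_exp 0 (4 * r\<^sup>2 - q x)" for x
  define v where "v x = flat_exp 0 (q x - r\<^sup>2)" for x
  define \<beta> where "\<beta> x = u x * inverse (u x + v x)" for x
  have flat: "smooth_at (flat_exp 0) t" for t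
    using smooth_on_flat_exp[of 0] unfolding smooth_at_def by blast
  have q: "smooth_at q x" for x
    unfolding q_def
    by (intro smooth_at_bilinear[OF bounded_bilinear_inner] smooth_at_diff smooth_at_ident smooth_at_const)
  have u: "smooth_at u x" for x
    unfolding u_def by (intro smooth_at_compose[OF _ flat] smooth_at_diff q smooth_at_const)
  have v: "smooth_at v x" for x
    unfolding v_def by (intro smooth_at_compose[OF _ flat] smooth_at_diff q smooth_at_const)
  have pos: "u x + v x > 0" for x
  proof -
    have "4 * r\<^sup>2 - q x > 0 \<or> q x - r\<^sup>2 > 0" using assms by (smt (verit) zero_less_power)
    moreover have "u x \<ge> 0" "v x \<ge> 0" by (auto simp: u_def v_def flat_exp_def)
    ultimately show ?thesis by (auto simp: add_pos_pos u_def v_def flat_exp_def)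
  qed
  have "smooth_at \<beta> x" for x
    unfolding \<beta>_def using pos[of x]
    by (intro smooth_at_bilinear[OF bounded_bilinear_mult] smooth_at_inverse smooth_at_add u v) auto
  moreover have "\<beta> x = 1" if "x \<in> ball a r" for x
  proof -
    have "(norm (x - a))\<^sup>2 \<le> r\<^sup>2"
      using that by (intro power_mono) (auto simp: dist_norm norm_minus_commute)
    then have "v x = 0" by (simp add: v_def flat_exp_def q_def power2_norm_eq_inner)
    then show ?thesis using pos[of x] by (simp add: \<beta>_def)
  qed
  moreover have "\<beta> x = 0" if "x \<notin> ball a (2 * r)" for x
  proof -
    have "(2 * r)\<^sup>2 \<le> (norm (x - a))\<^sup>2"
      using that assms by (intro power_mono) (auto simp: dist_norm norm_minus_commute)
    then have "u x = 0" by (simp add: u_def flat_exp_def q_def power2_norm_eq_inner)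
    then show ?thesis by (simp add: \<beta>_def)
  qed
  ultimately show thesis by (rule that)
qed

section \<open>Smooth functions and derivations on a manifold\<close>

text \<open>The codomain is an arbitrary normed space because operator-valued functions such as Gram
  matrices occur later. One chart is enough: for a smooth atlas the transition maps make the choice
  immaterial.\<close>

definition smooth_near ::
  "('m::topological_space, 'e::euclidean_space) atlas \<Rightarrow> ('m \<Rightarrow> 'b::real_normed_vector) \<Rightarrow> 'm \<Rightarrow> bool"
  where "smooth_near A f p \<longleftrightarrow> (\<exists>(U, \<phi>)\<in>A. p \<in> U \<and> smooth_at (f \<circ> inv_into U \<phi>) (\<phi> p))"

locale smooth_manifold =
  fixes A :: "('m::{t2_space, second_countable_topology}, 'e::euclidean_space) atlas"
  assumes atlas: "smooth_atlas A"
begin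

section \<open>Charts and smooth germs\<close>

lemma chart_exists: obtains U \<phi> where "(U, \<phi>) \<in> A" "p \<in> U"
proof -
  have "p \<in> (\<Union>(U, \<phi>)\<in>A. U)" using atlas unfolding smooth_atlas_def by simp
  then show thesis using that by auto
qed

lemma chart:
  assumes "(U, \<phi>) \<in> A"
  shows open_chart: "open U" and open_chart_range: "open (\<phi> ` U)"
    and chart_homeomorphism: "homeomorphism U (\<phi> ` U) \<phi> (inv_into U \<phi>)"
  using bspec[OF conjunct1[OF conjunct2[OF atlas[unfolded smooth_atlas_def]]] assms] by simp_all

lemma chart_inverse [simp]: "(U, \<phi>) \<in> A \<Longrightarrow> q \<in> U \<Longrightarrow> inv_into U \<phi> (\<phi> q) = q"
  using chart_homeomorphism unfolding homeomorphism_def by blast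

lemma filterlim_chart:
  assumes "(U, \<phi>) \<in> A" "p \<in> U"
  shows "filterlim \<phi> (nhds (\<phi> p)) (nhds p)"
proof -
  have "continuous_on U \<phi>" using chart_homeomorphism[OF assms(1)] unfolding homeomorphism_def by blast
  then have "isCont \<phi> p" using open_chart[OF assms(1)] assms(2) continuous_on_eq_continuous_at by blast
  then show ?thesis by (simp add: isCont_def tendsto_at_iff_tendsto_nhds)
qed

lemma filterlim_chart_inverse:
  assumes "(U, \<phi>) \<in> A" "p \<in> U"
  shows "filterlim (inv_into U \<phi>) (nhds p) (nhds (\<phi> p))"
proof -
  have "continuous_on (\<phi> ` U) (inv_into U \<phi>)"
    using chart_homeomorphism[OF assms(1)] unfolding homeomorphism_def by blast
  then have "isCont (inv_into U \<phi>) (\<phi> p)"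
    using open_chart_range[OF assms(1)] assms(2) continuous_on_eq_continuous_at by blast
  then have "filterlim (inv_into U \<phi>) (nhds (inv_into U \<phi> (\<phi> p))) (nhds (\<phi> p))"
    by (simp only: isCont_def tendsto_at_iff_tendsto_nhds)
  then show ?thesis using assms by simp
qed

lemma eventually_in_chart: "(U, \<phi>) \<in> A \<Longrightarrow> p \<in> U \<Longrightarrow> \<forall>\<^sub>F q in nhds p. q \<in> U"
  by (rule eventually_nhds_in_open[OF open_chart])

lemma eventually_in_chart_range: "(U, \<phi>) \<in> A \<Longrightarrow> p \<in> U \<Longrightarrow> \<forall>\<^sub>F x in nhds (\<phi> p). x \<in> \<phi> ` U"
  by (rule eventually_nhds_in_open[OF open_chart_range]) auto

lemma eventually_chart_iff:
  assumes "(U, \<phi>) \<in> A" "p \<in> U"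
  shows "(\<forall>\<^sub>F x in nhds (\<phi> p). P (inv_into U \<phi> x)) \<longleftrightarrow> (\<forall>\<^sub>F q in nhds p. P q)"
proof
  assume "\<forall>\<^sub>F x in nhds (\<phi> p). P (inv_into U \<phi> x)"
  from eventually_compose_filterlim[OF this filterlim_chart[OF assms]]
  show "\<forall>\<^sub>F q in nhds p. P q"
    using eventually_in_chart[OF assms] by eventually_elim (use assms(1) in simp)
next
  assume "\<forall>\<^sub>F q in nhds p. P q"
  from eventually_compose_filterlim[OF this filterlim_chart_inverse[OF assms]]
  show "\<forall>\<^sub>F x in nhds (\<phi> p). P (inv_into U \<phi> x)" .
qed

lemma transition_smooth_at:
  assumes "(U, \<phi>) \<in> A" "(V, \<psi>) \<in> A" "p \<in> U" "p \<in> V"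
  shows "smooth_at (\<psi> \<circ> inv_into U \<phi>) (\<phi> p)"
proof -
  have "open (\<phi> ` (U \<inter> V))"
    using homeomorphism_imp_open_map[OF chart_homeomorphism[OF assms(1)], of "U \<inter> V"]
      open_chart[OF assms(1)] open_chart[OF assms(2)] open_chart_range[OF assms(1)]
    by (metis inf_le1 openin_open_eq open_Int)
  moreover have "smooth_on (\<phi> ` (U \<inter> V)) (\<psi> \<circ> inv_into U \<phi>)"
    using bspec[OF bspec[OF conjunct2[OF conjunct2[OF atlas[unfolded smooth_atlas_def]]] assms(1), unfolded prod.case] assms(2)]
    by simp
  ultimately show ?thesis using assms(3,4) smooth_on_iff_smooth_at by blast
qed

lemma smooth_near_chart:
  assumes "(U, \<phi>) \<in> A" "p \<in> U"
  shows "smooth_near A f p \<longleftrightarrow> smooth_at (f \<circ> inv_into U \<phi>) (\<phi> p)"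
proof
  assume "smooth_near A f p"
  then obtain V \<psi> where V: "(V, \<psi>) \<in> A" "p \<in> V" "smooth_at (f \<circ> inv_into V \<psi>) (\<psi> p)"
    unfolding smooth_near_def by blast
  have "smooth_at (\<lambda>x. (f \<circ> inv_into V \<psi>) ((\<psi> \<circ> inv_into U \<phi>) x)) (\<phi> p)"
    by (rule smooth_at_compose[OF transition_smooth_at[OF assms(1) V(1) assms(2) V(2)]])
      (use V assms in \<open>simp add: comp_def\<close>)
  then show "smooth_at (f \<circ> inv_into U \<phi>) (\<phi> p)"
  proof (rule smooth_at_cong)
    have "\<forall>\<^sub>F q in nhds p. f q = (f \<circ> inv_into V \<psi>) (\<psi> q)"
      using eventually_in_chart[OF V(1,2)] by eventually_elim (use V(1) in simp)
    then show "\<forall>\<^sub>F x in nhds (\<phi> p). (f \<circ> inv_into U \<phi>) x = (f \<circ> inv_into V \<psi>) ((\<psi> \<circ> inv_into U \<phi>) x)"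
      using eventually_chart_iff[OF assms, of "\<lambda>q. f q = (f \<circ> inv_into V \<psi>) (\<psi> q)"] by simp
  qed
qed (use assms in \<open>auto simp: smooth_near_def\<close>)

lemma smooth_functions_iff: "f \<in> smooth_functions A \<longleftrightarrow> (\<forall>p. smooth_near A f p)"
proof
  assume f: "f \<in> smooth_functions A"
  show "\<forall>p. smooth_near A f p"
  proof
    fix p
    obtain U \<phi> where U: "(U, \<phi>) \<in> A" "p \<in> U" by (rule chart_exists)
    have "smooth_on (\<phi> ` U) (f \<circ> inv_into U \<phi>)" using f U unfolding smooth_functions_def by blast
    then show "smooth_near A f p"
      using U smooth_near_chart[OF U] smooth_on_iff_smooth_at[OF open_chart_range[OF U(1)]] by blast
  qed
next
  assume f: "\<forall>p. smooth_near A f p"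
  have "smooth_on (\<phi> ` U) (f \<circ> inv_into U \<phi>)" if "(U, \<phi>) \<in> A" for U \<phi>
    using f that smooth_near_chart[OF that] smooth_on_iff_smooth_at[OF open_chart_range[OF that]] by blast
  then show "f \<in> smooth_functions A" unfolding smooth_functions_def by blast
qed

lemma smooth_near_cong:
  assumes "smooth_near A f p" "\<forall>\<^sub>F q in nhds p. g q = f q"
  shows "smooth_near A g p"
proof -
  obtain U \<phi> where U: "(U, \<phi>) \<in> A" "p \<in> U" by (rule chart_exists)
  show ?thesis
    using smooth_at_cong[of "f \<circ> inv_into U \<phi>" "\<phi> p" "g \<circ> inv_into U \<phi>"]
      assms eventually_chart_iff[OF U, of "\<lambda>q. g q = f q"]
    unfolding smooth_near_chart[OF U] by simp
qed

lemma eventually_smooth_near: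
  assumes "smooth_near A f p"
  shows "\<forall>\<^sub>F q in nhds p. smooth_near A f q"
proof -
  obtain U \<phi> where U: "(U, \<phi>) \<in> A" "p \<in> U" by (rule chart_exists)
  have "\<forall>\<^sub>F x in nhds (\<phi> p). smooth_at (f \<circ> inv_into U \<phi>) x"
    using assms smooth_near_chart[OF U] eventually_smooth_at by blast
  from eventually_compose_filterlim[OF this filterlim_chart[OF U]]
  show ?thesis
    using eventually_in_chart[OF U] by eventually_elim (use smooth_near_chart[OF U(1)] in blast)
qed

lemma smooth_near_const: "smooth_near A (\<lambda>q. c) p"
proof -
  obtain U \<phi> where U: "(U, \<phi>) \<in> A" "p \<in> U" by (rule chart_exists)
  show ?thesis unfolding smooth_near_chart[OF U] comp_def by (rule smooth_at_const)
qed

lemma smooth_near_linear: "bounded_linear L \<Longrightarrow> smooth_near A f p \<Longrightarrow> smooth_near A (\<lambda>q. L (f q)) p"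
  unfolding smooth_near_def comp_def by (auto intro: smooth_at_linear)

lemma smooth_near_bilinear:
  assumes "bounded_bilinear B" "smooth_near A f p" "smooth_near A g p"
  shows "smooth_near A (\<lambda>q. B (f q) (g q)) p"
proof -
  obtain U \<phi> where U: "(U, \<phi>) \<in> A" "p \<in> U" by (rule chart_exists)
  show ?thesis
    using assms(2,3) unfolding smooth_near_chart[OF U] comp_def by (rule smooth_at_bilinear[OF assms(1)])
qed

lemma smooth_near_add:
  assumes "smooth_near A f p" "smooth_near A g p"
  shows "smooth_near A (\<lambda>q. f q + g q) p"
proof -
  obtain U \<phi> where U: "(U, \<phi>) \<in> A" "p \<in> U" by (rule chart_exists)
  show ?thesis
    using assms unfolding smooth_near_chart[OF U] comp_def by (rule smooth_at_add)
qed

lemma smooth_near_sum: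
  assumes "\<And>i. i \<in> I \<Longrightarrow> smooth_near A (f i) p"
  shows "smooth_near A (\<lambda>q. \<Sum>i\<in>I. f i q) p"
proof -
  obtain U \<phi> where U: "(U, \<phi>) \<in> A" "p \<in> U" by (rule chart_exists)
  show ?thesis
    using assms unfolding smooth_near_chart[OF U] comp_def by (rule smooth_at_sum)
qed

lemma smooth_near_blinfun_inverse:
  fixes F R :: "'m \<Rightarrow> ('d::real_normed_vector \<Rightarrow>\<^sub>L 'd)"
  assumes "smooth_near A F p"
    and "\<forall>\<^sub>F q in nhds p. R q o\<^sub>L F q = id_blinfun \<and> F q o\<^sub>L R q = id_blinfun"
  shows "smooth_near A R p"
proof -
  obtain U \<phi> where U: "(U, \<phi>) \<in> A" "p \<in> U" by (rule chart_exists)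
  show ?thesis
    unfolding smooth_near_chart[OF U] comp_def
    by (rule smooth_at_blinfun_inverse[OF assms(1)[unfolded smooth_near_chart[OF U] comp_def]])
      (use assms(2) eventually_chart_iff[OF U,
        of "\<lambda>q. R q o\<^sub>L F q = id_blinfun \<and> F q o\<^sub>L R q = id_blinfun"] in simp)
qed

lemma smooth_near_chart_compose:
  assumes "(U, \<phi>) \<in> A" "p \<in> U" "smooth_at G (\<phi> p)"
  shows "smooth_near A (\<lambda>q. G (\<phi> q)) p"
  unfolding smooth_near_chart[OF assms(1,2)] comp_def
proof (rule smooth_at_cong[OF assms(3)])
  show "\<forall>\<^sub>F x in nhds (\<phi> p). G (\<phi> (inv_into U \<phi> x)) = G x"
    using eventually_in_chart_range[OF assms(1,2)]
    by eventually_elim (simp add: f_inv_into_f)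
qed

lemma smooth_functionsD: "f \<in> smooth_functions A \<Longrightarrow> smooth_near A f p"
  by (simp add: smooth_functions_iff)

lemma smooth_functions_const: "(\<lambda>q. c) \<in> smooth_functions A"
  by (simp add: smooth_functions_iff smooth_near_const)

lemma smooth_functions_add:
  "f \<in> smooth_functions A \<Longrightarrow> g \<in> smooth_functions A \<Longrightarrow> (\<lambda>q. f q + g q) \<in> smooth_functions A"
  by (simp add: smooth_functions_iff smooth_near_add)

lemma smooth_functions_mult:
  "f \<in> smooth_functions A \<Longrightarrow> g \<in> smooth_functions A \<Longrightarrow> (\<lambda>q. f q * g q) \<in> smooth_functions A"
  by (simp add: smooth_functions_iff smooth_near_bilinear[OF bounded_bilinear_mult])

lemma smooth_functions_diff:
  assumes "f \<in> smooth_functions A" "g \<in> smooth_functions A"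
  shows "(\<lambda>q. f q - g q) \<in> smooth_functions A"
  using smooth_functions_add[OF assms(1) smooth_functions_mult[OF smooth_functions_const[of "- 1"] assms(2)]]
  by simp

lemma smooth_functions_sum:
  "(\<And>i. i \<in> I \<Longrightarrow> f i \<in> smooth_functions A) \<Longrightarrow> (\<lambda>q. \<Sum>i\<in>I. f i q) \<in> smooth_functions A"
  by (simp add: smooth_functions_iff smooth_near_sum)

section \<open>Cutoffs and extension of germs\<close>

text \<open>Vanishing outside a closed \<open>K\<close> inside \<open>W\<close>, rather than merely
  outside \<open>W\<close>, is what lets functions defined on \<open>W\<close> be extended by zero:
  the complement of \<open>K\<close> is open and covers every point where \<open>W\<close>
  ends.\<close>

lemma bump_function:
  assumes "open W" "p \<in> W"
  obtains \<beta> K where "\<beta> \<in> smooth_functions A" "\<forall>\<^sub>F q in nhds p. \<beta> q = 1"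
    "closed K" "K \<subseteq> W" "\<And>q. q \<notin> K \<Longrightarrow> \<beta> q = (0::real)"
proof -
  obtain U \<phi> where U: "(U, \<phi>) \<in> A" "p \<in> U" by (rule chart_exists)
  have "\<forall>\<^sub>F x in nhds (\<phi> p). inv_into U \<phi> x \<in> W"
    using eventually_chart_iff[OF U, of "\<lambda>q. q \<in> W"] assms eventually_nhds by blast
  with eventually_in_chart_range[OF U]
  have "\<forall>\<^sub>F x in nhds (\<phi> p). x \<in> \<phi> ` U \<and> inv_into U \<phi> x \<in> W" by eventually_elim blast
  then obtain S where S: "open S" "\<phi> p \<in> S" "\<And>x. x \<in> S \<Longrightarrow> x \<in> \<phi> ` U \<and> inv_into U \<phi> x \<in> W"
    unfolding eventually_nhds by blast
  then obtain s where s: "s > 0" "cball (\<phi> p) s \<subseteq> S" using open_contains_cball by blast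
  obtain b :: "'e \<Rightarrow> real" where b: "\<And>x. smooth_at b x" "\<And>x. x \<in> ball (\<phi> p) (s / 2) \<Longrightarrow> b x = 1"
    "\<And>x. x \<notin> ball (\<phi> p) s \<Longrightarrow> b x = 0"
    by (rule euclidean_bump[of "s / 2" "\<phi> p"]) (use s(1) in auto)
  define K where "K = inv_into U \<phi> ` cball (\<phi> p) s"
  define \<beta> where "\<beta> q = (if q \<in> U then b (\<phi> q) else 0)" for q
  have "continuous_on (cball (\<phi> p) s) (inv_into U \<phi>)"
    using chart_homeomorphism[OF U(1)] continuous_on_subset s(2) S(3)
    unfolding homeomorphism_def by (metis subsetI subsetD)
  then have "compact K" unfolding K_def by (intro compact_continuous_image compact_cball)
  \<comment> \<open>The Hausdorff property enters here: the compact set \<open>K\<close> is closed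
    in the whole manifold, so the bump extended by \<open>0\<close> is smooth also at points outside
    the chart domain.\<close>
  then have K: "closed K" "K \<subseteq> W" using s(2) S(3) by (auto simp: K_def compact_imp_closed)
  have \<beta>0: "\<beta> q = 0" if "q \<notin> K" for q
  proof (cases "q \<in> U")
    case True
    then have "\<phi> q \<notin> cball (\<phi> p) s" using that chart_inverse[OF U(1) True] unfolding K_def by force
    then show ?thesis using b(3) by (simp add: \<beta>_def)
  qed (simp add: \<beta>_def)
  have "smooth_near A \<beta> q" for q
  proof (cases "q \<in> U")
    case True
    show ?thesis
    proof (rule smooth_near_cong[OF smooth_near_chart_compose[OF U(1) True b(1)]])
      show "\<forall>\<^sub>F q in nhds q. \<beta> q = b (\<phi> q)"
        using eventually_in_chart[OF U(1) True] by eventually_elim (simp add: \<beta>_def)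
    qed
  next
    case False
    have "K \<subseteq> U" using s(2) S(3) unfolding K_def by (auto intro: inv_into_into)
    with False K(1) have "\<forall>\<^sub>F q in nhds q. q \<in> - K" by (intro eventually_nhds_in_open) auto
    then have "\<forall>\<^sub>F q in nhds q. \<beta> q = 0" by eventually_elim (simp add: \<beta>0)
    then show ?thesis by (rule smooth_near_cong[OF smooth_near_const])
  qed
  then have "\<beta> \<in> smooth_functions A" using smooth_functions_iff by blast
  moreover have "\<forall>\<^sub>F q in nhds p. \<beta> q = 1"
  proof -
    have "\<forall>\<^sub>F x in nhds (\<phi> p). x \<in> ball (\<phi> p) (s / 2)"
      using s(1) by (intro eventually_nhds_in_open) auto
    from eventually_compose_filterlim[OF this filterlim_chart[OF U]]
    show ?thesis using eventually_in_chart[OF U] by eventually_elim (simp add: \<beta>_def b(2))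
  qed
  ultimately show thesis using K \<beta>0 by (rule that)
qed

lemma smooth_functions_cutoff:
  assumes "\<beta> \<in> smooth_functions A" "closed K" "\<And>q. q \<notin> K \<Longrightarrow> \<beta> q = 0"
    and "\<And>q. q \<in> K \<Longrightarrow> smooth_near A f q"
  shows "(\<lambda>q. \<beta> q * f q) \<in> smooth_functions A"
proof -
  have "smooth_near A (\<lambda>q. \<beta> q * f q) q" for q
  proof (cases "q \<in> K")
    case True
    then show ?thesis
      by (rule smooth_near_bilinear[OF bounded_bilinear_mult smooth_functionsD[OF assms(1)] assms(4)])
  next
    case False
    with assms(2) have "\<forall>\<^sub>F q in nhds q. q \<in> - K" by (intro eventually_nhds_in_open) auto
    then have "\<forall>\<^sub>F q in nhds q. \<beta> q * f q = 0" by eventually_elim (simp add: assms(3))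
    then show ?thesis by (rule smooth_near_cong[OF smooth_near_const])
  qed
  then show ?thesis using smooth_functions_iff by blast
qed

text \<open>Tangent vectors act on global functions only; this is how local data, such as
  expressions in a chart, become arguments for them.\<close>

lemma extend_germ:
  fixes f :: "'m \<Rightarrow> real"
  assumes "smooth_near A f p"
  obtains g where "g \<in> smooth_functions A" "\<forall>\<^sub>F q in nhds p. g q = f q"
proof -
  obtain W where W: "open W" "p \<in> W" "\<And>q. q \<in> W \<Longrightarrow> smooth_near A f q"
    using eventually_smooth_near[OF assms] unfolding eventually_nhds by blast
  obtain \<beta> K where \<beta>: "\<beta> \<in> smooth_functions A" "\<forall>\<^sub>F q in nhds p. \<beta> q = 1"
    and K: "closed K" "K \<subseteq> W" "\<And>q. q \<notin> K \<Longrightarrow> \<beta> q = (0::real)"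
    using bump_function[OF W(1,2)] by blast
  have "(\<lambda>q. \<beta> q * f q) \<in> smooth_functions A"
    by (rule smooth_functions_cutoff[OF \<beta>(1) K(1,3)]) (use K(2) W(3) in auto)
  moreover have "\<forall>\<^sub>F q in nhds p. \<beta> q * f q = f q" using \<beta>(2) by eventually_elim simp
  ultimately show thesis by (rule that)
qed

section \<open>Tangent vectors as derivations\<close>

lemma tangent_add:
  "v \<in> tangent_space A p \<Longrightarrow> f \<in> smooth_functions A \<Longrightarrow> g \<in> smooth_functions A \<Longrightarrow>
    v (\<lambda>q. f q + g q) = v f + v g"
  unfolding tangent_space_def by blast

lemma tangent_cmult:
  "v \<in> tangent_space A p \<Longrightarrow> f \<in> smooth_functions A \<Longrightarrow> v (\<lambda>q. c * f q) = c * v f"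
  unfolding tangent_space_def by blast

lemma tangent_mult:
  "v \<in> tangent_space A p \<Longrightarrow> f \<in> smooth_functions A \<Longrightarrow> g \<in> smooth_functions A \<Longrightarrow>
    v (\<lambda>q. f q * g q) = v f * g p + f p * v g"
  unfolding tangent_space_def by blast

lemma tangent_not_smooth: "v \<in> tangent_space A p \<Longrightarrow> f \<notin> smooth_functions A \<Longrightarrow> v f = 0"
  unfolding tangent_space_def by blast

lemma tangent_spaceI:
  assumes "\<And>f g. f \<in> smooth_functions A \<Longrightarrow> g \<in> smooth_functions A \<Longrightarrow> v (\<lambda>q. f q + g q) = v f + v g"
    and "\<And>c f. f \<in> smooth_functions A \<Longrightarrow> v (\<lambda>q. c * f q) = c * v f"
    and "\<And>f g. f \<in> smooth_functions A \<Longrightarrow> g \<in> smooth_functions A \<Longrightarrow>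
      v (\<lambda>q. f q * g q) = v f * g p + f p * v g"
    and "\<And>f. f \<notin> smooth_functions A \<Longrightarrow> v f = 0"
  shows "v \<in> tangent_space A p"
  using assms unfolding tangent_space_def by blast

text \<open>\<open>1 = 1 * 1\<close> and the Leibniz rule give \<open>v 1 = 2 * v 1\<close>.\<close>

lemma tangent_const: assumes "v \<in> tangent_space A p" shows "v (\<lambda>q. c) = 0"
proof -
  have "v (\<lambda>q. 1) = 0"
    using tangent_mult[OF assms smooth_functions_const[of 1] smooth_functions_const[of 1]] by simp
  then show ?thesis using tangent_cmult[OF assms smooth_functions_const[of 1], of c] by simp
qed

lemma tangent_diff:
  assumes "v \<in> tangent_space A p" "f \<in> smooth_functions A" "g \<in> smooth_functions A"
  shows "v (\<lambda>q. f q - g q) = v f - v g"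
  using tangent_add[OF assms(1,2) smooth_functions_mult[OF smooth_functions_const[of "- 1"] assms(3)]]
    tangent_cmult[OF assms(1,3), of "- 1"] by simp

lemma tangent_sum:
  assumes "v \<in> tangent_space A p" "\<And>i. i \<in> I \<Longrightarrow> f i \<in> smooth_functions A"
  shows "v (\<lambda>q. \<Sum>i\<in>I. f i q) = (\<Sum>i\<in>I. v (f i))"
  using assms(2)
proof (induction I rule: infinite_finite_induct)
  case (insert i I)
  then show ?case
    using tangent_add[OF assms(1), of "f i" "\<lambda>q. \<Sum>i\<in>I. f i q"] smooth_functions_sum[of I f] by simp
qed (simp_all add: tangent_const[OF assms(1)])

text \<open>For a bump \<open>\<beta>\<close> inside the region of agreement, the product of
  \<open>\<beta>\<close> and \<open>f - g\<close> is identically \<open>0\<close>. The Leibniz rule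
  at \<open>p\<close>, where \<open>\<beta>\<close> is \<open>1\<close> and \<open>f - g\<close> is
  \<open>0\<close>, then leaves the value of \<open>v\<close> at \<open>f - g\<close>.\<close>

lemma tangent_local:
  assumes "v \<in> tangent_space A p" "f \<in> smooth_functions A" "g \<in> smooth_functions A"
    and "\<forall>\<^sub>F q in nhds p. f q = g q"
  shows "v f = v g"
proof -
  obtain W where W: "open W" "p \<in> W" "\<And>q. q \<in> W \<Longrightarrow> f q = g q"
    using assms(4) unfolding eventually_nhds by blast
  obtain \<beta> K where \<beta>: "\<beta> \<in> smooth_functions A" "\<forall>\<^sub>F q in nhds p. \<beta> q = 1"
    and K: "closed K" "K \<subseteq> W" "\<And>q. q \<notin> K \<Longrightarrow> \<beta> q = (0::real)"
    using bump_function[OF W(1,2)] by blast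
  have "(\<lambda>q. \<beta> q * (f q - g q)) = (\<lambda>q. 0)" using K W(3) by force
  moreover have "\<beta> p = 1" using \<beta>(2) by (rule eventually_nhds_x_imp_x)
  ultimately have "v (\<lambda>q. f q - g q) = 0"
    using tangent_mult[OF assms(1) \<beta>(1) smooth_functions_diff[OF assms(2,3)]] W(2,3)
      tangent_const[OF assms(1), of 0] by simp
  then show ?thesis using tangent_diff[OF assms(1-3)] by simp
qed

text \<open>Agreement on smooth functions is equality of HOL functions because derivations are
  required to be \<open>0\<close> on all other arguments.\<close>

lemma tangent_eqI:
  assumes "v \<in> tangent_space A p" "w \<in> tangent_space A p" "\<And>f. f \<in> smooth_functions A \<Longrightarrow> v f = w f"
  shows "v = w"
  using assms tangent_not_smooth by (metis ext)

lemma tangent_space_lincomb: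
  assumes "u \<in> tangent_space A p" "v \<in> tangent_space A p"
  shows "(\<lambda>f. a * u f + b * v f) \<in> tangent_space A p"
  by (rule tangent_spaceI)
    (simp_all add: tangent_add[OF assms(1)] tangent_add[OF assms(2)] tangent_cmult[OF assms(1)]
      tangent_cmult[OF assms(2)] tangent_mult[OF assms(1)] tangent_mult[OF assms(2)]
      tangent_not_smooth[OF assms(1)] tangent_not_smooth[OF assms(2)] algebra_simps)

lemma tangent_space_zero: "(\<lambda>f. 0) \<in> tangent_space A p"
  by (rule tangent_spaceI) simp_all

lemma tangent_space_sum:
  assumes "\<And>i. i \<in> I \<Longrightarrow> v i \<in> tangent_space A p"
  shows "(\<lambda>f. \<Sum>i\<in>I. c i * v i f) \<in> tangent_space A p"
  using assms
proof (induction I rule: infinite_finite_induct)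
  case (insert i I)
  then show ?case
    using tangent_space_lincomb[of "v i" p "\<lambda>f. \<Sum>i\<in>I. c i * v i f" "c i" 1] by simp
qed (simp_all add: tangent_space_zero)

section \<open>Smooth vector fields\<close>

lemma vector_fieldsD:
  "X \<in> vector_fields A \<Longrightarrow> X p \<in> tangent_space A p"
  "X \<in> vector_fields A \<Longrightarrow> f \<in> smooth_functions A \<Longrightarrow> (\<lambda>p. X p f) \<in> smooth_functions A"
  unfolding vector_fields_def by auto

lemma vector_fieldsI:
  "(\<And>p. X p \<in> tangent_space A p) \<Longrightarrow>
   (\<And>f. f \<in> smooth_functions A \<Longrightarrow> (\<lambda>p. X p f) \<in> smooth_functions A) \<Longrightarrow> X \<in> vector_fields A"
  unfolding vector_fields_def by auto

lemma vector_fields_add: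
  "X \<in> vector_fields A \<Longrightarrow> Y \<in> vector_fields A \<Longrightarrow> (\<lambda>p f. X p f + Y p f) \<in> vector_fields A"
  using tangent_space_lincomb[of "X _" _ "Y _" 1 1]
  by (intro vector_fieldsI smooth_functions_add) (simp_all add: vector_fieldsD)

lemma vector_fields_mult:
  "g \<in> smooth_functions A \<Longrightarrow> X \<in> vector_fields A \<Longrightarrow> (\<lambda>p f. g p * X p f) \<in> vector_fields A"
  using tangent_space_lincomb[of "X p" p "X p" "g p" 0 for p]
  by (intro vector_fieldsI smooth_functions_mult) (simp_all add: vector_fieldsD)

lemma vector_fields_zero: "(\<lambda>p f. 0) \<in> vector_fields A"
  by (intro vector_fieldsI tangent_space_zero smooth_functions_const)

lemma vector_fields_sum:
  assumes "\<And>i. i \<in> I \<Longrightarrow> X i \<in> vector_fields A"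
  shows "(\<lambda>p f. \<Sum>i\<in>I. X i p f) \<in> vector_fields A"
  using assms
proof (induction I rule: infinite_finite_induct)
  case (insert i I)
  then show ?case using vector_fields_add[of "X i" "\<lambda>p f. \<Sum>i\<in>I. X i p f"] by simp
qed (simp_all add: vector_fields_zero)

end

section \<open>Coordinate frames and local formulas for connections\<close>

context smooth_manifold
begin

text \<open>Chart coordinates and partial derivatives are multiplied by a bump function to become
  global objects; they are the genuine ones on the set \<open>W\<close>, where the bump equals
  \<open>1\<close>. That partial derivatives span all derivations is where Hadamard's lemma is
  needed.\<close>

lemma coordinate_frame:
  assumes U: "(U, \<phi>) \<in> A" "p \<in> U"
  obtains x :: "'e \<Rightarrow> 'm \<Rightarrow> real" and E :: "'e \<Rightarrow> 'm vfield" and W where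
    "open W" "p \<in> W"
    "\<And>b. x b \<in> smooth_functions A" "\<And>b. E b \<in> vector_fields A"
    "\<And>q b f. q \<in> W \<Longrightarrow> f \<in> smooth_functions A \<Longrightarrow>
      E b q f = frechet_derivative (f \<circ> inv_into U \<phi>) (at (\<phi> q)) b"
    "\<And>q b c. q \<in> W \<Longrightarrow> E b q (x c) = b \<bullet> c"
    "\<And>q v. q \<in> W \<Longrightarrow> v \<in> tangent_space A q \<Longrightarrow> v = (\<lambda>f. \<Sum>b\<in>Basis. v (x b) * E b q f)"
proof -
  obtain \<beta> K where \<beta>: "\<beta> \<in> smooth_functions A" "\<forall>\<^sub>F q in nhds p. \<beta> q = 1"
    and K: "closed K" "K \<subseteq> U" "\<And>q. q \<notin> K \<Longrightarrow> \<beta> q = (0::real)"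
    using bump_function[OF open_chart[OF U(1)] U(2)] by blast
  have "\<forall>\<^sub>F q in nhds p. \<beta> q = 1 \<and> q \<in> U"
    using \<beta>(2) eventually_in_chart[OF U] by (rule eventually_conj)
  then obtain W where W: "open W" "p \<in> W" "\<And>q. q \<in> W \<Longrightarrow> \<beta> q = 1" "W \<subseteq> U"
    unfolding eventually_nhds by blast
  define x where "x b q = \<beta> q * (\<phi> q \<bullet> b)" for b q
  define dd where "dd f q b = frechet_derivative (f \<circ> inv_into U \<phi>) (at (\<phi> q)) b" for f :: "'m \<Rightarrow> real" and q b
  \<comment> \<open>The case distinction honours the convention that derivations vanish on
    non-smooth functions.\<close>
  define E where "E b q f = (if f \<in> smooth_functions A then \<beta> q * dd f q b else 0)" for b q f
  have x: "x b \<in> smooth_functions A" for b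
    unfolding x_def
  proof (rule smooth_functions_cutoff[OF \<beta>(1) K(1,3)])
    fix q assume "q \<in> K"
    then show "smooth_near A (\<lambda>q. \<phi> q \<bullet> b) q"
      using K(2) smooth_near_chart_compose[OF U(1) _ smooth_at_linear[OF bounded_linear_inner_left smooth_at_ident]]
      by blast
  qed
  have smooth_chart: "smooth_at (f \<circ> inv_into U \<phi>) (\<phi> q)" if "f \<in> smooth_functions A" "q \<in> U" for f :: "'m \<Rightarrow> real" and q
    using smooth_functionsD[OF that(1)] smooth_near_chart[OF U(1) that(2)] by blast
  have deriv: "((f \<circ> inv_into U \<phi>) has_derivative dd f q) (at (\<phi> q))" if "f \<in> smooth_functions A" "q \<in> U" for f q
    unfolding dd_def using smooth_at_has_derivative[OF smooth_chart[OF that]] by simp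
  have dd_eqI: "dd f q b = f' b" if "((f \<circ> inv_into U \<phi>) has_derivative f') (at (\<phi> q))" for f q f' b
    unfolding dd_def using frechet_derivative_at[OF that] by simp
  have E_tangent: "E b q \<in> tangent_space A q" for b q
  proof (cases "q \<in> U")
    case True
    show ?thesis
    proof (rule tangent_spaceI)
      fix f g assume fg: "f \<in> smooth_functions A" "g \<in> smooth_functions A"
      have "dd (\<lambda>q. f q + g q) q b = dd f q b + dd g q b"
        using has_derivative_add[OF deriv[OF fg(1) True] deriv[OF fg(2) True]]
        by (intro dd_eqI[where f' = "\<lambda>b. dd f q b + dd g q b"]) (simp add: comp_def)
      then show "E b q (\<lambda>q. f q + g q) = E b q f + E b q g"
        using fg smooth_functions_add by (simp add: E_def algebra_simps)
      have "dd (\<lambda>q. f q * g q) q b = f q * dd g q b + dd f q b * g q"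
        using has_derivative_mult[OF deriv[OF fg(1) True] deriv[OF fg(2) True]] U(1) True
        by (intro dd_eqI[where f' = "\<lambda>b. f q * dd g q b + dd f q b * g q"]) (simp add: comp_def)
      then show "E b q (\<lambda>q. f q * g q) = E b q f * g q + f q * E b q g"
        using fg smooth_functions_mult by (simp add: E_def algebra_simps)
    next
      fix c f assume f: "f \<in> smooth_functions A"
      have "dd (\<lambda>q. c * f q) q b = c * dd f q b"
        using has_derivative_mult_right[OF deriv[OF f True], of c]
        by (intro dd_eqI[where f' = "\<lambda>b. c * dd f q b"]) (simp add: comp_def)
      then show "E b q (\<lambda>q. c * f q) = c * E b q f"
        using f smooth_functions_mult[OF smooth_functions_const] by (simp add: E_def)
    qed (simp add: E_def)
  next
    case False
    then have "E b q = (\<lambda>f. 0)" using K by (intro ext) (auto simp: E_def)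
    then show ?thesis using tangent_space_zero by simp
  qed
  have E: "E b \<in> vector_fields A" for b
  proof (rule vector_fieldsI[OF E_tangent])
    fix f assume f: "f \<in> smooth_functions A"
    have "(\<lambda>q. \<beta> q * dd f q b) \<in> smooth_functions A"
    proof (rule smooth_functions_cutoff[OF \<beta>(1) K(1,3)])
      fix q assume "q \<in> K"
      then have q: "q \<in> U" using K(2) by blast
      show "smooth_near A (\<lambda>q. dd f q b) q"
        unfolding dd_def
        by (rule smooth_near_chart_compose[OF U(1) q smooth_at_frechet_derivative[OF smooth_chart[OF f q]]])
    qed
    then show "(\<lambda>q. E b q f) \<in> smooth_functions A" using f by (simp add: E_def)
  qed
  have E_W: "E b q f = dd f q b" if "q \<in> W" "f \<in> smooth_functions A" for b q f
    using W(3)[OF that(1)] that(2) by (simp add: E_def)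
  have x_W: "x b q = \<phi> q \<bullet> b" if "q \<in> W" for b q using W(3)[OF that] by (simp add: x_def)
  have ev_W: "\<forall>\<^sub>F q' in nhds q. q' \<in> W" if "q \<in> W" for q
    using W(1) that by (rule eventually_nhds_in_open)
  have "E b q (x c) = b \<bullet> c" if q: "q \<in> W" for b q c
  proof -
    have qU: "q \<in> U" using q W(4) by blast
    have "\<forall>\<^sub>F y in nhds (\<phi> q). (x c \<circ> inv_into U \<phi>) y = y \<bullet> c"
    proof -
      have "\<forall>\<^sub>F y in nhds (\<phi> q). inv_into U \<phi> y \<in> W"
        using eventually_chart_iff[OF U(1) qU, of "\<lambda>q. q \<in> W"] ev_W[OF q] by simp
      then show ?thesis using eventually_in_chart_range[OF U(1) qU]
        by eventually_elim (simp add: x_W f_inv_into_f)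
    qed
    then obtain S where S: "open S" "\<phi> q \<in> S" "\<And>y. y \<in> S \<Longrightarrow> y \<bullet> c = (x c \<circ> inv_into U \<phi>) y"
      unfolding eventually_nhds by metis
    have "((\<lambda>y. y \<bullet> c) has_derivative (\<lambda>b. b \<bullet> c)) (at (\<phi> q))"
      by (auto intro!: derivative_eq_intros)
    from dd_eqI[OF has_derivative_transform_within_open[OF this S]] E_W[OF q x]
    show ?thesis by simp
  qed
  \<comment> \<open>Near \<open>q\<close>, \<open>f\<close> is the constant \<open>f q\<close> plus
    products of \<open>x b - x b q\<close> with \<open>h b\<close>. The derivation kills the
    constant, and since the first factor vanishes at \<open>q\<close> the Leibniz rule leaves
    \<open>v (x b) * h b q\<close>, where \<open>h b q\<close> is the partial derivative.\<close>
  moreover have "v = (\<lambda>f. \<Sum>b\<in>Basis. v (x b) * E b q f)" if q: "q \<in> W" and v: "v \<in> tangent_space A q" for q v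
  proof (rule tangent_eqI[OF v tangent_space_sum[OF E_tangent]])
    fix f assume f: "f \<in> smooth_functions A"
    have qU: "q \<in> U" using q W(4) by blast
    obtain g where g: "\<And>b. smooth_at (g b) (\<phi> q)" "\<And>b. g b (\<phi> q) = dd f q b"
      and fg: "\<forall>\<^sub>F y in nhds (\<phi> q). (f \<circ> inv_into U \<phi>) y =
        (f \<circ> inv_into U \<phi>) (\<phi> q) + (\<Sum>b\<in>Basis. ((y - \<phi> q) \<bullet> b) * g b y)"
      using hadamard[OF smooth_chart[OF f qU]] unfolding dd_def by blast
    \<comment> \<open>Hadamard's factors live in the chart and are good only near \<open>q\<close>;
      their germs are extended so that \<open>v\<close> can act on them.\<close>
    have "\<exists>h. h \<in> smooth_functions A \<and> (\<forall>\<^sub>F q' in nhds q. h q' = g b (\<phi> q'))" for b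
      using extend_germ[OF smooth_near_chart_compose[OF U(1) qU g(1)]] by metis
    then obtain h where h: "\<And>b. h b \<in> smooth_functions A" "\<And>b. \<forall>\<^sub>F q' in nhds q. h b q' = g b (\<phi> q')"
      by metis
    have hq: "h b q = dd f q b" for b
      using eventually_nhds_x_imp_x[OF h(2)] g(2) by simp
    define r where "r q' = (\<Sum>b\<in>Basis. (x b q' - x b q) * h b q')" for q'
    have xq: "(\<lambda>q'. x b q' - x b q) \<in> smooth_functions A" for b
      by (intro smooth_functions_diff x smooth_functions_const)
    have r: "r \<in> smooth_functions A"
      unfolding r_def by (intro smooth_functions_sum smooth_functions_mult xq h)
    have "\<forall>\<^sub>F q' in nhds q. \<forall>b\<in>Basis. h b q' = g b (\<phi> q')"
      by (intro eventually_ball_finite finite_Basis ballI h(2))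
    moreover have "\<forall>\<^sub>F q' in nhds q. f (inv_into U \<phi> (\<phi> q')) =
        f (inv_into U \<phi> (\<phi> q)) + (\<Sum>b\<in>Basis. ((\<phi> q' - \<phi> q) \<bullet> b) * g b (\<phi> q'))"
      using eventually_compose_filterlim[OF fg filterlim_chart[OF U(1) qU]] by simp
    ultimately have "\<forall>\<^sub>F q' in nhds q. f q' = f q + r q'"
      using ev_W[OF q] eventually_in_chart[OF U(1) qU]
    proof eventually_elim
      case (elim q')
      then show ?case
        using U(1) qU q by (simp add: r_def x_W inner_diff_left)
    qed
    from tangent_local[OF v f _ this] have "v f = v (\<lambda>q'. f q + r q')"
      using smooth_functions_add[OF smooth_functions_const r] by blast
    also have "\<dots> = v r"
      using tangent_add[OF v smooth_functions_const r] tangent_const[OF v] by simp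
    also have "\<dots> = (\<Sum>b\<in>Basis. v (\<lambda>q'. (x b q' - x b q) * h b q'))"
      unfolding r_def by (rule tangent_sum[OF v]) (intro smooth_functions_mult xq h)
    also have "\<dots> = (\<Sum>b\<in>Basis. v (x b) * E b q f)"
      by (intro sum.cong refl)
        (simp add: tangent_mult[OF v xq h(1)] tangent_diff[OF v x smooth_functions_const]
          tangent_const[OF v] hq E_W[OF q f])
    finally show "v f = (\<Sum>b\<in>Basis. v (x b) * E b q f)" .
  qed
  ultimately show thesis
    using W(1,2) x E E_W unfolding dd_def by (rule that[rotated 5])
qed

lemma frame_exists:
  obtains x :: "'e \<Rightarrow> 'm \<Rightarrow> real" and E :: "'e \<Rightarrow> 'm vfield" and W where
    "open W" "p \<in> W"
    "\<And>b. x b \<in> smooth_functions A" "\<And>b. E b \<in> vector_fields A"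
    "\<And>q b c. q \<in> W \<Longrightarrow> E b q (x c) = b \<bullet> c"
    "\<And>q v. q \<in> W \<Longrightarrow> v \<in> tangent_space A q \<Longrightarrow> v = (\<lambda>f. \<Sum>b\<in>Basis. v (x b) * E b q f)"
proof -
  obtain U \<phi> where U: "(U, \<phi>) \<in> A" "p \<in> U" by (rule chart_exists)
  show thesis by (rule coordinate_frame[OF U]) (rule that; assumption)
qed

end

section \<open>Affine connections in a local frame\<close>

locale manifold_connection = smooth_manifold A
  for A :: "('m::{t2_space, second_countable_topology}, 'e::euclidean_space) atlas" +
  fixes D :: "'m connection"
  assumes connection: "affine_connection A D"
begin

lemma connection_vector_field:
  "X \<in> vector_fields A \<Longrightarrow> Y \<in> vector_fields A \<Longrightarrow> D X Y \<in> vector_fields A"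
  using connection unfolding affine_connection_def by (elim conjE) simp

lemma connection_add:
  assumes "X \<in> vector_fields A" "Y \<in> vector_fields A" "Z \<in> vector_fields A"
  shows "D (\<lambda>p g. X p g + Y p g) Z = (\<lambda>p g. D X Z p g + D Y Z p g)"
    and "D Z (\<lambda>p g. X p g + Y p g) = (\<lambda>p g. D Z X p g + D Z Y p g)"
  using bspec[OF bspec[OF bspec[OF conjunct1[OF conjunct2[OF connection[unfolded affine_connection_def]]]
        assms(1)] assms(2)] assms(3)] by auto

lemma connection_mult:
  assumes "X \<in> vector_fields A" "Y \<in> vector_fields A" "f \<in> smooth_functions A"
  shows "D (\<lambda>p g. f p * X p g) Y = (\<lambda>p g. f p * D X Y p g)"
    and "D X (\<lambda>p g. f p * Y p g) = (\<lambda>p g. X p f * Y p g + f p * D X Y p g)"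
  using bspec[OF bspec[OF bspec[OF conjunct2[OF conjunct2[OF connection[unfolded affine_connection_def]]]
        assms(1)] assms(2)] assms(3)] by auto

lemma connection_zero:
  assumes "X \<in> vector_fields A"
  shows "D (\<lambda>p g. 0) X = (\<lambda>p g. 0)" "D X (\<lambda>p g. 0) = (\<lambda>p g. 0)"
  using connection_mult(1)[OF vector_fields_zero assms smooth_functions_const[of 0]]
    connection_mult(2)[OF assms vector_fields_zero smooth_functions_const[of 0]] by simp_all

lemma connection_sum:
  assumes "X \<in> vector_fields A" "\<And>i. i \<in> I \<Longrightarrow> Y i \<in> vector_fields A"
  shows "D (\<lambda>p g. \<Sum>i\<in>I. Y i p g) X = (\<lambda>p g. \<Sum>i\<in>I. D (Y i) X p g)"
    and "D X (\<lambda>p g. \<Sum>i\<in>I. Y i p g) = (\<lambda>p g. \<Sum>i\<in>I. D X (Y i) p g)"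
proof -
  have "D (\<lambda>p g. \<Sum>i\<in>I. Y i p g) X = (\<lambda>p g. \<Sum>i\<in>I. D (Y i) X p g) \<and>
      D X (\<lambda>p g. \<Sum>i\<in>I. Y i p g) = (\<lambda>p g. \<Sum>i\<in>I. D X (Y i) p g)"
    using assms(2)
  proof (induction I rule: infinite_finite_induct)
    case (insert i I)
    then have "Y i \<in> vector_fields A" "(\<lambda>p g. \<Sum>i\<in>I. Y i p g) \<in> vector_fields A"
      by (auto intro: vector_fields_sum)
    from connection_add[OF this assms(1)] insert show ?case by simp
  qed (simp_all add: connection_zero[OF assms(1)])
  then show "D (\<lambda>p g. \<Sum>i\<in>I. Y i p g) X = (\<lambda>p g. \<Sum>i\<in>I. D (Y i) X p g)"
    "D X (\<lambda>p g. \<Sum>i\<in>I. Y i p g) = (\<lambda>p g. \<Sum>i\<in>I. D X (Y i) p g)" by auto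
qed

text \<open>The Christoffel expansion, with \<open>D (E c) (E b)\<close> in place of the symbols.
  The frame spans only on \<open>W\<close>, while the connection axioms speak of global fields;
  multiplying a field by a bump \<open>\<beta>\<close> turns its expansion into a global identity.
  At \<open>p\<close> the bump leaves no trace, as \<open>\<beta> p = 1\<close> and
  \<open>X p \<beta> = 0\<close>.\<close>

lemma connection_local_formula:
  assumes W: "open W" "p \<in> W"
    and x: "\<And>b. x b \<in> smooth_functions A" and E: "\<And>b. E b \<in> vector_fields A"
    and frame: "\<And>q v. q \<in> W \<Longrightarrow> v \<in> tangent_space A q \<Longrightarrow> v = (\<lambda>f. \<Sum>b\<in>Basis. v (x b) * E b q f)"
    and X: "X \<in> vector_fields A" and Y: "Y \<in> vector_fields A"
  shows "D X Y p g = (\<Sum>b\<in>Basis. X p (\<lambda>q. Y q (x b)) * E b p g +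
      Y p (x b) * (\<Sum>c\<in>Basis. X p (x c) * D (E c) (E b) p g))"
proof -
  obtain \<beta> K where \<beta>: "\<beta> \<in> smooth_functions A" "\<forall>\<^sub>F q in nhds p. \<beta> q = 1"
    and K: "closed K" "K \<subseteq> W" "\<And>q. q \<notin> K \<Longrightarrow> \<beta> q = (0::real)"
    using bump_function[OF W] by blast
  have \<beta>p: "\<beta> p = 1" using \<beta>(2) by (rule eventually_nhds_x_imp_x)
  have expand: "(\<lambda>q f. \<beta> q * Z q f) = (\<lambda>q f. \<Sum>b\<in>Basis. (\<beta> q * Z q (x b)) * E b q f)"
    if Z: "Z \<in> vector_fields A" for Z
  proof (intro ext)
    fix q f
    show "\<beta> q * Z q f = (\<Sum>b\<in>Basis. (\<beta> q * Z q (x b)) * E b q f)"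
    proof (cases "q \<in> W")
      case True
      have "Z q f = (\<Sum>b\<in>Basis. Z q (x b) * E b q f)"
        using fun_cong[OF frame[OF True vector_fieldsD(1)[OF Z]], of f] .
      then show ?thesis by (simp add: sum_distrib_left mult.assoc)
    next
      case False
      then have "\<beta> q = 0" using K(2,3) by blast
      then show ?thesis by simp
    qed
  qed
  have coeff: "(\<lambda>q. \<beta> q * Z q (x b)) \<in> smooth_functions A" if "Z \<in> vector_fields A" for Z b
    using smooth_functions_mult[OF \<beta>(1) vector_fieldsD(2)[OF that x]] .
  have left: "D Z V p g = (\<Sum>c\<in>Basis. Z p (x c) * D (E c) V p g)"
    if Z: "Z \<in> vector_fields A" and V: "V \<in> vector_fields A" for Z V
  proof -
    have "D Z V p g = D (\<lambda>q f. \<beta> q * Z q f) V p g"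
      by (simp add: connection_mult(1)[OF Z V \<beta>(1)] \<beta>p)
    also have "\<dots> = (\<Sum>c\<in>Basis. Z p (x c) * D (E c) V p g)"
      unfolding expand[OF Z]
      by (simp add: connection_sum(1)[OF V vector_fields_mult[OF coeff[OF Z] E]]
          connection_mult(1)[OF E V coeff[OF Z]] \<beta>p)
    finally show ?thesis .
  qed
  have "X p \<beta> = X p (\<lambda>q. 1)"
    by (rule tangent_local[OF vector_fieldsD(1)[OF X] \<beta>(1) smooth_functions_const \<beta>(2)])
  then have X\<beta>: "X p \<beta> = 0" using tangent_const[OF vector_fieldsD(1)[OF X]] by simp
  have XY: "X p (\<lambda>q. \<beta> q * Y q (x b)) = X p (\<lambda>q. Y q (x b))" for b
    using tangent_mult[OF vector_fieldsD(1)[OF X] \<beta>(1) vector_fieldsD(2)[OF Y x]] by (simp add: X\<beta> \<beta>p)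
  have "D X Y p g = D X (\<lambda>q f. \<beta> q * Y q f) p g"
    by (simp add: connection_mult(2)[OF X Y \<beta>(1)] \<beta>p X\<beta>)
  also have "\<dots> = (\<Sum>b\<in>Basis. X p (\<lambda>q. Y q (x b)) * E b p g + Y p (x b) * D X (E b) p g)"
    unfolding expand[OF Y]
    by (simp add: connection_sum(2)[OF X vector_fields_mult[OF coeff[OF Y] E]]
        connection_mult(2)[OF X E coeff[OF Y]] \<beta>p XY)
  finally show ?thesis by (simp only: left[OF X E])
qed

end

section \<open>Immersions\<close>

lemma tangent_map_lincomb:
  "tangent_map A \<iota> (\<lambda>f. a * u f + b * v f) = (\<lambda>f. a * tangent_map A \<iota> u f + b * tangent_map A \<iota> v f)"
  by (intro ext) (simp add: tangent_map_def)

lemma tangent_map_sum: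
  "tangent_map A \<iota> (\<lambda>f. \<Sum>i\<in>I. c i * v i f) = (\<lambda>f. \<Sum>i\<in>I. c i * tangent_map A \<iota> (v i) f)"
  by (intro ext) (simp add: tangent_map_def)

locale immersed_manifold = N: smooth_manifold N + M: smooth_manifold M
  for N :: "('n::{t2_space, second_countable_topology}, 'd::euclidean_space) atlas"
    and M :: "('m::{t2_space, second_countable_topology}, 'e::euclidean_space) atlas" +
  fixes \<iota> :: "'n \<Rightarrow> 'm"
  assumes immersion: "immersion N M \<iota>"
begin

lemma smooth_immersion: "smooth_map N M \<iota>"
  using immersion unfolding immersion_def by blast

lemma eventually_immersion:
  assumes "\<forall>\<^sub>F q in nhds (\<iota> x). P q"
  shows "\<forall>\<^sub>F y in nhds x. P (\<iota> y)"
proof -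
  have "isCont \<iota> x"
    using smooth_immersion continuous_on_eq_continuous_at[OF open_UNIV] unfolding smooth_map_def by blast
  then have "filterlim \<iota> (nhds (\<iota> x)) (nhds x)"
    by (simp only: isCont_def tendsto_at_iff_tendsto_nhds)
  from eventually_compose_filterlim[OF assms this] show ?thesis .
qed

lemma chart_immersion_smooth_at:
  assumes "(U, \<phi>) \<in> N" "x \<in> U" "(V, \<psi>) \<in> M" "\<iota> x \<in> V"
  shows "smooth_at (\<psi> \<circ> \<iota> \<circ> inv_into U \<phi>) (\<phi> x)"
proof -
  have "open (\<iota> -` V)"
    using smooth_immersion M.open_chart[OF assms(3)] open_vimage unfolding smooth_map_def by blast
  then have "openin (top_of_set U) (U \<inter> \<iota> -` V)"
    using N.open_chart[OF assms(1)] by (simp add: openin_open_eq open_Int)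
  from homeomorphism_imp_open_map[OF N.chart_homeomorphism[OF assms(1)] this]
  have "open (\<phi> ` (U \<inter> \<iota> -` V))"
    using N.open_chart_range[OF assms(1)] by (simp add: openin_open_eq)
  moreover have "smooth_on (\<phi> ` (U \<inter> \<iota> -` V)) (\<psi> \<circ> \<iota> \<circ> inv_into U \<phi>)"
    using bspec[OF bspec[OF conjunct2[OF smooth_immersion[unfolded smooth_map_def]] assms(1),
          unfolded prod.case] assms(3)] by simp
  ultimately show ?thesis using assms(2,4) smooth_on_iff_smooth_at by blast
qed

lemma pullback_smooth_near:
  assumes "smooth_near M f (\<iota> x)"
  shows "smooth_near N (\<lambda>y. f (\<iota> y)) x"
proof -
  obtain U \<phi> where U: "(U, \<phi>) \<in> N" "x \<in> U" by (rule N.chart_exists)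
  obtain V \<psi> where V: "(V, \<psi>) \<in> M" "\<iota> x \<in> V" by (rule M.chart_exists)
  have f: "smooth_at (f \<circ> inv_into V \<psi>) ((\<psi> \<circ> \<iota> \<circ> inv_into U \<phi>) (\<phi> x))"
    using assms M.smooth_near_chart[OF V, of f] U by simp
  have "smooth_near N (\<lambda>y. (f \<circ> inv_into V \<psi>) ((\<psi> \<circ> \<iota> \<circ> inv_into U \<phi>) (\<phi> y))) x"
    by (rule N.smooth_near_chart_compose[OF U smooth_at_compose[OF chart_immersion_smooth_at[OF U V] f]])
  moreover have "\<forall>\<^sub>F y in nhds x. f (\<iota> y) = (f \<circ> inv_into V \<psi>) ((\<psi> \<circ> \<iota> \<circ> inv_into U \<phi>) (\<phi> y))"
    using N.eventually_in_chart[OF U] eventually_immersion[OF M.eventually_in_chart[OF V]]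
    by eventually_elim (use U(1) V(1) in simp)
  ultimately show ?thesis by (rule N.smooth_near_cong)
qed

lemma pullback_smooth: "f \<in> smooth_functions M \<Longrightarrow> (\<lambda>y. f (\<iota> y)) \<in> smooth_functions N"
  by (simp add: N.smooth_functions_iff pullback_smooth_near M.smooth_functionsD)

lemma tangent_map_apply: "f \<in> smooth_functions M \<Longrightarrow> tangent_map M \<iota> v f = v (\<lambda>y. f (\<iota> y))"
  by (simp add: tangent_map_def comp_def)

lemma tangent_map_tangent:
  assumes v: "v \<in> tangent_space N x"
  shows "tangent_map M \<iota> v \<in> tangent_space M (\<iota> x)"
proof (rule M.tangent_spaceI)
  fix f g assume "f \<in> smooth_functions M" "g \<in> smooth_functions M"
  then show "tangent_map M \<iota> v (\<lambda>q. f q + g q) = tangent_map M \<iota> v f + tangent_map M \<iota> v g"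
    and "tangent_map M \<iota> v (\<lambda>q. f q * g q) = tangent_map M \<iota> v f * g (\<iota> x) + f (\<iota> x) * tangent_map M \<iota> v g"
    using N.tangent_add[OF v pullback_smooth pullback_smooth] N.tangent_mult[OF v pullback_smooth pullback_smooth]
    by (simp_all add: tangent_map_apply M.smooth_functions_add M.smooth_functions_mult)
next
  fix c f assume f: "f \<in> smooth_functions M"
  then show "tangent_map M \<iota> v (\<lambda>q. c * f q) = c * tangent_map M \<iota> v f"
    using N.tangent_cmult[OF v pullback_smooth[OF f]]
    by (simp add: tangent_map_apply M.smooth_functions_mult M.smooth_functions_const)
qed (simp add: tangent_map_def)

text \<open>A kernel vector \<open>h\<close> of the Jacobian is made into the derivation
  \<open>v\<close> at \<open>x\<close> with components \<open>h\<close>. By the chain rule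
  \<open>v\<close> annihilates every pulled back function, so the tangent map sends it where it
  sends \<open>0\<close>. Injectivity on derivations gives \<open>v = 0\<close>, and applying
  \<open>v\<close> to the coordinates gives \<open>h = 0\<close>.\<close>

lemma chart_immersion_derivative_inj:
  assumes U: "(U, \<phi>) \<in> N" "x \<in> U" and V: "(V, \<psi>) \<in> M" "\<iota> x \<in> V"
  shows "inj (frechet_derivative (\<psi> \<circ> \<iota> \<circ> inv_into U \<phi>) (at (\<phi> x)))"
proof -
  define F where "F = \<psi> \<circ> \<iota> \<circ> inv_into U \<phi>"
  have dF: "(F has_derivative frechet_derivative F (at (\<phi> x))) (at (\<phi> x))"
    unfolding F_def by (rule smooth_at_has_derivative[OF chart_immersion_smooth_at[OF U V]])
  obtain e E W where W: "x \<in> W" and e: "\<And>b. e b \<in> smooth_functions N"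
    and E: "\<And>b. E b \<in> vector_fields N"
    and E_deriv: "\<And>q b f. q \<in> W \<Longrightarrow> f \<in> smooth_functions N \<Longrightarrow>
      E b q f = frechet_derivative (f \<circ> inv_into U \<phi>) (at (\<phi> q)) b"
    and E_e: "\<And>q b c. q \<in> W \<Longrightarrow> E b q (e c) = b \<bullet> c"
    by (rule N.coordinate_frame[OF U]) (rule that; assumption)
  have "h = 0" if h: "frechet_derivative F (at (\<phi> x)) h = 0" for h
  proof -
    define v where "v f = (\<Sum>b\<in>Basis. (h \<bullet> b) * E b x f)" for f
    have v: "v \<in> tangent_space N x"
      unfolding v_def by (rule N.tangent_space_sum[OF N.vector_fieldsD(1)[OF E]])
    have "v (\<lambda>y. f (\<iota> y)) = 0" if f: "f \<in> smooth_functions M" for f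
    proof -
      have "smooth_at (f \<circ> inv_into V \<psi>) (\<psi> (\<iota> x))"
        using M.smooth_functionsD[OF f] M.smooth_near_chart[OF V, of f] by blast
      then have df: "((f \<circ> inv_into V \<psi>) has_derivative
          frechet_derivative (f \<circ> inv_into V \<psi>) (at (F (\<phi> x)))) (at (F (\<phi> x)))"
        using smooth_at_has_derivative U by (simp add: F_def)
      note d = has_derivative_compose[OF dF df]
      have "\<forall>\<^sub>F y in nhds x. f (\<iota> y) = (f \<circ> inv_into V \<psi>) (\<psi> (\<iota> y))"
        using eventually_immersion[OF M.eventually_in_chart[OF V]]
        by eventually_elim (use V(1) in simp)
      then have "\<forall>\<^sub>F z in nhds (\<phi> x). (f \<circ> inv_into V \<psi>) (F z) = ((\<lambda>y. f (\<iota> y)) \<circ> inv_into U \<phi>) z"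
        using N.eventually_chart_iff[OF U, of "\<lambda>y. f (\<iota> y) = (f \<circ> inv_into V \<psi>) (\<psi> (\<iota> y))"]
        by (simp add: F_def eq_commute)
      then obtain S where S: "open S" "\<phi> x \<in> S"
        "\<And>z. z \<in> S \<Longrightarrow> (f \<circ> inv_into V \<psi>) (F z) = ((\<lambda>y. f (\<iota> y)) \<circ> inv_into U \<phi>) z"
        unfolding eventually_nhds by blast
      note d' = has_derivative_transform_within_open[OF d S]
      have "E b x (\<lambda>y. f (\<iota> y)) = frechet_derivative (f \<circ> inv_into V \<psi>) (at (F (\<phi> x)))
          (frechet_derivative F (at (\<phi> x)) b)" for b
        unfolding E_deriv[OF W pullback_smooth[OF f]] by (rule fun_cong[OF frechet_derivative_at[OF d'], symmetric])
      then have "v (\<lambda>y. f (\<iota> y)) = (\<Sum>b\<in>Basis. (h \<bullet> b) *\<^sub>R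
          frechet_derivative (f \<circ> inv_into V \<psi>) (at (F (\<phi> x))) (frechet_derivative F (at (\<phi> x)) b))"
        by (simp add: v_def)
      also have "\<dots> = frechet_derivative (f \<circ> inv_into V \<psi>) (at (F (\<phi> x))) (frechet_derivative F (at (\<phi> x)) h)"
        by (rule linear_eq_sum_Basis[OF has_derivative_linear[OF d], symmetric])
      also have "\<dots> = 0" using h linear_0[OF has_derivative_linear[OF df]] by simp
      finally show ?thesis .
    qed
    then have "tangent_map M \<iota> v = tangent_map M \<iota> (\<lambda>f. 0)"
      by (intro ext) (simp add: tangent_map_def comp_def)
    then have "v = (\<lambda>f. 0)"
      using immersion v N.tangent_space_zero unfolding immersion_def inj_on_def by blast
    moreover have "v (e c) = h \<bullet> c" for c
      using E_e[OF W] linear_eq_sum_Basis[OF bounded_linear.linear[OF bounded_linear_inner_left], of h c]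
      by (simp add: v_def)
    ultimately have "h \<bullet> c = 0" for c by simp
    then show ?thesis by (metis inner_eq_zero_iff)
  qed
  then show ?thesis
    using linear_injective_0[OF has_derivative_linear[OF dF]] unfolding F_def by blast
qed

section \<open>Extending functions and fields off the submanifold\<close>

text \<open>With \<open>L\<close> a linear left inverse of the Jacobian, \<open>L \<circ> F\<close>
  maps the model space of the submanifold to itself and has the identity as its derivative, so it
  has a smooth local inverse \<open>H\<close>. Then \<open>H \<circ> L\<close> is a smooth left
  inverse of the chart expression \<open>F\<close>, and \<open>g\<close> read in its chart is
  composed with it.\<close>

lemma extend_function:
  assumes g: "g \<in> smooth_functions N"
  obtains g' where "g' \<in> smooth_functions M" "\<forall>\<^sub>F y in nhds x. g' (\<iota> y) = g y"
proof -
  obtain U \<phi> where U: "(U, \<phi>) \<in> N" "x \<in> U" by (rule N.chart_exists)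
  obtain V \<psi> where V: "(V, \<psi>) \<in> M" "\<iota> x \<in> V" by (rule M.chart_exists)
  define F where "F = \<psi> \<circ> \<iota> \<circ> inv_into U \<phi>"
  have F: "smooth_at F (\<phi> x)" unfolding F_def by (rule chart_immersion_smooth_at[OF U V])
  note dF = smooth_at_has_derivative[OF F]
  have "inj (frechet_derivative F (at (\<phi> x)))"
    unfolding F_def by (rule chart_immersion_derivative_inj[OF U V])
  then obtain L where L: "linear L" "L \<circ> frechet_derivative F (at (\<phi> x)) = id"
    using linear_injective_left_inverse[OF has_derivative_linear[OF dF]] by blast
  have bL: "bounded_linear L" using L(1) linear_conv_bounded_linear by blast
  have dG: "((\<lambda>z. L (F z)) has_derivative (\<lambda>h. h)) (at (\<phi> x))"
    using bounded_linear.has_derivative[OF bL dF] fun_cong[OF L(2)] by simp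
  obtain H where H: "smooth_at H (L (F (\<phi> x)))" "\<forall>\<^sub>F z in nhds (\<phi> x). H (L (F z)) = z"
    by (rule smooth_at_local_inverse[OF smooth_at_linear[OF bL F]])
      (simp add: frechet_derivative_at[OF dG, symmetric])
  have F\<phi>: "F (\<phi> x) = \<psi> (\<iota> x)" using U by (simp add: F_def)
  have "smooth_at (\<lambda>w. H (L w)) (\<psi> (\<iota> x))"
    by (rule smooth_at_compose[OF smooth_at_linear[OF bL smooth_at_ident]]) (use H(1) F\<phi> in simp)
  moreover have "smooth_at (g \<circ> inv_into U \<phi>) (H (L (\<psi> (\<iota> x))))"
    using N.smooth_functionsD[OF g] N.smooth_near_chart[OF U, of g] eventually_nhds_x_imp_x[OF H(2)] F\<phi> by simp
  ultimately have "smooth_at (\<lambda>w. (g \<circ> inv_into U \<phi>) (H (L w))) (\<psi> (\<iota> x))"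
    by (rule smooth_at_compose)
  from M.extend_germ[OF M.smooth_near_chart_compose[OF V this]]
  obtain g' where g': "g' \<in> smooth_functions M"
    "\<forall>\<^sub>F q in nhds (\<iota> x). g' q = (g \<circ> inv_into U \<phi>) (H (L (\<psi> q)))" by blast
  have "\<forall>\<^sub>F y in nhds x. g' (\<iota> y) = g y"
    using eventually_immersion[OF g'(2)] N.eventually_in_chart[OF U]
      eventually_compose_filterlim[OF H(2) N.filterlim_chart[OF U]]
    by eventually_elim (use U(1) in \<open>simp add: F_def\<close>)
  with g'(1) show thesis by (rule that)
qed

text \<open>The components \<open>X y (e b \<circ> \<iota>)\<close> of the pushed forward field in
  an ambient frame are functions on the submanifold; each of them is extended and then recombined
  with the frame.\<close>

lemma extend_vector_field:
  assumes X: "X \<in> vector_fields N"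
  obtains X' where "extends_near M \<iota> x X X'"
proof -
  obtain e :: "'e \<Rightarrow> 'm \<Rightarrow> real" and E W where W: "open W" "\<iota> x \<in> W" and e: "\<And>b. e b \<in> smooth_functions M"
    and E: "\<And>b. E b \<in> vector_fields M"
    and frame: "\<And>q v. q \<in> W \<Longrightarrow> v \<in> tangent_space M q \<Longrightarrow> v = (\<lambda>f. \<Sum>b\<in>Basis. v (e b) * E b q f)"
    by (rule M.frame_exists) (rule that; assumption)
  have "\<exists>g'. g' \<in> smooth_functions M \<and> (\<forall>\<^sub>F y in nhds x. g' (\<iota> y) = X y (\<lambda>y. e b (\<iota> y)))" for b
    using extend_function[OF N.vector_fieldsD(2)[OF X pullback_smooth[OF e]]] by metis
  then obtain c where c: "\<And>b. c b \<in> smooth_functions M"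
    "\<And>b. \<forall>\<^sub>F y in nhds x. c b (\<iota> y) = X y (\<lambda>y. e b (\<iota> y))" by metis
  define X' where "X' q f = (\<Sum>b\<in>Basis. c b q * E b q f)" for q f
  have "X' \<in> vector_fields M"
    unfolding X'_def by (intro M.vector_fields_sum M.vector_fields_mult c(1) E)
  moreover have "\<forall>\<^sub>F y in nhds x. X' (\<iota> y) = tangent_map M \<iota> (X y)"
  proof -
    have "\<forall>\<^sub>F y in nhds x. \<forall>b\<in>Basis. c b (\<iota> y) = X y (\<lambda>y. e b (\<iota> y))"
      by (intro eventually_ball_finite finite_Basis ballI c(2))
    moreover have "\<forall>\<^sub>F y in nhds x. \<iota> y \<in> W"
      by (rule eventually_immersion[OF eventually_nhds_in_open[OF W]])
    ultimately show ?thesis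
    proof eventually_elim
      case (elim y)
      have "tangent_map M \<iota> (X y) = (\<lambda>f. \<Sum>b\<in>Basis. tangent_map M \<iota> (X y) (e b) * E b (\<iota> y) f)"
        by (rule frame[OF elim(2) tangent_map_tangent[OF N.vector_fieldsD(1)[OF X]]])
      also have "\<dots> = X' (\<iota> y)"
        using elim(1) by (intro ext) (simp add: X'_def tangent_map_apply[OF e])
      finally show ?case by simp
    qed
  qed
  ultimately show thesis using that unfolding extends_near_def by blast
qed

lemma extends_nearD:
  assumes "extends_near M \<iota> x X X'"
  shows "X' \<in> vector_fields M" "\<forall>\<^sub>F y in nhds x. X' (\<iota> y) = tangent_map M \<iota> (X y)"
    "X' (\<iota> x) = tangent_map M \<iota> (X x)"
  using assms eventually_nhds_x_imp_x[of "\<lambda>y. X' (\<iota> y) = tangent_map M \<iota> (X y)"]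
  unfolding extends_near_def by auto

text \<open>One pair of extensions serves a whole neighbourhood, which is needed to see that the
  induced derivative varies smoothly with the point.\<close>

lemma eventually_extends_near:
  assumes "extends_near M \<iota> x X X'"
  shows "\<forall>\<^sub>F y in nhds x. extends_near M \<iota> y X X'"
proof -
  have "\<forall>\<^sub>F y in nhds x. \<forall>\<^sub>F z in nhds y. X' (\<iota> z) = tangent_map M \<iota> (X z)"
    using extends_nearD(2)[OF assms] by (simp add: eventually_eventually)
  then show ?thesis
    by eventually_elim (simp add: extends_near_def extends_nearD(1)[OF assms])
qed

text \<open>At \<open>\<iota> x\<close> the ambient field is a pushed forward vector, which sees
  \<open>f\<close> only through its restriction along \<open>\<iota>\<close>. Frame components,
  Leibniz terms, pairings and brackets are all transferred between the two manifolds this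
  way.\<close>

lemma extends_near_apply:
  assumes "X \<in> vector_fields N" "extends_near M \<iota> x X X'" "f \<in> smooth_functions M"
    "g \<in> smooth_functions N" "\<forall>\<^sub>F y in nhds x. f (\<iota> y) = g y"
  shows "X' (\<iota> x) f = X x g"
  using N.tangent_local[OF N.vector_fieldsD(1)[OF assms(1)] pullback_smooth[OF assms(3)] assms(4,5)]
  by (simp add: extends_nearD(3)[OF assms(2)] tangent_map_apply[OF assms(3)])

end

section \<open>Two-forms and their pullbacks\<close>

context smooth_manifold
begin

text \<open>The mixed terms \<open>X f * Y g\<close> and \<open>Y f * X g\<close> cancel in the
  commutator. On a non-smooth argument both inner derivatives are the constant
  \<open>0\<close>.\<close>

lemma lie_bracket_tangent:
  assumes X: "X \<in> vector_fields A" and Y: "Y \<in> vector_fields A"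
  shows "lie_bracket X Y p \<in> tangent_space A p"
proof (rule tangent_spaceI)
  note XT = vector_fieldsD(1)[OF X] and YT = vector_fieldsD(1)[OF Y]
  note XS = vector_fieldsD(2)[OF X] and YS = vector_fieldsD(2)[OF Y]
  fix f assume f: "f \<in> smooth_functions A"
  {
    fix g assume g: "g \<in> smooth_functions A"
    show "lie_bracket X Y p (\<lambda>q. f q + g q) = lie_bracket X Y p f + lie_bracket X Y p g"
      by (simp add: lie_bracket_def tangent_add[OF XT] tangent_add[OF YT] XS YS f g)
    show "lie_bracket X Y p (\<lambda>q. f q * g q) = lie_bracket X Y p f * g p + f p * lie_bracket X Y p g"
      by (simp add: lie_bracket_def tangent_mult[OF XT] tangent_mult[OF YT] tangent_add[OF XT]
          tangent_add[OF YT] smooth_functions_mult XS YS f g algebra_simps)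
  }
  show "lie_bracket X Y p (\<lambda>q. c * f q) = c * lie_bracket X Y p f" for c
    by (simp add: lie_bracket_def tangent_cmult[OF XT] tangent_cmult[OF YT] XS YS f algebra_simps)
next
  fix f assume "f \<notin> smooth_functions A"
  then show "lie_bracket X Y p f = 0"
    by (simp add: lie_bracket_def tangent_not_smooth[OF vector_fieldsD(1)[OF X]]
        tangent_not_smooth[OF vector_fieldsD(1)[OF Y]] tangent_const[OF vector_fieldsD(1)[OF X]]
        tangent_const[OF vector_fieldsD(1)[OF Y]])
qed

end

section \<open>Algebra of two-forms, and closedness from a torsion-free connection\<close>

locale manifold_two_form = smooth_manifold A
  for A :: "('m::{t2_space, second_countable_topology}, 'e::euclidean_space) atlas" +
  fixes \<omega> :: "'m form2"
  assumes form: "two_form A \<omega>"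
begin

lemma form_lincomb:
  assumes "u \<in> tangent_space A p" "v \<in> tangent_space A p" "w \<in> tangent_space A p"
  shows "\<omega> p (\<lambda>f. a * u f + b * v f) w = a * \<omega> p u w + b * \<omega> p v w"
    and "\<omega> p w (\<lambda>f. a * u f + b * v f) = a * \<omega> p w u + b * \<omega> p w v"
  using form assms unfolding two_form_def by (elim conjE, simp)+

lemma form_add:
  assumes "u \<in> tangent_space A p" "v \<in> tangent_space A p" "w \<in> tangent_space A p"
  shows "\<omega> p (\<lambda>f. u f + v f) w = \<omega> p u w + \<omega> p v w"
    and "\<omega> p w (\<lambda>f. u f + v f) = \<omega> p w u + \<omega> p w v"
  using form_lincomb[OF assms, of 1 1] by simp_all

lemma form_diff:
  assumes "u \<in> tangent_space A p" "v \<in> tangent_space A p" "w \<in> tangent_space A p"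
  shows "\<omega> p (\<lambda>f. u f - v f) w = \<omega> p u w - \<omega> p v w"
  using form_lincomb(1)[OF assms, of 1 "- 1"] by simp

lemma form_cmult:
  assumes "u \<in> tangent_space A p" "w \<in> tangent_space A p"
  shows "\<omega> p (\<lambda>f. a * u f) w = a * \<omega> p u w"
  using form_lincomb(1)[OF assms(1,1,2), of a 0] by simp

lemma form_zero:
  assumes "w \<in> tangent_space A p"
  shows "\<omega> p (\<lambda>f. 0) w = 0" "\<omega> p w (\<lambda>f. 0) = 0"
  using form_lincomb[OF assms assms assms, of 0 0] by simp_all

lemma form_self: "v \<in> tangent_space A p \<Longrightarrow> \<omega> p v v = 0"
  using form unfolding two_form_def by (elim conjE) simp

lemma form_skew:
  assumes "u \<in> tangent_space A p" "v \<in> tangent_space A p"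
  shows "\<omega> p u v = - \<omega> p v u"
proof -
  have uv: "(\<lambda>f. u f + v f) \<in> tangent_space A p"
    using tangent_space_lincomb[OF assms, of 1 1] by simp
  show ?thesis
    using form_self[OF uv] form_self[OF assms(1)] form_self[OF assms(2)]
    by (simp add: form_add(1)[OF assms uv] form_add(2)[OF assms assms(1)] form_add(2)[OF assms assms(2)])
qed

lemma form_sum:
  assumes "\<And>i. i \<in> I \<Longrightarrow> v i \<in> tangent_space A p" and w: "w \<in> tangent_space A p"
  shows "\<omega> p (\<lambda>f. \<Sum>i\<in>I. c i * v i f) w = (\<Sum>i\<in>I. c i * \<omega> p (v i) w)"
    and "\<omega> p w (\<lambda>f. \<Sum>i\<in>I. c i * v i f) = (\<Sum>i\<in>I. c i * \<omega> p w (v i))"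
proof -
  have "\<omega> p (\<lambda>f. \<Sum>i\<in>I. c i * v i f) w = (\<Sum>i\<in>I. c i * \<omega> p (v i) w) \<and>
      \<omega> p w (\<lambda>f. \<Sum>i\<in>I. c i * v i f) = (\<Sum>i\<in>I. c i * \<omega> p w (v i))"
    using assms(1)
  proof (induction I rule: infinite_finite_induct)
    case (insert i I)
    then have "v i \<in> tangent_space A p" "(\<lambda>f. \<Sum>i\<in>I. c i * v i f) \<in> tangent_space A p"
      by (auto intro: tangent_space_sum)
    from form_lincomb[OF this w, of "c i" 1] insert show ?case by simp
  qed (simp_all add: form_zero[OF w])
  then show "\<omega> p (\<lambda>f. \<Sum>i\<in>I. c i * v i f) w = (\<Sum>i\<in>I. c i * \<omega> p (v i) w)"
    "\<omega> p w (\<lambda>f. \<Sum>i\<in>I. c i * v i f) = (\<Sum>i\<in>I. c i * \<omega> p w (v i))" by auto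
qed

lemma form_smooth:
  "X \<in> vector_fields A \<Longrightarrow> Y \<in> vector_fields A \<Longrightarrow> (\<lambda>p. \<omega> p (X p) (Y p)) \<in> smooth_functions A"
  using form unfolding two_form_def by (elim conjE) simp

text \<open>Parallelism turns each of the three derivatives in the invariant formula, and vanishing
  torsion each of the three brackets, into a difference of two terms
  \<open>\<omega> p (D U V p) (W p)\<close>; these twelve terms cancel in pairs.\<close>

lemma closed_form_if_parallel_torsion_free:
  assumes "affine_connection A D" and parallel: "parallel_form A D \<omega>" and tf: "torsion_free A D"
  shows "closed_form A \<omega>"
  unfolding closed_form_def
proof (intro ballI allI)
  interpret manifold_connection A D by unfold_locales (rule assms(1))
  fix X Y Z p
  assume XYZ: "X \<in> vector_fields A" "Y \<in> vector_fields A" "Z \<in> vector_fields A"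
  have DT: "D U V p \<in> tangent_space A p" if "U \<in> vector_fields A" "V \<in> vector_fields A" for U V
    using vector_fieldsD(1)[OF connection_vector_field[OF that]] .
  \<comment> \<open>Skew-symmetry puts the derivative into the first slot of both terms, where the
    bracket terms have it.\<close>
  have deriv: "U p (\<lambda>q. \<omega> q (V q) (W q)) = \<omega> p (D U V p) (W p) - \<omega> p (D U W p) (V p)"
    if "U \<in> vector_fields A" "V \<in> vector_fields A" "W \<in> vector_fields A" for U V W
  proof -
    have "cov_deriv_form D \<omega> U V W p = 0" using parallel that unfolding parallel_form_def by blast
    then show ?thesis
      using form_skew[OF vector_fieldsD(1)[OF that(2)] DT[OF that(1,3)]] by (simp add: cov_deriv_form_def)
  qed
  have bracket: "\<omega> p (lie_bracket U V p) (W p) = \<omega> p (D U V p) (W p) - \<omega> p (D V U p) (W p)"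
    if "U \<in> vector_fields A" "V \<in> vector_fields A" "W \<in> vector_fields A" for U V W
  proof -
    have "torsion D U V = (\<lambda>p f. 0)" using tf that unfolding torsion_free_def by blast
    from fun_cong[OF fun_cong[OF this]]
    have "lie_bracket U V p f = D U V p f - D V U p f" for f
      by (simp add: torsion_def)
    then have "lie_bracket U V p = (\<lambda>f. D U V p f - D V U p f)" by blast
    then show ?thesis
      using form_diff[OF DT[OF that(1,2)] DT[OF that(2,1)] vector_fieldsD(1)[OF that(3)]] by simp
  qed
  show "ext_deriv \<omega> X Y Z p = 0"
    unfolding ext_deriv_def by (simp add: deriv bracket XYZ)
qed

end

section \<open>The form pulled back along the immersion\<close>

locale immersed_two_form = immersed_manifold N M \<iota> + M: manifold_two_form M \<omega>
  for N :: "('n::{t2_space, second_countable_topology}, 'd::euclidean_space) atlas"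
    and M :: "('m::{t2_space, second_countable_topology}, 'e::euclidean_space) atlas"
    and \<iota> :: "'n \<Rightarrow> 'm" and \<omega> :: "'m form2"
begin

text \<open>The first argument is an ambient field that need not be tangent to the submanifold. This
  covers both the pulled back form and the pairings of \<open>D X' Y'\<close> with a frame of the
  submanifold that occur in the projection formula.\<close>

lemma pairing_smooth:
  assumes Y': "Y' \<in> vector_fields M" and Z: "Z \<in> vector_fields N"
  shows "(\<lambda>y. \<omega> (\<iota> y) (Y' (\<iota> y)) (tangent_map M \<iota> (Z y))) \<in> smooth_functions N"
  unfolding N.smooth_functions_iff
proof
  fix x
  obtain Z' where Z': "extends_near M \<iota> x Z Z'" using extend_vector_field[OF Z] .
  have "smooth_near N (\<lambda>y. \<omega> (\<iota> y) (Y' (\<iota> y)) (Z' (\<iota> y))) x"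
    by (rule pullback_smooth_near[OF M.smooth_functionsD[OF M.form_smooth[OF Y' extends_nearD(1)[OF Z']]]])
  moreover have "\<forall>\<^sub>F y in nhds x. \<omega> (\<iota> y) (Y' (\<iota> y)) (tangent_map M \<iota> (Z y)) = \<omega> (\<iota> y) (Y' (\<iota> y)) (Z' (\<iota> y))"
    using extends_nearD(2)[OF Z'] by eventually_elim simp
  ultimately show "smooth_near N (\<lambda>y. \<omega> (\<iota> y) (Y' (\<iota> y)) (tangent_map M \<iota> (Z y))) x"
    by (rule N.smooth_near_cong)
qed

lemma pullback_two_form: "two_form N (pullback_form M \<iota> \<omega>)"
  unfolding two_form_def
proof (intro conjI ballI allI)
  fix x u v w a b
  assume "u \<in> tangent_space N x" "v \<in> tangent_space N x" "w \<in> tangent_space N x"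
  note uvw = this[THEN tangent_map_tangent]
  show "pullback_form M \<iota> \<omega> x (\<lambda>f. a * u f + b * v f) w =
      a * pullback_form M \<iota> \<omega> x u w + b * pullback_form M \<iota> \<omega> x v w"
    and "pullback_form M \<iota> \<omega> x w (\<lambda>f. a * u f + b * v f) =
      a * pullback_form M \<iota> \<omega> x w u + b * pullback_form M \<iota> \<omega> x w v"
    by (simp_all add: pullback_form_def tangent_map_lincomb M.form_lincomb uvw)
next
  fix x v assume "v \<in> tangent_space N x"
  then show "pullback_form M \<iota> \<omega> x v v = 0"
    by (simp add: pullback_form_def M.form_self tangent_map_tangent)
next
  fix Y Z assume Y: "Y \<in> vector_fields N" and Z: "Z \<in> vector_fields N"
  show "(\<lambda>x. pullback_form M \<iota> \<omega> x (Y x) (Z x)) \<in> smooth_functions N"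
    unfolding N.smooth_functions_iff
  proof
    fix x
    obtain Y' where Y': "extends_near M \<iota> x Y Y'" using extend_vector_field[OF Y] .
    have "\<forall>\<^sub>F y in nhds x. pullback_form M \<iota> \<omega> y (Y y) (Z y) = \<omega> (\<iota> y) (Y' (\<iota> y)) (tangent_map M \<iota> (Z y))"
      using extends_nearD(2)[OF Y'] by eventually_elim (simp add: pullback_form_def)
    then show "smooth_near N (\<lambda>x. pullback_form M \<iota> \<omega> x (Y x) (Z x)) x"
      by (rule N.smooth_near_cong[OF N.smooth_functionsD[OF pairing_smooth[OF extends_nearD(1)[OF Y'] Z]]])
  qed
qed

sublocale N: manifold_two_form N "pullback_form M \<iota> \<omega>"
  by unfold_locales (rule pullback_two_form)

end

section \<open>The tangential projection\<close>

locale nondegenerate_submanifold = immersed_two_form N M \<iota> \<omega>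
  for N :: "('n::{t2_space, second_countable_topology}, 'd::euclidean_space) atlas"
    and M :: "('m::{t2_space, second_countable_topology}, 'e::euclidean_space) atlas"
    and \<iota> :: "'n \<Rightarrow> 'm" and \<omega> :: "'m form2" +
  assumes nondegenerate_pullback: "nondegenerate N (pullback_form M \<iota> \<omega>)"
begin

lemma pullback_form_eq_zeroD:
  "v \<in> tangent_space N x \<Longrightarrow> (\<And>w. w \<in> tangent_space N x \<Longrightarrow> pullback_form M \<iota> \<omega> x v w = 0) \<Longrightarrow> v = (\<lambda>f. 0)"
  using nondegenerate_pullback unfolding nondegenerate_def by blast

text \<open>The pairing condition says that the remainder of \<open>u\<close> after subtracting
  \<open>tangent_map M \<iota> v\<close> is normal, so \<open>v\<close> is a candidate;
  nondegeneracy makes it the only one. That such a \<open>v\<close> exists is settled in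
  \<open>tangential_part_frame\<close>.\<close>

lemma tangential_part_eqI:
  assumes u: "u \<in> tangent_space M (\<iota> x)" and v: "v \<in> tangent_space N x"
    and pair: "\<And>w. w \<in> tangent_space N x \<Longrightarrow> pullback_form M \<iota> \<omega> x v w = \<omega> (\<iota> x) u (tangent_map M \<iota> w)"
  shows "tangential_part N M \<omega> \<iota> x u = v"
  unfolding tangential_part_def
proof (rule the_equality)
  define n where "n f = u f - tangent_map M \<iota> v f" for f
  note vM = tangent_map_tangent[OF v]
  have "n \<in> tangent_space M (\<iota> x)"
    using M.tangent_space_lincomb[OF u vM, of 1 "- 1"] unfolding n_def by simp
  moreover have "\<omega> (\<iota> x) n (tangent_map M \<iota> w) = 0" if "w \<in> tangent_space N x" for w
    using M.form_diff[OF u vM tangent_map_tangent[OF that]] pair[OF that]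
    unfolding n_def by (simp add: pullback_form_def)
  ultimately have "n \<in> normal_space N M \<omega> \<iota> x" unfolding normal_space_def by blast
  moreover have "u = (\<lambda>f. tangent_map M \<iota> v f + n f)" by (simp add: n_def)
  ultimately show "v \<in> tangent_space N x \<and> (\<exists>n\<in>normal_space N M \<omega> \<iota> x. u = (\<lambda>f. tangent_map M \<iota> v f + n f))"
    using v by blast
next
  fix v' assume "v' \<in> tangent_space N x \<and> (\<exists>n\<in>normal_space N M \<omega> \<iota> x. u = (\<lambda>f. tangent_map M \<iota> v' f + n f))"
  then obtain n where v': "v' \<in> tangent_space N x" and n: "n \<in> normal_space N M \<omega> \<iota> x"
    and un: "u = (\<lambda>f. tangent_map M \<iota> v' f + n f)" by blast
  have nM: "n \<in> tangent_space M (\<iota> x)" using n unfolding normal_space_def by blast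
  have diff: "(\<lambda>f. v' f - v f) \<in> tangent_space N x"
    using N.tangent_space_lincomb[OF v' v, of 1 "- 1"] by simp
  have "pullback_form M \<iota> \<omega> x (\<lambda>f. v' f - v f) w = 0" if w: "w \<in> tangent_space N x" for w
  proof -
    have "\<omega> (\<iota> x) n (tangent_map M \<iota> w) = 0" using n w unfolding normal_space_def by blast
    then have "\<omega> (\<iota> x) u (tangent_map M \<iota> w) = pullback_form M \<iota> \<omega> x v' w"
      unfolding un by (simp add: M.form_add tangent_map_tangent v' w nM pullback_form_def)
    then show ?thesis using pair[OF w] by (simp add: N.form_diff[OF v' v w])
  qed
  from fun_cong[OF pullback_form_eq_zeroD[OF diff this]] show "v' = v" by (intro ext) simp
qed

text \<open>In a frame \<open>E\<close> of the submanifold the tangential part of \<open>u\<close> is obtained by applying the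
  inverse of the Gram matrix of the pulled back form to the pairings of \<open>u\<close> with \<open>E\<close>; \<open>\<rho>\<close> holds
  the entries of that inverse, which makes the smooth dependence visible.\<close>

lemma tangential_part_frame:
  obtains E :: "'d \<Rightarrow> 'n vfield" and \<rho> :: "'d \<Rightarrow> 'd \<Rightarrow> 'n \<Rightarrow> real" and W
  where "open W" "x\<^sub>0 \<in> W" "\<And>i. E i \<in> vector_fields N"
    "\<And>i j x. x \<in> W \<Longrightarrow> smooth_near N (\<rho> i j) x"
    "\<And>x u. x \<in> W \<Longrightarrow> u \<in> tangent_space M (\<iota> x) \<Longrightarrow> tangential_part N M \<omega> \<iota> x u =
      (\<lambda>f. \<Sum>i\<in>Basis. (\<Sum>j\<in>Basis. \<rho> i j x * \<omega> (\<iota> x) u (tangent_map M \<iota> (E j x))) * E i x f)"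
    "\<And>x u w. x \<in> W \<Longrightarrow> u \<in> tangent_space M (\<iota> x) \<Longrightarrow> w \<in> tangent_space N x \<Longrightarrow>
      pullback_form M \<iota> \<omega> x (tangential_part N M \<omega> \<iota> x u) w = \<omega> (\<iota> x) u (tangent_map M \<iota> w)"
proof -
  obtain e :: "'d \<Rightarrow> 'n \<Rightarrow> real" and E :: "'d \<Rightarrow> 'n vfield" and W where W: "open W" "x\<^sub>0 \<in> W"
    and E: "\<And>b. E b \<in> vector_fields N"
    and E_e: "\<And>q b c. q \<in> W \<Longrightarrow> E b q (e c) = b \<bullet> c"
    and frame: "\<And>q v. q \<in> W \<Longrightarrow> v \<in> tangent_space N q \<Longrightarrow> v = (\<lambda>f. \<Sum>b\<in>Basis. v (e b) * E b q f)"
    by (rule N.frame_exists) (rule that; assumption)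
  note ET = N.vector_fieldsD(1)[OF E]
  \<comment> \<open>The Gram operator: it sends the coordinates \<open>a\<close> of the combination
    \<open>comb x a\<close> to the vector of its pairings with the frame.\<close>
  define A where "A x = (\<Sum>j\<in>Basis. \<Sum>i\<in>Basis. pullback_form M \<iota> \<omega> x (E i x) (E j x) *\<^sub>R
      (blinfun_scaleR_left j o\<^sub>L blinfun_inner_left i))" for x
  define comb where "comb x a = (\<lambda>f. \<Sum>i\<in>Basis. (a \<bullet> i) * E i x f)" for x a
  have comb: "comb x a \<in> tangent_space N x" for x a
    unfolding comb_def by (rule N.tangent_space_sum[OF ET])
  have A_inner: "blinfun_apply (A x) a \<bullet> c = pullback_form M \<iota> \<omega> x (comb x a) (E c x)"
    if c: "c \<in> Basis" for x a c
  proof -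
    have "blinfun_apply (A x) a = (\<Sum>j\<in>Basis. (\<Sum>i\<in>Basis. (a \<bullet> i) * pullback_form M \<iota> \<omega> x (E i x) (E j x)) *\<^sub>R j)"
      by (simp add: A_def blinfun.sum_left scaleR_blinfun.rep_eq scaleR_sum_left mult.commute)
    then have "blinfun_apply (A x) a \<bullet> c = (\<Sum>i\<in>Basis. (a \<bullet> i) * pullback_form M \<iota> \<omega> x (E i x) (E c x))"
      using c by (simp only: inner_sum_left_Basis)
    then show ?thesis unfolding comb_def by (simp add: N.form_sum(1)[OF ET ET])
  qed
  have expand: "\<omega> (\<iota> x) u (tangent_map M \<iota> w) = (\<Sum>c\<in>Basis. w (e c) * \<omega> (\<iota> x) u (tangent_map M \<iota> (E c x)))"
    if "x \<in> W" "u \<in> tangent_space M (\<iota> x)" "w \<in> tangent_space N x" for x u w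
  proof -
    have "tangent_map M \<iota> w = (\<lambda>f. \<Sum>c\<in>Basis. w (e c) * tangent_map M \<iota> (E c x) f)"
      by (subst frame[OF that(1,3)]) (rule tangent_map_sum)
    then show ?thesis using M.form_sum(2)[OF tangent_map_tangent[OF ET] that(2)] by simp
  qed
  \<comment> \<open>A kernel vector gives a tangent vector that pairs to \<open>0\<close> with the
    frame, hence with the whole tangent space, and so vanishes by nondegeneracy; the coordinate
    functions \<open>e c\<close> then show that its coordinates vanish.\<close>
  have "inj (blinfun_apply (A x))" if x: "x \<in> W" for x
  proof -
    have "a = 0" if a: "blinfun_apply (A x) a = 0" for a
    proof -
      have "pullback_form M \<iota> \<omega> x (comb x a) w = 0" if w: "w \<in> tangent_space N x" for w
        using expand[OF x tangent_map_tangent[OF comb] w] A_inner[of _ x a] a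
        unfolding pullback_form_def by simp
      from fun_cong[OF pullback_form_eq_zeroD[OF comb this], of "e c" for c]
      have "(\<Sum>i\<in>Basis. (a \<bullet> i) * (i \<bullet> c)) = 0" for c
        using E_e[OF x] by (simp add: comb_def)
      then have "a \<bullet> c = 0" for c
        using linear_eq_sum_Basis[OF bounded_linear.linear[OF bounded_linear_inner_left], of a c] by simp
      then show ?thesis by (metis inner_eq_zero_iff)
    qed
    then show ?thesis
      using linear_injective_0[OF bounded_linear.linear[OF blinfun.bounded_linear_right]] by blast
  qed
  have "\<exists>R. R o\<^sub>L A x = id_blinfun \<and> A x o\<^sub>L R = id_blinfun" if x: "x \<in> W" for x
  proof -
    have lin: "linear (blinfun_apply (A x))"
      by (rule bounded_linear.linear[OF blinfun.bounded_linear_right])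
    obtain G where G: "linear G" "\<And>a. G (blinfun_apply (A x) a) = a" "\<And>a. blinfun_apply (A x) (G a) = a"
      using linear_injective_isomorphism[OF lin \<open>x \<in> W \<Longrightarrow> inj (blinfun_apply (A x))\<close>[OF x]] by blast
    then have "Blinfun G o\<^sub>L A x = id_blinfun \<and> A x o\<^sub>L Blinfun G = id_blinfun"
      by (auto intro!: blinfun_eqI simp: bounded_linear_Blinfun_apply linear_conv_bounded_linear)
    then show ?thesis by blast
  qed
  \<comment> \<open>\<open>R\<close> is picked at each point separately; its smoothness is not part
    of the choice but follows from that of \<open>A\<close>.\<close>
  then obtain R where R: "\<And>x. x \<in> W \<Longrightarrow> R x o\<^sub>L A x = id_blinfun \<and> A x o\<^sub>L R x = id_blinfun"
    by metis
  have A_smooth: "smooth_near N A x" for x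
    unfolding A_def
    by (intro N.smooth_near_sum N.smooth_near_linear[OF bounded_linear_scaleR_left]
        N.smooth_functionsD[OF N.form_smooth] E)
  define \<rho> where "\<rho> i j x = blinfun_apply (R x) j \<bullet> i" for i j x
  have R_smooth: "smooth_near N R x" if "x \<in> W" for x
  proof (rule N.smooth_near_blinfun_inverse[OF A_smooth])
    show "\<forall>\<^sub>F y in nhds x. R y o\<^sub>L A y = id_blinfun \<and> A y o\<^sub>L R y = id_blinfun"
      using eventually_nhds_in_open[OF W(1) that] by eventually_elim (rule R)
  qed
  have \<rho>: "smooth_near N (\<rho> i j) x" if "x \<in> W" for i j x
    unfolding \<rho>_def
    by (intro N.smooth_near_linear[OF bounded_linear_inner_left]
        N.smooth_near_linear[OF blinfun.bounded_linear_left] R_smooth that)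
  have main: "tangential_part N M \<omega> \<iota> x u =
      (\<lambda>f. \<Sum>i\<in>Basis. (\<Sum>j\<in>Basis. \<rho> i j x * \<omega> (\<iota> x) u (tangent_map M \<iota> (E j x))) * E i x f)
    \<and> (\<forall>w\<in>tangent_space N x. pullback_form M \<iota> \<omega> x (tangential_part N M \<omega> \<iota> x u) w = \<omega> (\<iota> x) u (tangent_map M \<iota> w))"
    if x: "x \<in> W" and u: "u \<in> tangent_space M (\<iota> x)" for x u
  proof -
    \<comment> \<open>\<open>z\<close> lists the pairings of \<open>u\<close> with the frame and
      \<open>a\<close> solves the Gram system for it, so \<open>comb x a\<close> has the same
      pairings as \<open>u\<close>.\<close>
    define z where "z = (\<Sum>j\<in>Basis. \<omega> (\<iota> x) u (tangent_map M \<iota> (E j x)) *\<^sub>R j)"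
    define a where "a = blinfun_apply (R x) z"
    have Aa: "blinfun_apply (A x) a = z"
      using R[OF x] unfolding a_def by (metis blinfun_apply_blinfun_compose blinfun_apply_id_blinfun)
    have a: "a \<bullet> i = (\<Sum>j\<in>Basis. \<rho> i j x * \<omega> (\<iota> x) u (tangent_map M \<iota> (E j x)))" for i
      unfolding a_def z_def \<rho>_def
      by (simp add: blinfun.sum_right blinfun.scaleR_right inner_sum_left mult.commute)
    have pair: "pullback_form M \<iota> \<omega> x (comb x a) w = \<omega> (\<iota> x) u (tangent_map M \<iota> w)"
      if w: "w \<in> tangent_space N x" for w
    proof -
      have "\<omega> (\<iota> x) (tangent_map M \<iota> (comb x a)) (tangent_map M \<iota> (E c x)) = \<omega> (\<iota> x) u (tangent_map M \<iota> (E c x))"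
        if c: "c \<in> Basis" for c
        using A_inner[OF c, of x a] unfolding Aa z_def pullback_form_def
        by (simp only: inner_sum_left_Basis[OF c])
      then show ?thesis
        unfolding pullback_form_def expand[OF x tangent_map_tangent[OF comb] w] expand[OF x u w] by simp
    qed
    have "tangential_part N M \<omega> \<iota> x u = comb x a"
      by (rule tangential_part_eqI[OF u comb pair])
    then show ?thesis using pair by (simp add: comb_def a)
  qed
  show thesis
    by (rule that[OF W, of E \<rho>]) (use E \<rho> main in blast)+
qed

end

section \<open>The induced connection\<close>

locale almost_fedosov_submanifold = nondegenerate_submanifold N M \<iota> \<omega> + M: manifold_connection M D
  for N :: "('n::{t2_space, second_countable_topology}, 'd::euclidean_space) atlas"
    and M :: "('m::{t2_space, second_countable_topology}, 'e::euclidean_space) atlas"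
    and \<iota> :: "'n \<Rightarrow> 'm" and \<omega> :: "'m form2" and D :: "'m connection" +
  assumes parallel: "parallel_form M D \<omega>"
begin

abbreviation induced :: "'n connection"
  where "induced \<equiv> induced_connection N M \<omega> \<iota> D"

section \<open>Independence of the extensions and characterisation by pairings\<close>

lemma deriv_along_eq:
  assumes X: "X \<in> vector_fields N" and X': "extends_near M \<iota> x X X'"
    and Y: "Y \<in> vector_fields N" and Y': "extends_near M \<iota> x Y Y'"
  shows "deriv_along M \<iota> D X Y x = D X' Y' (\<iota> x)"
  unfolding deriv_along_def
proof (rule the_equality)
  show "\<exists>X'' Y''. extends_near M \<iota> x X X'' \<and> extends_near M \<iota> x Y Y'' \<and> D X' Y' (\<iota> x) = D X'' Y'' (\<iota> x)"
    using X' Y' by blast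
next
  fix u assume "\<exists>X'' Y''. extends_near M \<iota> x X X'' \<and> extends_near M \<iota> x Y Y'' \<and> u = D X'' Y'' (\<iota> x)"
  then obtain X'' Y'' where X'': "extends_near M \<iota> x X X''" and Y'': "extends_near M \<iota> x Y Y''"
    and u: "u = D X'' Y'' (\<iota> x)" by blast
  obtain e :: "'e \<Rightarrow> 'm \<Rightarrow> real" and E :: "'e \<Rightarrow> 'm vfield" and W where W: "open W" "\<iota> x \<in> W"
    and e: "\<And>b. e b \<in> smooth_functions M" and E: "\<And>b. E b \<in> vector_fields M"
    and frame: "\<And>q v. q \<in> W \<Longrightarrow> v \<in> tangent_space M q \<Longrightarrow> v = (\<lambda>f. \<Sum>b\<in>Basis. v (e b) * E b q f)"
    by (rule M.frame_exists) (rule that; assumption)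
  have formula: "D U V (\<iota> x) g = (\<Sum>b\<in>Basis. U (\<iota> x) (\<lambda>q. V q (e b)) * E b (\<iota> x) g +
      V (\<iota> x) (e b) * (\<Sum>c\<in>Basis. U (\<iota> x) (e c) * D (E c) (E b) (\<iota> x) g))"
    if "U \<in> vector_fields M" "V \<in> vector_fields M" for U V g
    by (rule M.connection_local_formula[OF W e E frame]) (use that in auto)
  \<comment> \<open>The derivative term of the local formula does not see the extensions:
    \<open>V' (\<iota> x)\<close> is a pushed forward vector and differentiates only the restriction
    to the submanifold, where near \<open>x\<close> the component of \<open>Z'\<close> is that of
    \<open>Z\<close>.\<close>
  have coeff: "V' (\<iota> x) (\<lambda>q. Z' q (e b)) = X x (\<lambda>y. Z y (\<lambda>z. e b (\<iota> z)))"
    if V': "extends_near M \<iota> x X V'" and Z: "Z \<in> vector_fields N" and Z': "extends_near M \<iota> x Z Z'" for V' Z Z' b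
  proof (rule extends_near_apply[OF X V'])
    show "(\<lambda>q. Z' q (e b)) \<in> smooth_functions M"
      by (rule M.vector_fieldsD(2)[OF extends_nearD(1)[OF Z'] e])
    show "(\<lambda>y. Z y (\<lambda>z. e b (\<iota> z))) \<in> smooth_functions N"
      by (rule N.vector_fieldsD(2)[OF Z pullback_smooth[OF e]])
    show "\<forall>\<^sub>F y in nhds x. Z' (\<iota> y) (e b) = Z y (\<lambda>z. e b (\<iota> z))"
      using extends_nearD(2)[OF Z'] by eventually_elim (simp add: tangent_map_apply[OF e])
  qed
  have "D X'' Y'' (\<iota> x) g = D X' Y' (\<iota> x) g" for g
    unfolding formula[OF extends_nearD(1)[OF X''] extends_nearD(1)[OF Y'']]
      formula[OF extends_nearD(1)[OF X'] extends_nearD(1)[OF Y']]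
      coeff[OF X'' Y Y''] coeff[OF X' Y Y']
    unfolding extends_nearD(3)[OF X''] extends_nearD(3)[OF Y''] extends_nearD(3)[OF X'] extends_nearD(3)[OF Y'] ..
  then show "u = D X' Y' (\<iota> x)" unfolding u by blast
qed

lemma ambient_derivative_tangent:
  "extends_near M \<iota> x X X' \<Longrightarrow> extends_near M \<iota> x Y Y' \<Longrightarrow> D X' Y' (\<iota> x) \<in> tangent_space M (\<iota> x)"
  by (intro M.vector_fieldsD(1) M.connection_vector_field extends_nearD(1))

lemma induced_eq:
  assumes "X \<in> vector_fields N" "extends_near M \<iota> x X X'" "Y \<in> vector_fields N" "extends_near M \<iota> x Y Y'"
  shows "induced X Y x = tangential_part N M \<omega> \<iota> x (D X' Y' (\<iota> x))"
  unfolding induced_connection_def deriv_along_eq[OF assms] ..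

lemma induced_eqI:
  assumes "X \<in> vector_fields N" "extends_near M \<iota> x X X'" "Y \<in> vector_fields N" "extends_near M \<iota> x Y Y'"
    and "v \<in> tangent_space N x"
    and "\<And>w. w \<in> tangent_space N x \<Longrightarrow>
      pullback_form M \<iota> \<omega> x v w = \<omega> (\<iota> x) (D X' Y' (\<iota> x)) (tangent_map M \<iota> w)"
  shows "induced X Y x = v"
  unfolding induced_eq[OF assms(1-4)]
  by (rule tangential_part_eqI[OF ambient_derivative_tangent[OF assms(2,4)] assms(5,6)])

text \<open>Complements \<open>induced_eqI\<close>: there a vector with the right pairings is given,
  here the induced derivative itself is shown to have them, which rests on the existence of the
  tangential part.\<close>

lemma induced_pairing:
  assumes "X \<in> vector_fields N" "extends_near M \<iota> x X X'" "Y \<in> vector_fields N" "extends_near M \<iota> x Y Y'"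
    and "w \<in> tangent_space N x"
  shows "pullback_form M \<iota> \<omega> x (induced X Y x) w = \<omega> (\<iota> x) (D X' Y' (\<iota> x)) (tangent_map M \<iota> w)"
proof -
  obtain W where "x \<in> W"
    "\<And>y u w. y \<in> W \<Longrightarrow> u \<in> tangent_space M (\<iota> y) \<Longrightarrow> w \<in> tangent_space N y \<Longrightarrow>
      pullback_form M \<iota> \<omega> y (tangential_part N M \<omega> \<iota> y u) w = \<omega> (\<iota> y) u (tangent_map M \<iota> w)"
    by (rule tangential_part_frame[of x]) (rule that; assumption)
  then show ?thesis
    unfolding induced_eq[OF assms(1-4)] using ambient_derivative_tangent[OF assms(2,4)] assms(5) by blast
qed

section \<open>Smoothness and the axioms of an affine connection\<close>

text \<open>Fixed extensions compute the induced derivative at every point near \<open>x\<close>.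
  There the Gram formula \<open>V\<close> for the tangential part exhibits it as a combination of
  smooth fields whose coefficients are smooth at \<open>x\<close>.\<close>

lemma induced_vector_field:
  assumes X: "X \<in> vector_fields N" and Y: "Y \<in> vector_fields N"
  shows "induced X Y \<in> vector_fields N"
proof -
  have local: "induced X Y x \<in> tangent_space N x \<and>
      (\<forall>f\<in>smooth_functions N. smooth_near N (\<lambda>y. induced X Y y f) x)" for x
  proof -
    obtain X' where X': "extends_near M \<iota> x X X'" using extend_vector_field[OF X] .
    obtain Y' where Y': "extends_near M \<iota> x Y Y'" using extend_vector_field[OF Y] .
    obtain E :: "'d \<Rightarrow> 'n vfield" and \<rho> :: "'d \<Rightarrow> 'd \<Rightarrow> 'n \<Rightarrow> real" and W
      where W: "open W" "x \<in> W" and E: "\<And>i. E i \<in> vector_fields N"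
      and \<rho>: "\<And>i j x. x \<in> W \<Longrightarrow> smooth_near N (\<rho> i j) x"
      and part: "\<And>x u. x \<in> W \<Longrightarrow> u \<in> tangent_space M (\<iota> x) \<Longrightarrow> tangential_part N M \<omega> \<iota> x u =
        (\<lambda>f. \<Sum>i\<in>Basis. (\<Sum>j\<in>Basis. \<rho> i j x * \<omega> (\<iota> x) u (tangent_map M \<iota> (E j x))) * E i x f)"
      by (rule tangential_part_frame[of x]) (rule that; assumption)
    define V where "V y f = (\<Sum>i\<in>Basis. (\<Sum>j\<in>Basis. \<rho> i j y *
        \<omega> (\<iota> y) (D X' Y' (\<iota> y)) (tangent_map M \<iota> (E j y))) * E i y f)" for y f
    have eq: "\<forall>\<^sub>F y in nhds x. induced X Y y = V y"
      using eventually_nhds_in_open[OF W] eventually_extends_near[OF X'] eventually_extends_near[OF Y']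
    proof eventually_elim
      case (elim y)
      show ?case
        unfolding induced_eq[OF X elim(2) Y elim(3)] V_def
        by (rule part[OF elim(1) ambient_derivative_tangent[OF elim(2,3)]])
    qed
    have "V x \<in> tangent_space N x"
      unfolding V_def by (rule N.tangent_space_sum[OF N.vector_fieldsD(1)[OF E]])
    moreover have "smooth_near N (\<lambda>y. induced X Y y f) x" if f: "f \<in> smooth_functions N" for f
    proof (rule N.smooth_near_cong)
      have "D X' Y' \<in> vector_fields M"
        by (rule M.connection_vector_field[OF extends_nearD(1)[OF X'] extends_nearD(1)[OF Y']])
      then show "smooth_near N (\<lambda>y. V y f) x"
        unfolding V_def
        by (intro N.smooth_near_sum N.smooth_near_bilinear[OF bounded_bilinear_mult] \<rho>[OF W(2)]
            N.smooth_functionsD[OF pairing_smooth] N.smooth_functionsD[OF N.vector_fieldsD(2)] E f)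
      show "\<forall>\<^sub>F y in nhds x. induced X Y y f = V y f"
        using eq by eventually_elim simp
    qed
    ultimately show ?thesis using eventually_nhds_x_imp_x[OF eq] by simp
  qed
  then show ?thesis by (intro N.vector_fieldsI) (simp_all add: N.smooth_functions_iff)
qed

lemma induced_tangent:
  "X \<in> vector_fields N \<Longrightarrow> Y \<in> vector_fields N \<Longrightarrow> induced X Y x \<in> tangent_space N x"
  by (rule N.vector_fieldsD(1)[OF induced_vector_field])

lemma extends_near_add:
  assumes "extends_near M \<iota> x X X'" "extends_near M \<iota> x Y Y'"
  shows "extends_near M \<iota> x (\<lambda>y g. X y g + Y y g) (\<lambda>q g. X' q g + Y' q g)"
proof -
  have "\<forall>\<^sub>F y in nhds x. (\<lambda>g. X' (\<iota> y) g + Y' (\<iota> y) g) = tangent_map M \<iota> (\<lambda>g. X y g + Y y g)"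
    using extends_nearD(2)[OF assms(1)] extends_nearD(2)[OF assms(2)]
    by eventually_elim (use tangent_map_lincomb[of M \<iota> 1 _ 1] in simp)
  then show ?thesis
    unfolding extends_near_def using M.vector_fields_add extends_nearD(1) assms by blast
qed

lemma extends_near_mult:
  assumes "extends_near M \<iota> x X X'" "f' \<in> smooth_functions M" "\<forall>\<^sub>F y in nhds x. f' (\<iota> y) = f y"
  shows "extends_near M \<iota> x (\<lambda>y g. f y * X y g) (\<lambda>q g. f' q * X' q g)"
proof -
  have "\<forall>\<^sub>F y in nhds x. (\<lambda>g. f' (\<iota> y) * X' (\<iota> y) g) = tangent_map M \<iota> (\<lambda>g. f y * X y g)"
    using extends_nearD(2)[OF assms(1)] assms(3)
    by eventually_elim (use tangent_map_lincomb[of M \<iota> _ _ 0] in simp)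
  then show ?thesis
    unfolding extends_near_def using M.vector_fields_mult extends_nearD(1) assms by blast
qed

lemma induced_add:
  assumes X: "X \<in> vector_fields N" and Y: "Y \<in> vector_fields N" and Z: "Z \<in> vector_fields N"
  shows "induced (\<lambda>p g. X p g + Y p g) Z = (\<lambda>p g. induced X Z p g + induced Y Z p g)"
    and "induced Z (\<lambda>p g. X p g + Y p g) = (\<lambda>p g. induced Z X p g + induced Z Y p g)"
proof -
  have "induced (\<lambda>p g. X p g + Y p g) Z x = (\<lambda>g. induced X Z x g + induced Y Z x g) \<and>
      induced Z (\<lambda>p g. X p g + Y p g) x = (\<lambda>g. induced Z X x g + induced Z Y x g)" for x
  proof -
    obtain X' where X': "extends_near M \<iota> x X X'" using extend_vector_field[OF X] .
    obtain Y' where Y': "extends_near M \<iota> x Y Y'" using extend_vector_field[OF Y] .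
    obtain Z' where Z': "extends_near M \<iota> x Z Z'" using extend_vector_field[OF Z] .
    note XY = N.vector_fields_add[OF X Y] and XY' = extends_near_add[OF X' Y']
    note D = M.connection_add[OF extends_nearD(1)[OF X'] extends_nearD(1)[OF Y'] extends_nearD(1)[OF Z']]
    note T = N.tangent_space_lincomb[OF induced_tangent induced_tangent, where a = 1 and b = 1, simplified]
    have "induced (\<lambda>p g. X p g + Y p g) Z x = (\<lambda>g. induced X Z x g + induced Y Z x g)"
      by (rule induced_eqI[OF XY XY' Z Z' T[OF X Z Y Z]])
        (simp add: D N.form_add induced_tangent X Y Z induced_pairing[OF X X' Z Z'] induced_pairing[OF Y Y' Z Z']
          M.form_add ambient_derivative_tangent[OF X' Z'] ambient_derivative_tangent[OF Y' Z'] tangent_map_tangent)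
    moreover have "induced Z (\<lambda>p g. X p g + Y p g) x = (\<lambda>g. induced Z X x g + induced Z Y x g)"
      by (rule induced_eqI[OF Z Z' XY XY' T[OF Z X Z Y]])
        (simp add: D N.form_add induced_tangent X Y Z induced_pairing[OF Z Z' X X'] induced_pairing[OF Z Z' Y Y']
          M.form_add ambient_derivative_tangent[OF Z' X'] ambient_derivative_tangent[OF Z' Y'] tangent_map_tangent)
    ultimately show ?thesis ..
  qed
  then show "induced (\<lambda>p g. X p g + Y p g) Z = (\<lambda>p g. induced X Z p g + induced Y Z p g)"
    and "induced Z (\<lambda>p g. X p g + Y p g) = (\<lambda>p g. induced Z X p g + induced Z Y p g)"
    by auto
qed

text \<open>For the second rule, the Leibniz rule of \<open>D\<close> on the extensions produces the
  summand \<open>X x f\<close> times the image of \<open>Y x\<close>, which is already tangent to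
  the submanifold; only the other summand is changed by the projection.\<close>

lemma induced_mult:
  assumes X: "X \<in> vector_fields N" and Y: "Y \<in> vector_fields N" and f: "f \<in> smooth_functions N"
  shows "induced (\<lambda>p g. f p * X p g) Y = (\<lambda>p g. f p * induced X Y p g)"
    and "induced X (\<lambda>p g. f p * Y p g) = (\<lambda>p g. X p f * Y p g + f p * induced X Y p g)"
proof -
  have "induced (\<lambda>p g. f p * X p g) Y x = (\<lambda>g. f x * induced X Y x g) \<and>
      induced X (\<lambda>p g. f p * Y p g) x = (\<lambda>g. X x f * Y x g + f x * induced X Y x g)" for x
  proof -
    obtain X' where X': "extends_near M \<iota> x X X'" using extend_vector_field[OF X] .
    obtain Y' where Y': "extends_near M \<iota> x Y Y'" using extend_vector_field[OF Y] .
    obtain f' where f': "f' \<in> smooth_functions M" "\<forall>\<^sub>F y in nhds x. f' (\<iota> y) = f y"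
      using extend_function[OF f] .
    note fx = eventually_nhds_x_imp_x[OF f'(2)] and Xf = extends_near_apply[OF X X' f'(1) f f'(2)]
    note D = M.connection_mult[OF extends_nearD(1)[OF X'] extends_nearD(1)[OF Y'] f'(1)]
    note DT = ambient_derivative_tangent[OF X' Y']
    have "induced (\<lambda>p g. f p * X p g) Y x = (\<lambda>g. f x * induced X Y x g)"
    proof (rule induced_eqI[OF N.vector_fields_mult[OF f X] extends_near_mult[OF X' f'] Y Y'])
      show "(\<lambda>g. f x * induced X Y x g) \<in> tangent_space N x"
        using N.tangent_space_lincomb[OF induced_tangent[OF X Y] induced_tangent[OF X Y], where a = "f x" and b = 0] by simp
    qed (simp add: D N.form_cmult induced_tangent X Y induced_pairing[OF X X' Y Y'] M.form_cmult[OF DT]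
        tangent_map_tangent fx)
    moreover have "induced X (\<lambda>p g. f p * Y p g) x = (\<lambda>g. X x f * Y x g + f x * induced X Y x g)"
    proof (rule induced_eqI[OF X X' N.vector_fields_mult[OF f Y] extends_near_mult[OF Y' f']])
      show "(\<lambda>g. X x f * Y x g + f x * induced X Y x g) \<in> tangent_space N x"
        by (rule N.tangent_space_lincomb[OF N.vector_fieldsD(1)[OF Y] induced_tangent[OF X Y]])
    next
      fix w assume w: "w \<in> tangent_space N x"
      show "pullback_form M \<iota> \<omega> x (\<lambda>g. X x f * Y x g + f x * induced X Y x g) w =
          \<omega> (\<iota> x) (D X' (\<lambda>q g. f' q * Y' q g) (\<iota> x)) (tangent_map M \<iota> w)"
        unfolding D(2) Xf fx extends_nearD(3)[OF Y']
          N.form_lincomb(1)[OF N.vector_fieldsD(1)[OF Y] induced_tangent[OF X Y] w]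
          M.form_lincomb(1)[OF tangent_map_tangent[OF N.vector_fieldsD(1)[OF Y]] DT tangent_map_tangent[OF w]]
          induced_pairing[OF X X' Y Y' w]
        by (simp add: pullback_form_def)
    qed
    ultimately show ?thesis ..
  qed
  then show "induced (\<lambda>p g. f p * X p g) Y = (\<lambda>p g. f p * induced X Y p g)"
    and "induced X (\<lambda>p g. f p * Y p g) = (\<lambda>p g. X p f * Y p g + f p * induced X Y p g)"
    by auto
qed

lemma induced_affine: "affine_connection N induced"
  unfolding affine_connection_def
  by (intro conjI ballI induced_vector_field induced_add induced_mult; assumption)

section \<open>Parallelism, brackets and torsion\<close>

text \<open>In the ambient identity at \<open>\<iota> x\<close> the derivatives of the extensions
  are paired only with vectors tangent to the submanifold, and such pairings do not see the normal
  component that the projection removes.\<close>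

lemma induced_parallel: "parallel_form N induced (pullback_form M \<iota> \<omega>)"
  unfolding parallel_form_def
proof (intro ballI allI)
  fix X Y Z x
  assume X: "X \<in> vector_fields N" and Y: "Y \<in> vector_fields N" and Z: "Z \<in> vector_fields N"
  obtain X' where X': "extends_near M \<iota> x X X'" using extend_vector_field[OF X] .
  obtain Y' where Y': "extends_near M \<iota> x Y Y'" using extend_vector_field[OF Y] .
  obtain Z' where Z': "extends_near M \<iota> x Z Z'" using extend_vector_field[OF Z] .
  note YT = N.vector_fieldsD(1)[OF Y] and ZT = N.vector_fieldsD(1)[OF Z]
  have "X' (\<iota> x) (\<lambda>q. \<omega> q (Y' q) (Z' q)) = X x (\<lambda>y. pullback_form M \<iota> \<omega> y (Y y) (Z y))"
  proof (rule extends_near_apply[OF X X' M.form_smooth[OF extends_nearD(1)[OF Y'] extends_nearD(1)[OF Z']]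
        N.form_smooth[OF Y Z]])
    show "\<forall>\<^sub>F y in nhds x. \<omega> (\<iota> y) (Y' (\<iota> y)) (Z' (\<iota> y)) = pullback_form M \<iota> \<omega> y (Y y) (Z y)"
      using extends_nearD(2)[OF Y'] extends_nearD(2)[OF Z'] by eventually_elim (simp add: pullback_form_def)
  qed
  moreover have "cov_deriv_form D \<omega> X' Y' Z' (\<iota> x) = 0"
    using parallel extends_nearD(1)[OF X'] extends_nearD(1)[OF Y'] extends_nearD(1)[OF Z']
    unfolding parallel_form_def by blast
  \<comment> \<open>\<open>induced_pairing\<close> speaks of the first slot only; skew-symmetry on
    both manifolds brings the derivative of \<open>Z\<close> there.\<close>
  ultimately show "cov_deriv_form induced (pullback_form M \<iota> \<omega>) X Y Z x = 0"
    using induced_pairing[OF X X' Y Y' ZT] induced_pairing[OF X X' Z Z' YT]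
      N.form_skew[OF YT induced_tangent[OF X Z]]
      M.form_skew[OF tangent_map_tangent[OF YT] ambient_derivative_tangent[OF X' Z']]
    by (simp add: cov_deriv_form_def extends_nearD(3)[OF Y'] extends_nearD(3)[OF Z'])
qed

text \<open>The classical argument for \<iota>-related fields: both iterated derivatives of
  \<open>f\<close> at \<open>\<iota> x\<close> equal those of \<open>f \<circ> \<iota>\<close> at
  \<open>x\<close>. Relatedness near \<open>x\<close> suffices, as only germs enter.\<close>

lemma lie_bracket_related:
  assumes X: "X \<in> vector_fields N" and X': "extends_near M \<iota> x X X'"
    and Y: "Y \<in> vector_fields N" and Y': "extends_near M \<iota> x Y Y'"
  shows "lie_bracket X' Y' (\<iota> x) = tangent_map M \<iota> (lie_bracket X Y x)"
proof (rule M.tangent_eqI)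
  show "lie_bracket X' Y' (\<iota> x) \<in> tangent_space M (\<iota> x)"
    by (rule M.lie_bracket_tangent[OF extends_nearD(1)[OF X'] extends_nearD(1)[OF Y']])
  show "tangent_map M \<iota> (lie_bracket X Y x) \<in> tangent_space M (\<iota> x)"
    by (rule tangent_map_tangent[OF N.lie_bracket_tangent[OF X Y]])
next
  fix f assume f: "f \<in> smooth_functions M"
  have "U' (\<iota> x) (\<lambda>q. V' q f) = U x (\<lambda>y. V y (\<lambda>z. f (\<iota> z)))"
    if U: "U \<in> vector_fields N" "extends_near M \<iota> x U U'"
      and V: "V \<in> vector_fields N" and V': "extends_near M \<iota> x V V'" for U U' V V'
  proof (rule extends_near_apply[OF U])
    show "(\<lambda>q. V' q f) \<in> smooth_functions M"
      by (rule M.vector_fieldsD(2)[OF extends_nearD(1)[OF V'] f])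
    show "(\<lambda>y. V y (\<lambda>z. f (\<iota> z))) \<in> smooth_functions N"
      by (rule N.vector_fieldsD(2)[OF V pullback_smooth[OF f]])
    show "\<forall>\<^sub>F y in nhds x. V' (\<iota> y) f = V y (\<lambda>z. f (\<iota> z))"
      using extends_nearD(2)[OF V'] by eventually_elim (simp add: tangent_map_apply[OF f])
  qed
  from this[OF X X' Y Y'] this[OF Y Y' X X']
  show "lie_bracket X' Y' (\<iota> x) f = tangent_map M \<iota> (lie_bracket X Y x) f"
    by (simp add: lie_bracket_def tangent_map_apply[OF f])
qed

text \<open>For the extensions, the difference of \<open>D X' Y'\<close> and \<open>D Y' X'\<close>
  at \<open>\<iota> x\<close> is the image of the bracket of \<open>X\<close> and \<open>Y\<close>,
  hence tangent to the submanifold, and the projection leaves it alone.\<close>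

lemma induced_torsion_free:
  assumes tf: "torsion_free M D"
  shows "torsion_free N induced"
  unfolding torsion_free_def
proof (intro ballI)
  fix X Y assume X: "X \<in> vector_fields N" and Y: "Y \<in> vector_fields N"
  have "induced X Y x = (\<lambda>f. induced Y X x f + lie_bracket X Y x f)" for x
  proof -
    obtain X' where X': "extends_near M \<iota> x X X'" using extend_vector_field[OF X] .
    obtain Y' where Y': "extends_near M \<iota> x Y Y'" using extend_vector_field[OF Y] .
    note BT = N.lie_bracket_tangent[OF X Y]
    have "torsion D X' Y' = (\<lambda>p f. 0)"
      using tf extends_nearD(1)[OF X'] extends_nearD(1)[OF Y'] unfolding torsion_free_def by blast
    from fun_cong[OF fun_cong[OF this]]
    have "D X' Y' (\<iota> x) f = D Y' X' (\<iota> x) f + lie_bracket X' Y' (\<iota> x) f" for f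
      by (simp add: torsion_def algebra_simps)
    then have D: "D X' Y' (\<iota> x) = (\<lambda>f. D Y' X' (\<iota> x) f + tangent_map M \<iota> (lie_bracket X Y x) f)"
      unfolding lie_bracket_related[OF X X' Y Y'] by blast
    show ?thesis
    proof (rule induced_eqI[OF X X' Y Y'])
      show "(\<lambda>f. induced Y X x f + lie_bracket X Y x f) \<in> tangent_space N x"
        using N.tangent_space_lincomb[OF induced_tangent[OF Y X] BT, where a = 1 and b = 1] by simp
    next
      fix w assume w: "w \<in> tangent_space N x"
      show "pullback_form M \<iota> \<omega> x (\<lambda>f. induced Y X x f + lie_bracket X Y x f) w =
          \<omega> (\<iota> x) (D X' Y' (\<iota> x)) (tangent_map M \<iota> w)"
        unfolding D N.form_add(1)[OF induced_tangent[OF Y X] BT w]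
          M.form_add(1)[OF ambient_derivative_tangent[OF Y' X'] tangent_map_tangent[OF BT] tangent_map_tangent[OF w]]
          induced_pairing[OF Y Y' X X' w]
        by (simp add: pullback_form_def)
    qed
  qed
  then show "torsion induced X Y = (\<lambda>p f. 0)" by (intro ext) (simp add: torsion_def)
qed

end

theorem proposition2p4:
  fixes M :: "('m::{t2_space, second_countable_topology}, 'e::euclidean_space) atlas"
    and N :: "('n::{t2_space, second_countable_topology}, 'd::euclidean_space) atlas"
    and \<omega> :: "'m form2" and D :: "'m connection" and \<iota> :: "'n \<Rightarrow> 'm"
  assumes "DIM('e) > 4"
    and "almost_fedosov_manifold M \<omega> D"
    and "almost_symplectic_submanifold N M \<omega> \<iota>"
  shows "almost_symplectic_connection N (pullback_form M \<iota> \<omega>) (induced_connection N M \<omega> \<iota> D) \<and>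
    (torsion_free M D \<longrightarrow>
      symplectic_submanifold N M \<omega> \<iota> \<and>
      symplectic_connection N (pullback_form M \<iota> \<omega>) (induced_connection N M \<omega> \<iota> D))"
proof -
  interpret almost_fedosov_submanifold N M \<iota> \<omega> D
    using assms(2,3)
    unfolding almost_fedosov_manifold_def almost_symplectic_manifold_def almost_symplectic_connection_def
      almost_symplectic_submanifold_def
    by unfold_locales auto
  have "almost_symplectic_connection N (pullback_form M \<iota> \<omega>) induced"
    unfolding almost_symplectic_connection_def using induced_affine induced_parallel ..
  \<comment> \<open>Closedness is obtained on the submanifold itself, from the induced connection,
    and not by pulling back closedness of \<open>\<omega>\<close>.\<close>
  moreover have "closed_form N (pullback_form M \<iota> \<omega>)" if "torsion_free M D"
    by (rule N.closed_form_if_parallel_torsion_free[OF induced_affine induced_parallel induced_torsion_free[OF that]])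
  ultimately show ?thesis
    unfolding symplectic_submanifold_def symplectic_connection_def
    using assms(3) induced_torsion_free by blast
qed

end
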